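(* Let $C$ be a curve of degree $d$. Let $(n_1,\dots,n_k,m_1,\dots,m_l)\in\mathbb{N}^{k+l}$ be a $(k+l)$-tuple such that $\sum_{i=1}^k n_i=\sum_{j=1}^l m_j$, and let $\tilde C=T_{(n_1,\dots,n_k;m_1,\dots,m_l)}(C)$. Then $\tilde C$ has $k+1$ additional singularities to those of $C$: $k$ $d$-tacnodes of order $n_i-1$ ($1\le i\le k$), and another singular point which is a blow down of $l$ $d$-tacnodes of order $m_j-1$ ($1\le j\le l$) on the exceptional section of that blow down (i.e., the curve has the following additional singularities: $[d_{n_1}],\dots,[d_{n_k}]$ and $[d(n_1+\cdots+n_k),([d_{m_1}],\dots,[d_{m_l}])]$).
   Context: Curves are complex plane projective curves and $\mathbb{N}=\{1,2,3,\dots\}$. Singularity types: if a singular point $P$ is resolved by a sequence of $s$ blow-ups, with only one singular point appearing at each blow-up, and $t_i>1$ ($1\le i\le s$) is the multiplicity of the curve at $P$ before the $i$-th blow-up, then $[t_1,\dots,t_s]$ is called the type of the singularity. A sequence of $r$ equal multiplicities $l$ is abbreviated $l_r$ (e.g. $[2,2,2]=[2_3]$). The notation $[t,(\tau_1,\dots,\tau_l)]$ denotes a singular point of multiplicity $t$ which after the first blow-up splits into $l$ singular points of types $\tau_1,\dots,\tau_l$. A $d$-tacnode is a singular point where $d$ smooth branches of the curve have a common tangent at the same point; a $d$-tacnode of order $k$ is a $d$-tacnode such that the higher derivatives of the branches are also equal up to order $k$ (the usual tacnode is a $2$-tacnode of order $1$). A blow down of $l$ $d$-tacnodes is the singular point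 obtained from $l$ $d$-tacnodes located on an exceptional curve when that curve is blown down. The Hirzebruch surface $F_n$ is the $\mathbb{P}^1$-bundle over $\mathbb{P}^1$ whose exceptional section has self-intersection $-n$. Elementary transformations: the first type ($F_n$ to $F_{n+1}$) blows up a point on the exceptional section and then blows down the proper transform of the fiber through that point. The second type ($F_n$ to $F_{n-1}$) blows up a point on a fiber $Q$, outside the exceptional section, and then blows down the proper transform of $Q$. In both cases the transformation is said to be performed on that fiber; the new fiber (the exceptional curve of the blow-up) replaces the old one and is called its proper transform. Construction of $T_{(n_1,\dots,n_k;m_1,\dots,m_l)}$: take $k+l$ different lines $Q_1,\dots,Q_k$ and $P_1,\dots,P_l$, all meeting $C$ transversally and all intersecting in a point $O$ outside $C$, in such a way that, for a disk $D$ centered at $O$, the intersection points of the lines with the boundary of $D$ are organized counterclockwise. Blow up $O$ to get $F_1$. Apply $n_i$ elementary transformations of the first type on the proper transform of $Q_i$ for all $i$, reaching $F_{(\sum n_i)+1}$. Then apply $m_j$ elementary transformations of the second type on the proper transform of $P_j$ for all $j$, returning to $F_1$. Finally blow down the exceptional section to get $\mathbb{P}^2$. This defines the Cremona transformation $T_{(n_1,\dots,n_k;m_1,\dots,m_l)}$; the image of $C$ is its proper transform.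
   Formalization: Assumes d ≥ 2 and k ≥ 1, and that points blown up in second-type elementary transformations lie off the current proper transform of C; otherwise the claim fails (for d = 1 the [1_n] points are smooth; a centre on C leaves fewer than d branches). *)

theory Defs
  imports "HOL-Analysis.Analysis"
begin

text \<open>
  Points of \<open>P\<^sup>2\<close> and of the Hirzebruch surfaces are orbits of homogeneous coordinate vectors,
  i.e. sets of representatives; curves are sets of such points.
\<close>

section \<open>Plane curves\<close>

type_synonym p2_point = "(complex ^ 3) set"

definition ppt :: "complex ^ 3 \<Rightarrow> p2_point" where
  "ppt v = {c *s v | c. c \<noteq> 0}"

text \<open>Over an infinite field a form is determined by the function it induces.\<close>

definition ternary_form :: "nat \<Rightarrow> (complex ^ 3 \<Rightarrow> complex) \<Rightarrow> bool" where
  "ternary_form d F \<longleftrightarrow>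
     (\<exists>c. \<forall>v. F v = (\<Sum>i\<le>d. \<Sum>j\<le>d - i. c i j * (v $ 1) ^ i * (v $ 2) ^ j * (v $ 3) ^ (d - i - j)))"

definition plane_curve :: "nat \<Rightarrow> (complex ^ 3 \<Rightarrow> complex) \<Rightarrow> bool" where
  "plane_curve d F \<longleftrightarrow> ternary_form d F \<and> (\<exists>v. F v \<noteq> 0)"

text \<open>Factors of a form are forms, so it suffices to exclude repeated homogeneous factors.\<close>

definition reduced_curve :: "nat \<Rightarrow> (complex ^ 3 \<Rightarrow> complex) \<Rightarrow> bool" where
  "reduced_curve d F \<longleftrightarrow> plane_curve d F \<and>
     (\<forall>r g h. 1 \<le> r \<and> 2 * r \<le> d \<and> ternary_form r g \<and> ternary_form (d - 2 * r) h
        \<longrightarrow> F \<noteq> (\<lambda>v. (g v)\<^sup>2 * h v))"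

definition curve_points :: "(complex ^ 3 \<Rightarrow> complex) \<Rightarrow> p2_point set" where
  "curve_points F = {ppt v | v. v \<noteq> 0 \<and> F v = 0}"

definition sing_points :: "(complex ^ 3 \<Rightarrow> complex) \<Rightarrow> p2_point set" where
  "sing_points F =
     {ppt v | v. v \<noteq> 0 \<and> F v = 0 \<and> (F has_derivative (\<lambda>_. 0)) (at v)}"

text \<open>
  The line spanned by \<open>u\<close> and \<open>v\<close> meets the curve transversally: at every common point the
  differential of \<open>F\<close> does not vanish along the line, so the intersection multiplicity is one.
\<close>

definition meets_transversally ::
    "(complex ^ 3 \<Rightarrow> complex) \<Rightarrow> complex ^ 3 \<Rightarrow> complex ^ 3 \<Rightarrow> bool" where
  "meets_transversally F u v \<longleftrightarrow>
     (\<forall>w \<in> {b *s u + c *s v | b c. True}. w \<noteq> 0 \<and> F w = 0 \<longrightarrow>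
        (\<exists>D. (F has_derivative D) (at w) \<and>
             (\<exists>h \<in> {b *s u + c *s v | b c. True}. D h \<noteq> 0)))"

section \<open>Germs of plane curves and their singularity types\<close>

text \<open>All germs are germs at the origin of \<open>C\<^sup>2\<close>.\<close>

definition holo2 :: "(complex \<times> complex \<Rightarrow> complex) \<Rightarrow> bool" where
  "holo2 f \<longleftrightarrow>
     (\<forall>\<^sub>F x in nhds 0. \<exists>a b. (f has_derivative (\<lambda>(h, k). a * h + b * k)) (at x))"

text \<open>
  A local holomorphic coordinate system of \<open>P\<^sup>2\<close> at \<open>p\<close>, given by a lift to homogeneous
  coordinates.  It is an immersion into \<open>P\<^sup>2\<close> iff \<open>\<psi>\<close> and its two partial derivatives
  are linearly independent.  Then \<open>F \<circ> \<psi>\<close> is a local equation at \<open>p\<close> of the curve \<open>F = 0\<close>.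
\<close>

definition local_coords :: "(complex \<times> complex \<Rightarrow> complex ^ 3) \<Rightarrow> p2_point \<Rightarrow> bool" where
  "local_coords \<psi> p \<longleftrightarrow>
     (\<forall>i. holo2 (\<lambda>x. \<psi> x $ i)) \<and> \<psi> 0 \<noteq> 0 \<and> p = ppt (\<psi> 0) \<and>
     (\<exists>D. (\<psi> has_derivative D) (at 0) \<and>
          det (vector [\<psi> 0, D (1, 0), D (0, 1)] :: complex ^ 3 ^ 3) \<noteq> 0)"

definition coord_change :: "(complex \<times> complex \<Rightarrow> complex \<times> complex) \<Rightarrow> bool" where
  "coord_change \<kappa> \<longleftrightarrow>
     holo2 (fst \<circ> \<kappa>) \<and> holo2 (snd \<circ> \<kappa>) \<and> \<kappa> 0 = 0 \<and>
     (\<exists>D. (\<kappa> has_derivative D) (at 0) \<and>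
          fst (D (1, 0)) * snd (D (0, 1)) - fst (D (0, 1)) * snd (D (1, 0)) \<noteq> 0)"

definition vanishes_to_order :: "nat \<Rightarrow> (complex \<times> complex \<Rightarrow> complex) \<Rightarrow> bool" where
  "vanishes_to_order t f \<longleftrightarrow> (\<exists>K. \<forall>\<^sub>F x in nhds 0. norm (f x) \<le> K * norm x ^ t)"

definition has_mult :: "(complex \<times> complex \<Rightarrow> complex) \<Rightarrow> nat \<Rightarrow> bool" where
  "has_mult f t \<longleftrightarrow> vanishes_to_order t f \<and> \<not> vanishes_to_order (Suc t) f"

definition germ_singular :: "(complex \<times> complex \<Rightarrow> complex) \<Rightarrow> bool" where
  "germ_singular f \<longleftrightarrow> f 0 = 0 \<and> (f has_derivative (\<lambda>_. 0)) (at 0)"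

text \<open>
  Blow-up of the origin of \<open>C\<^sup>2\<close>.  A point of the exceptional curve is a direction: \<open>Some b\<close>
  is the direction \<open>(1, b)\<close>, and \<open>None\<close> the direction \<open>(0, 1)\<close>.  \<open>blow_chart \<theta>\<close> is the blow-up map
  in coordinates \<open>(s, u)\<close> centred at the point \<open>\<theta>\<close>; the exceptional curve is \<open>s = 0\<close>.
\<close>

fun blow_chart :: "complex option \<Rightarrow> complex \<times> complex \<Rightarrow> complex \<times> complex" where
  "blow_chart (Some b) (s, u) = (s, s * (b + u))"
| "blow_chart None (s, u) = (s * u, s)"

definition strict_transform ::
    "nat \<Rightarrow> (complex \<times> complex \<Rightarrow> complex) \<Rightarrow> complex option \<Rightarrow>
     (complex \<times> complex \<Rightarrow> complex) \<Rightarrow> bool" where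
  "strict_transform t f \<theta> g \<longleftrightarrow>
     holo2 g \<and> (\<forall>\<^sub>F x in nhds 0. f (blow_chart \<theta> x) = fst x ^ t * g x)"

text \<open>
  \<open>Sing t [\<tau>\<^sub>1, \<dots>, \<tau>\<^sub>l]\<close> is the type \<open>[t, (\<tau>\<^sub>1, \<dots>, \<tau>\<^sub>l)]\<close>: multiplicity \<open>t\<close>, and after
  one blow-up exactly \<open>l\<close> singular points on the exceptional curve, of types \<open>\<tau>\<^sub>1, \<dots>, \<tau>\<^sub>l\<close>.
  The type \<open>[t\<^sub>1, \<dots>, t\<^sub>s]\<close> is the case where at most one singular point appears each time.
\<close>

datatype sing_type = Sing nat "sing_type list"

fun seq_type :: "nat \<Rightarrow> nat list \<Rightarrow> sing_type" where
  "seq_type t [] = Sing t []"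
| "seq_type t (u # us) = Sing t [seq_type u us]"

text \<open>The type \<open>[l\<^sub>r]\<close>, for \<open>r \<ge> 1\<close>.\<close>

definition rep_type :: "nat \<Rightarrow> nat \<Rightarrow> sing_type" where
  "rep_type l r = seq_type l (replicate (r - 1) l)"

inductive germ_type :: "(complex \<times> complex \<Rightarrow> complex) \<Rightarrow> sing_type \<Rightarrow> bool" where
  "germ_type f (Sing t \<tau>s)"
    if "t > 1" and "has_mult f t"
      and "\<forall>\<theta>. strict_transform t f \<theta> (g \<theta>)"
      and "distinct dirs"
      and "list_all2 (\<lambda>\<theta> \<tau>. germ_type (g \<theta>) \<tau>) dirs \<tau>s"
      and "\<forall>\<theta>. \<theta> \<notin> set dirs \<longrightarrow> \<not> germ_singular (g \<theta>)"

definition has_type :: "(complex ^ 3 \<Rightarrow> complex) \<Rightarrow> p2_point \<Rightarrow> sing_type \<Rightarrow> bool" where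
  "has_type F p \<tau> \<longleftrightarrow> (\<exists>\<psi>. local_coords \<psi> p \<and> germ_type (F \<circ> \<psi>) \<tau>)"

definition locally_isomorphic ::
    "(complex ^ 3 \<Rightarrow> complex) \<Rightarrow> p2_point \<Rightarrow> (complex ^ 3 \<Rightarrow> complex) \<Rightarrow> p2_point \<Rightarrow> bool" where
  "locally_isomorphic F p G q \<longleftrightarrow>
     (\<exists>\<psi> \<psi>'. local_coords \<psi> p \<and> local_coords \<psi>' q \<and> (\<forall>\<^sub>F x in nhds 0. F (\<psi> x) = G (\<psi>' x)))"

text \<open>
  A \<open>d\<close>-tacnode of order \<open>k\<close>: in suitable coordinates the curve consists of \<open>d\<close> smooth branches
  \<open>y = \<phi>\<^sub>i(x)\<close> whose derivatives at \<open>0\<close> agree up to order \<open>k\<close>, and for any two branches not up to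
  order \<open>k + 1\<close>.  For \<open>k = 0\<close> this is an ordinary \<open>d\<close>-fold point (type \<open>[d]\<close>); for
  \<open>k \<ge> 1\<close> the branches have a common tangent.
\<close>

definition germ_tacnode :: "nat \<Rightarrow> nat \<Rightarrow> (complex \<times> complex \<Rightarrow> complex) \<Rightarrow> bool" where
  "germ_tacnode d k f \<longleftrightarrow>
     (\<exists>\<kappa> u \<phi>. coord_change \<kappa> \<and> holo2 u \<and> u 0 \<noteq> 0 \<and>
        (\<forall>i<d. \<phi> i analytic_on {0} \<and> \<phi> i 0 = 0) \<and>
        (\<forall>\<^sub>F x in nhds 0. f (\<kappa> x) = u x * (\<Prod>i<d. snd x - \<phi> i (fst x))) \<and>
        (\<forall>i<d. \<forall>j<d. i \<noteq> j \<longrightarrow>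
           (\<forall>r\<le>k. (deriv ^^ r) (\<phi> i) 0 = (deriv ^^ r) (\<phi> j) 0) \<and>
           (deriv ^^ Suc k) (\<phi> i) 0 \<noteq> (deriv ^^ Suc k) (\<phi> j) 0))"

definition tacnode_at :: "nat \<Rightarrow> nat \<Rightarrow> (complex ^ 3 \<Rightarrow> complex) \<Rightarrow> p2_point \<Rightarrow> bool" where
  "tacnode_at d k F p \<longleftrightarrow> (\<exists>\<psi>. local_coords \<psi> p \<and> germ_tacnode d k (F \<circ> \<psi>))"

text \<open>
  The point \<open>p\<close> is the blow-down of \<open>length ks\<close> many \<open>d\<close>-tacnodes, of orders \<open>ks\<close>: blowing up \<open>p\<close>,
  the strict transform meets the exceptional curve in exactly these tacnodes.
\<close>

definition blow_down_of_tacnodes ::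
    "nat \<Rightarrow> nat list \<Rightarrow> (complex ^ 3 \<Rightarrow> complex) \<Rightarrow> p2_point \<Rightarrow> bool" where
  "blow_down_of_tacnodes d ks F p \<longleftrightarrow>
     (\<exists>\<psi> t g dirs. local_coords \<psi> p \<and> has_mult (F \<circ> \<psi>) t \<and>
        (\<forall>\<theta>. strict_transform t (F \<circ> \<psi>) \<theta> (g \<theta>)) \<and>
        distinct dirs \<and> list_all2 (\<lambda>\<theta> k. germ_tacnode d k (g \<theta>)) dirs ks \<and>
        (\<forall>\<theta>. \<theta> \<notin> set dirs \<longrightarrow> g \<theta> 0 \<noteq> 0))"

section \<open>Hirzebruch surfaces\<close>

text \<open>
  \<open>F\<^sub>n\<close> is the quotient of pairs \<open>x \<in> C\<^sup>2 - 0\<close>, \<open>(y, z) \<in> C\<^sup>2 - 0\<close> by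
  \<open>(x, y, z) \<sim> (\<lambda> x, \<lambda>\<^sup>-\<^sup>n \<mu> y, \<mu> z)\<close>, with projection \<open>x\<close> to \<open>P\<^sup>1\<close>.  Since \<open>z / y\<close> has
  weight \<open>n\<close>, the divisor \<open>z = 0\<close> is linearly equivalent to \<open>y = 0\<close> plus \<open>n\<close> fibres; the two being
  disjoint, \<open>y = 0\<close> has self-intersection \<open>-n\<close> and is the exceptional section.
\<close>

type_synonym p1_coord = "complex \<times> complex"
type_synonym h_point = "(p1_coord \<times> complex \<times> complex) set"

definition hpt :: "nat \<Rightarrow> p1_coord \<Rightarrow> complex \<Rightarrow> complex \<Rightarrow> h_point" where
  "hpt n x y z =
     {((l * fst x, l * snd x), m * y / l ^ n, m * z) | l m. l \<noteq> 0 \<and> m \<noteq> 0}"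

definition hirzebruch :: "nat \<Rightarrow> h_point set" where
  "hirzebruch n = {hpt n x y z | x y z. x \<noteq> 0 \<and> (y, z) \<noteq> 0}"

definition exc_section :: "nat \<Rightarrow> h_point set" where
  "exc_section n = {hpt n x 0 z | x z. x \<noteq> 0 \<and> z \<noteq> 0}"

definition fibre :: "nat \<Rightarrow> p1_coord \<Rightarrow> h_point set" where
  "fibre n a = {hpt n a y z | y z. (y, z) \<noteq> 0}"

definition lin :: "p1_coord \<Rightarrow> p1_coord \<Rightarrow> complex" where
  "lin a x = fst a * snd x - snd a * fst x"

definition binary_form :: "nat \<Rightarrow> (p1_coord \<Rightarrow> complex) \<Rightarrow> bool" where
  "binary_form n q \<longleftrightarrow> (\<exists>c. \<forall>x. q x = (\<Sum>i\<le>n. c i * fst x ^ i * snd x ^ (n - i)))"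

section \<open>Blow-ups as correspondences\<close>

text \<open>
  A blow-up of \<open>X\<close> at \<open>c\<close> is given by a surface \<open>B \<subseteq> X \<times> Y\<close> whose first projection is the blow-up
  map.  The proper transform of \<open>D \<subseteq> X\<close> is the closure in \<open>B\<close> of the preimage of \<open>D - {c}\<close>, for the
  quotient topology; it is computed on the cones of representatives.
\<close>

definition proper_transform ::
    "('a::topological_space set \<times> 'b::topological_space set) set \<Rightarrow> 'a set \<Rightarrow> 'a set set \<Rightarrow>
     ('a set \<times> 'b set) set" where
  "proper_transform B c D =
     {(P, P') \<in> B. \<exists>v \<in> P. \<exists>v' \<in> P'.
        (v, v') \<in> closure (\<Union>(R, R') \<in> {(R, R') \<in> B. R \<in> D - {c}}. R \<times> R')}"

text \<open>
  For a basis \<open>(e\<^sub>0, e\<^sub>1, O)\<close> of \<open>C\<^sup>3\<close>: the blow-up of \<open>P\<^sup>2\<close> at the point \<open>O\<close>, which is \<open>F\<^sub>1\<close>.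
  In coordinates \<open>X\<^sub>0, X\<^sub>1, Z\<close> for the basis it is \<open>(X\<^sub>0, X\<^sub>1) = (x\<^sub>0 y, x\<^sub>1 y)\<close>, \<open>Z = z\<close>.  The exceptional
  section \<open>y = 0\<close> lies over \<open>O\<close>, and the fibre over \<open>a \<in> P\<^sup>1\<close> is the proper transform
  of the line spanned by \<open>O\<close> and \<open>a\<^sub>0 e\<^sub>0 + a\<^sub>1 e\<^sub>1\<close>.
\<close>

type_synonym frame = "(complex ^ 3) \<times> (complex ^ 3) \<times> (complex ^ 3)"

fun is_frame :: "frame \<Rightarrow> bool" where
  "is_frame (e0, e1, O') \<longleftrightarrow> det (vector [e0, e1, O'] :: complex ^ 3 ^ 3) \<noteq> 0"

fun vertex :: "frame \<Rightarrow> complex ^ 3" where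
  "vertex (e0, e1, O') = O'"

fun direction :: "frame \<Rightarrow> p1_coord \<Rightarrow> complex ^ 3" where
  "direction (e0, e1, O') x = fst x *s e0 + snd x *s e1"

definition blow_up_P2 :: "frame \<Rightarrow> (p2_point \<times> h_point) set" where
  "blow_up_P2 fr =
     {(ppt (y *s direction fr x + z *s vertex fr), hpt 1 x y z) | x y z. x \<noteq> 0 \<and> (y, z) \<noteq> 0}"

text \<open>
  Elementary transformation of the first type on the fibre over \<open>a\<close>, as the surface
  \<open>B \<subseteq> F\<^sub>n \<times> F\<^sub>n\<^sub>+\<^sub>1\<close> that dominates both.  All pairs in \<open>B\<close> lie over the same \<open>x \<in> P\<^sup>1\<close>.
  Let \<open>t = lin a x\<close>, a local equation of the fibre.  Near the centre \<open>y = t = 0\<close> put \<open>z = 1\<close>; the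
  equation \<open>y' t = z' y\<close> of \<open>B\<close> is that of the blow-up of \<open>F\<^sub>n\<close> at the centre, with
  exceptional curve the new fibre \<open>(y' : z')\<close>.  Near the point \<open>z' = t = 0\<close> of \<open>F\<^sub>n\<^sub>+\<^sub>1\<close> put
  \<open>y' = 1\<close>; the equation \<open>t z = z' y\<close> is that of the blow-up of \<open>F\<^sub>n\<^sub>+\<^sub>1\<close> at that point, with
  exceptional curve the old fibre \<open>(y : z)\<close>.  The identification of the surface obtained with the
  model \<open>F\<^sub>n\<^sub>+\<^sub>1\<close> is unique up to automorphisms.
\<close>

definition elem1 :: "nat \<Rightarrow> p1_coord \<Rightarrow> (h_point \<times> h_point) set" where
  "elem1 n a =
     {(hpt n x y z, hpt (n + 1) x y' z') | x y z y' z'.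
        x \<noteq> 0 \<and> (y, z) \<noteq> 0 \<and> (y', z') \<noteq> 0 \<and> y' * (lin a x * z) = z' * y}"

definition centre1 :: "nat \<Rightarrow> p1_coord \<Rightarrow> h_point" where
  "centre1 n a = hpt n a 0 1"

text \<open>
  Elementary transformation of the second type from \<open>F\<^sub>n\<close> to \<open>F\<^sub>n\<^sub>-\<^sub>1\<close> on the fibre over \<open>a\<close>
  (\<open>n \<ge> 1\<close>).  A point of that fibre outside the exceptional section has \<open>y \<noteq> 0\<close>, and is written
  as \<open>z = q(a) y\<close> for a form \<open>q\<close> of degree \<open>n\<close>; any point is so obtained, and the choice of
  \<open>q\<close> with given \<open>q(a)\<close> only affects the identification with the model \<open>F\<^sub>n\<^sub>-\<^sub>1\<close>.  Near the centre
  \<open>z - q y = t = 0\<close> put \<open>y = 1\<close>; the equation \<open>y' (z - q) = z' t\<close> is that of the blow-up there.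
  Near \<open>y' = t = 0\<close> put \<open>z' = 1\<close>; the equation \<open>y' (z - q y) = t y\<close> is that of the
  blow-up of \<open>F\<^sub>n\<^sub>-\<^sub>1\<close>, with exceptional curve the old fibre.
\<close>

definition elem2 :: "nat \<Rightarrow> p1_coord \<Rightarrow> (p1_coord \<Rightarrow> complex) \<Rightarrow> (h_point \<times> h_point) set" where
  "elem2 n a q =
     {(hpt n x y z, hpt (n - 1) x y' z') | x y z y' z'.
        x \<noteq> 0 \<and> (y, z) \<noteq> 0 \<and> (y', z') \<noteq> 0 \<and> y' * (z - q x * y) = z' * (lin a x * y)}"

definition centre2 :: "nat \<Rightarrow> p1_coord \<Rightarrow> (p1_coord \<Rightarrow> complex) \<Rightarrow> h_point" where
  "centre2 n a q = hpt n a 1 (q a)"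


text \<open>The two projections of \<open>elem1 n a\<close> and \<open>elem2 n a q\<close> contract what they should, and nothing else.\<close>

lemma hpt_memI:
  assumes "l \<noteq> 0" "m \<noteq> 0"
  shows "((l * fst x, l * snd x), m * y / l ^ n, m * z) \<in> hpt n x y z"
  using assms unfolding hpt_def by blast

lemma hpt_memE:
  assumes "v \<in> hpt n x y z"
  obtains l m where "l \<noteq> 0" "m \<noteq> 0" "v = ((l * fst x, l * snd x), m * y / l ^ n, m * z)"
  using assms unfolding hpt_def by blast

lemma hpt_rescale:
  assumes "l \<noteq> 0" "m \<noteq> 0"
  shows "hpt n (l * fst x, l * snd x) (m * y / l ^ n) (m * z) = hpt n x y z"
proof -
  have sub: "hpt n (l * fst x, l * snd x) (m * y / l ^ n) (m * z) \<subseteq> hpt n x y z"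
    if "l \<noteq> 0" "m \<noteq> 0" for l m x y z
  proof
    fix v assume "v \<in> hpt n (l * fst x, l * snd x) (m * y / l ^ n) (m * z)"
    then obtain l' m' where h: "l' \<noteq> 0" "m' \<noteq> 0"
      "v = ((l' * (l * fst x), l' * (l * snd x)), m' * (m * y / l ^ n) / l' ^ n, m' * (m * z))"
      by (rule hpt_memE) simp
    then have v: "v = (((l' * l) * fst x, (l' * l) * snd x), (m' * m) * y / (l' * l) ^ n, (m' * m) * z)"
      by (simp add: power_mult_distrib mult_ac)
    show "v \<in> hpt n x y z"
      unfolding v by (rule hpt_memI) (use h that in simp_all)
  qed
  have "hpt n x y z \<subseteq> hpt n (l * fst x, l * snd x) (m * y / l ^ n) (m * z)"
    using sub[of "1 / l" "1 / m" "(l * fst x, l * snd x)" "m * y / l ^ n" "m * z"] assms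
    by (simp add: power_divide)
  with sub[OF assms] show ?thesis by blast
qed

lemma hpt_eqD:
  assumes "hpt n x y z = hpt n x' y' z'"
  obtains l m where "l \<noteq> 0" "m \<noteq> 0" "x' = (l * fst x, l * snd x)" "y' = m * y / l ^ n" "z' = m * z"
proof -
  have "(x', y', z') \<in> hpt n x y z"
    using hpt_memI[of 1 1 x' y' n z'] assms by simp
  then show ?thesis by (rule hpt_memE) (use that in simp)
qed

lemma hpt_proportional:
  assumes "y * z' = z * y'" "(y, z) \<noteq> 0" "(y', z') \<noteq> 0"
  shows "hpt n x y z = hpt n x y' z'"
proof -
  have "\<exists>m. m \<noteq> 0 \<and> y' = m * y \<and> z' = m * z"
  proof (cases "y = 0")
    case True
    then have "z \<noteq> 0" "y' = 0" "z' \<noteq> 0" using assms by (auto simp: zero_prod_def)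
    then show ?thesis using True by (intro exI[of _ "z' / z"]) simp
  next
    case False
    then have "y' \<noteq> 0" using assms by (auto simp: zero_prod_def)
    then show ?thesis using False assms(1) by (intro exI[of _ "y' / y"]) (simp add: field_simps)
  qed
  then obtain m where "m \<noteq> 0" "y' = m * y" "z' = m * z" by blast
  then show ?thesis using hpt_rescale[of 1 m n x y z] by simp
qed

lemma elem1_iff:
  assumes "x \<noteq> 0" "(y, z) \<noteq> 0"
  shows "(hpt n x y z, P') \<in> elem1 n a \<longleftrightarrow>
    (\<exists>y' z'. (y', z') \<noteq> 0 \<and> P' = hpt (n + 1) x y' z' \<and> y' * (lin a x * z) = z' * y)"
proof
  assume "(hpt n x y z, P') \<in> elem1 n a"
  then obtain x1 y1 z1 y' z' where h: "hpt n x1 y1 z1 = hpt n x y z" "P' = hpt (n + 1) x1 y' z'"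
    "(y', z') \<noteq> 0" "y' * (lin a x1 * z1) = z' * y1"
    unfolding elem1_def by blast
  from h(1) obtain l m where lm: "l \<noteq> 0" "m \<noteq> 0" "x = (l * fst x1, l * snd x1)"
    "y = m * y1 / l ^ n" "z = m * z1"
    by (rule hpt_eqD)
  have "P' = hpt (n + 1) x (y' / l ^ (n + 1)) z'"
    using hpt_rescale[of l 1 "n + 1" x1 y' z'] lm h(2) by simp
  moreover have "lin a x = l * lin a x1" using lm(3) by (simp add: lin_def algebra_simps)
  then have "y' / l ^ (n + 1) * (lin a x * z) = (m / l ^ n) * (y' * (lin a x1 * z1))"
    using lm by simp
  then have "y' / l ^ (n + 1) * (lin a x * z) = z' * y"
    using h(4) lm by simp
  ultimately show "\<exists>y' z'. (y', z') \<noteq> 0 \<and> P' = hpt (n + 1) x y' z' \<and> y' * (lin a x * z) = z' * y"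
    using h(3) lm(1) by (intro exI[of _ "y' / l ^ (n + 1)"] exI[of _ z']) (auto simp: zero_prod_def)
qed (use assms in \<open>unfold elem1_def, blast\<close>)

lemma elem1_iff':
  assumes "x \<noteq> 0" "(y', z') \<noteq> 0"
  shows "(P, hpt (n + 1) x y' z') \<in> elem1 n a \<longleftrightarrow>
    (\<exists>y z. (y, z) \<noteq> 0 \<and> P = hpt n x y z \<and> y' * (lin a x * z) = z' * y)"
proof
  assume "(P, hpt (n + 1) x y' z') \<in> elem1 n a"
  then obtain x1 y z y1 z1 where h: "hpt (n + 1) x1 y1 z1 = hpt (n + 1) x y' z'" "P = hpt n x1 y z"
    "(y, z) \<noteq> 0" "y1 * (lin a x1 * z) = z1 * y"
    unfolding elem1_def by auto
  from h(1) obtain l m where lm: "l \<noteq> 0" "m \<noteq> 0" "x = (l * fst x1, l * snd x1)"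
    "y' = m * y1 / l ^ (n + 1)" "z' = m * z1"
    by (rule hpt_eqD)
  have "P = hpt n x (y / l ^ n) z"
    using hpt_rescale[of l 1 n x1 y z] lm h(2) by simp
  moreover have "lin a x = l * lin a x1" using lm(3) by (simp add: lin_def algebra_simps)
  then have "y' * (lin a x * z) = (m / l ^ n) * (y1 * (lin a x1 * z))"
    using lm by simp
  then have "y' * (lin a x * z) = z' * (y / l ^ n)"
    using h(4) lm by simp
  ultimately show "\<exists>y z. (y, z) \<noteq> 0 \<and> P = hpt n x y z \<and> y' * (lin a x * z) = z' * y"
    using h(3) lm(1) by (intro exI[of _ "y / l ^ n"] exI[of _ z]) (auto simp: zero_prod_def)
qed (use assms in \<open>unfold elem1_def, blast\<close>)

lemma lin_self [simp]: "lin a a = 0"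
  by (simp add: lin_def)

lemma centre1_in:
  assumes "a \<noteq> 0"
  shows "centre1 n a \<in> exc_section n \<inter> fibre n a"
proof -
  have "(0::complex, 1::complex) \<noteq> 0" "(1::complex) \<noteq> 0" by (simp_all add: zero_prod_def)
  then show ?thesis using assms unfolding centre1_def exc_section_def fibre_def by blast
qed

lemma elem1_over_centre:
  assumes "a \<noteq> 0"
  shows "{P'. (centre1 n a, P') \<in> elem1 n a} = fibre (n + 1) a"
proof -
  have nz: "(0::complex, 1::complex) \<noteq> 0" by (simp add: zero_prod_def)
  show ?thesis
    unfolding centre1_def fibre_def elem1_iff[OF assms nz] lin_self by (simp, blast)
qed

lemma elem1_contracted:
  assumes "a \<noteq> 0"
  shows "{P. (P, hpt (n + 1) a 1 0) \<in> elem1 n a} = fibre n a"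
proof -
  have nz: "(1::complex, 0::complex) \<noteq> 0" by (simp add: zero_prod_def)
  show ?thesis
    unfolding fibre_def elem1_iff'[OF assms nz] lin_self by (simp, blast)
qed

lemma elem1_off_centre:
  assumes "x \<noteq> 0" "(y, z) \<noteq> 0" "(y, lin a x * z) \<noteq> 0"
  shows "(hpt n x y z, P') \<in> elem1 n a \<longleftrightarrow> P' = hpt (n + 1) x y (lin a x * z)"
proof -
  have "hpt (n + 1) x y' z' = hpt (n + 1) x y (lin a x * z)"
    if "(y', z') \<noteq> 0" "y' * (lin a x * z) = z' * y" for y' z'
    using hpt_proportional that assms(3) by blast
  then show ?thesis using assms(3) mult.commute[of y "lin a x * z"] unfolding elem1_iff[OF assms(1,2)] by blast
qed

lemma elem1_off_contracted:
  assumes "x \<noteq> 0" "(y', z') \<noteq> 0" "(y' * lin a x, z') \<noteq> 0"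
  shows "(P, hpt (n + 1) x y' z') \<in> elem1 n a \<longleftrightarrow> P = hpt n x (y' * lin a x) z'"
proof -
  have "hpt n x y z = hpt n x (y' * lin a x) z'"
    if "(y, z) \<noteq> 0" "y' * (lin a x * z) = z' * y" for y z
  proof (rule hpt_proportional)
    show "y * z' = z * (y' * lin a x)" using that(2) by algebra
  qed (rule that(1) assms(3))+
  moreover have "y' * (lin a x * z') = z' * (y' * lin a x)"
    by algebra
  ultimately show ?thesis using assms(3) unfolding elem1_iff'[OF assms(1,2)] by blast
qed

lemma binary_form_scale:
  assumes "binary_form n q"
  shows "q (l * fst x, l * snd x) = l ^ n * q x"
proof -
  obtain c where c: "\<And>x. q x = (\<Sum>i\<le>n. c i * fst x ^ i * snd x ^ (n - i))"
    using assms unfolding binary_form_def by blast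
  have *: "c i * (l * fst x) ^ i * (l * snd x) ^ (n - i) = l ^ n * (c i * fst x ^ i * snd x ^ (n - i))"
    if "i \<le> n" for i
    using that power_add[of l i "n - i"] by (simp add: power_mult_distrib)
  show ?thesis
    unfolding c sum_distrib_left fst_conv snd_conv by (intro sum.cong refl) (rule *, simp)
qed

lemma elem2_iff:
  assumes "x \<noteq> 0" "(y, z) \<noteq> 0" "n \<ge> 1" "binary_form n q"
  shows "(hpt n x y z, P') \<in> elem2 n a q \<longleftrightarrow>
    (\<exists>y' z'. (y', z') \<noteq> 0 \<and> P' = hpt (n - 1) x y' z' \<and> y' * (z - q x * y) = z' * (lin a x * y))"
proof
  assume "(hpt n x y z, P') \<in> elem2 n a q"
  then obtain x1 y1 z1 y' z' where h: "hpt n x1 y1 z1 = hpt n x y z" "P' = hpt (n - 1) x1 y' z'"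
    "(y', z') \<noteq> 0" "y' * (z1 - q x1 * y1) = z' * (lin a x1 * y1)"
    unfolding elem2_def by auto
  from h(1) obtain l m where lm: "l \<noteq> 0" "m \<noteq> 0" "x = (l * fst x1, l * snd x1)"
    "y = m * y1 / l ^ n" "z = m * z1"
    by (rule hpt_eqD)
  have P': "P' = hpt (n - 1) x (y' / l ^ (n - 1)) z'"
    using hpt_rescale[of l 1 "n - 1" x1 y' z'] lm h(2) by simp
  have ln: "l ^ n = l * l ^ (n - 1)" using \<open>n \<ge> 1\<close> by (simp flip: power_Suc)
  have "lin a x = l * lin a x1" using lm(3) by (simp add: lin_def algebra_simps)
  moreover have "z - q x * y = m * (z1 - q x1 * y1)"
    using lm binary_form_scale[OF assms(4), of l x1] by (simp add: algebra_simps)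
  ultimately have "y' / l ^ (n - 1) * (z - q x * y) = z' * (lin a x * y)"
    using h(4) lm(1,2,4) by (simp add: ln)
  with P' show "\<exists>y' z'. (y', z') \<noteq> 0 \<and> P' = hpt (n - 1) x y' z' \<and>
      y' * (z - q x * y) = z' * (lin a x * y)"
    using h(3) lm(1) by (intro exI[of _ "y' / l ^ (n - 1)"] exI[of _ z']) (auto simp: zero_prod_def)
qed (use assms in \<open>unfold elem2_def, blast\<close>)

lemma elem2_iff':
  assumes "x \<noteq> 0" "(y', z') \<noteq> 0" "n \<ge> 1" "binary_form n q"
  shows "(P, hpt (n - 1) x y' z') \<in> elem2 n a q \<longleftrightarrow>
    (\<exists>y z. (y, z) \<noteq> 0 \<and> P = hpt n x y z \<and> y' * (z - q x * y) = z' * (lin a x * y))"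
proof
  assume "(P, hpt (n - 1) x y' z') \<in> elem2 n a q"
  then obtain x1 y z y1 z1 where h: "hpt (n - 1) x1 y1 z1 = hpt (n - 1) x y' z'" "P = hpt n x1 y z"
    "(y, z) \<noteq> 0" "y1 * (z - q x1 * y) = z1 * (lin a x1 * y)"
    unfolding elem2_def by auto
  from h(1) obtain l m where lm: "l \<noteq> 0" "m \<noteq> 0" "x = (l * fst x1, l * snd x1)"
    "y' = m * y1 / l ^ (n - 1)" "z' = m * z1"
    by (rule hpt_eqD)
  have P: "P = hpt n x (y / l ^ n) z"
    using hpt_rescale[of l 1 n x1 y z] lm h(2) by simp
  have ln: "l ^ n = l * l ^ (n - 1)" using \<open>n \<ge> 1\<close> by (simp flip: power_Suc)
  have "lin a x = l * lin a x1" using lm(3) by (simp add: lin_def algebra_simps)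
  moreover have "z - q x * (y / l ^ n) = z - q x1 * y"
    using lm binary_form_scale[OF assms(4), of l x1] by simp
  ultimately have "y' * (z - q x * (y / l ^ n)) = z' * (lin a x * (y / l ^ n))"
    using h(4) lm(1,2,4,5) by (simp add: ln)
  with P show "\<exists>y z. (y, z) \<noteq> 0 \<and> P = hpt n x y z \<and> y' * (z - q x * y) = z' * (lin a x * y)"
    using h(3) lm(1) by (intro exI[of _ "y / l ^ n"] exI[of _ z]) (auto simp: zero_prod_def)
qed (use assms in \<open>unfold elem2_def, blast\<close>)

lemma centre2_in:
  assumes "a \<noteq> 0"
  shows "centre2 n a q \<in> fibre n a - exc_section n"
proof -
  have "centre2 n a q \<notin> exc_section n"
  proof
    assume "centre2 n a q \<in> exc_section n"
    then obtain x z where "hpt n x 0 z = hpt n a 1 (q a)"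
      unfolding exc_section_def centre2_def by auto
    then show False by (rule hpt_eqD) simp
  qed
  moreover have "(1::complex, q a) \<noteq> 0" by (simp add: zero_prod_def)
  then have "centre2 n a q \<in> fibre n a" unfolding centre2_def fibre_def by blast
  ultimately show ?thesis by blast
qed

lemma elem2_over_centre:
  assumes "a \<noteq> 0" "n \<ge> 1" "binary_form n q"
  shows "{P'. (centre2 n a q, P') \<in> elem2 n a q} = fibre (n - 1) a"
proof -
  have nz: "(1::complex, q a) \<noteq> 0" by (simp add: zero_prod_def)
  show ?thesis
    unfolding centre2_def fibre_def elem2_iff[OF assms(1) nz assms(2,3)] lin_self by (simp, blast)
qed

lemma elem2_contracted:
  assumes "a \<noteq> 0" "n \<ge> 1" "binary_form n q"
  shows "{P. (P, hpt (n - 1) a 0 1) \<in> elem2 n a q} = fibre n a"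
proof -
  have nz: "(0::complex, 1::complex) \<noteq> 0" by (simp add: zero_prod_def)
  show ?thesis
    unfolding fibre_def elem2_iff'[OF assms(1) nz assms(2,3)] lin_self by (simp, blast)
qed

lemma elem2_off_centre:
  assumes "x \<noteq> 0" "(y, z) \<noteq> 0" "(lin a x * y, z - q x * y) \<noteq> 0" "n \<ge> 1" "binary_form n q"
  shows "(hpt n x y z, P') \<in> elem2 n a q \<longleftrightarrow> P' = hpt (n - 1) x (lin a x * y) (z - q x * y)"
proof -
  have "hpt (n - 1) x y' z' = hpt (n - 1) x (lin a x * y) (z - q x * y)"
    if "(y', z') \<noteq> 0" "y' * (z - q x * y) = z' * (lin a x * y)" for y' z'
    using hpt_proportional that assms(3) by blast
  then show ?thesis
    using assms(3) mult.commute[of "lin a x * y" "z - q x * y"] unfolding elem2_iff[OF assms(1,2,4,5)] by blast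
qed

lemma elem2_off_contracted:
  assumes "x \<noteq> 0" "(y', z') \<noteq> 0" "(y', lin a x * z' + q x * y') \<noteq> 0" "n \<ge> 1" "binary_form n q"
  shows "(P, hpt (n - 1) x y' z') \<in> elem2 n a q \<longleftrightarrow> P = hpt n x y' (lin a x * z' + q x * y')"
proof -
  have "hpt n x y z = hpt n x y' (lin a x * z' + q x * y')"
    if "(y, z) \<noteq> 0" "y' * (z - q x * y) = z' * (lin a x * y)" for y z
  proof (rule hpt_proportional)
    show "y * (lin a x * z' + q x * y') = z * y'" using that(2) by algebra
  qed (rule that(1) assms(3))+
  moreover have "y' * (lin a x * z' + q x * y' - q x * y') = z' * (lin a x * y')"
    by algebra
  ultimately show ?thesis using assms(3) unfolding elem2_iff'[OF assms(1,2,4,5)] by blast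
qed

section \<open>The Cremona transformations\<close>

text \<open>
  \<open>first_rel n as\<close> performs successively transformations of the first type on the fibres over \<open>as\<close>,
  starting on \<open>F\<^sub>n\<close>; \<open>first_curve n as\<close> is its effect on curves (proper transform on the blow-up, then
  blow-down).  Similarly for the second type, where each step also carries its \<open>q\<close>.
\<close>

fun first_rel :: "nat \<Rightarrow> p1_coord list \<Rightarrow> (h_point \<times> h_point) set" where
  "first_rel n [] = Id"
| "first_rel n (a # as) = elem1 n a O first_rel (n + 1) as"

fun first_curve :: "nat \<Rightarrow> p1_coord list \<Rightarrow> h_point set \<Rightarrow> h_point set" where
  "first_curve n [] D = D"
| "first_curve n (a # as) D =
     first_curve (n + 1) as (snd ` proper_transform (elem1 n a) (centre1 n a) D)"

fun second_rel ::
    "nat \<Rightarrow> (p1_coord \<times> (p1_coord \<Rightarrow> complex)) list \<Rightarrow> (h_point \<times> h_point) set" where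
  "second_rel n [] = Id"
| "second_rel n ((a, q) # bs) = elem2 n a q O second_rel (n - 1) bs"

fun second_curve ::
    "nat \<Rightarrow> (p1_coord \<times> (p1_coord \<Rightarrow> complex)) list \<Rightarrow> h_point set \<Rightarrow> h_point set" where
  "second_curve n [] D = D"
| "second_curve n ((a, q) # bs) D =
     second_curve (n - 1) bs (snd ` proper_transform (elem2 n a q) (centre2 n a q) D)"

text \<open>
  The blown-up points of the second type must avoid the current proper transform of the curve: were
  the first one on a fibre a point of the curve, fewer than \<open>d\<close> branches would pass through the point
  of the exceptional section.  At the later steps on a fibre the curve meets it only on the
  exceptional section, so there this is no restriction.
\<close>

fun second_centres_ok ::
    "nat \<Rightarrow> (p1_coord \<times> (p1_coord \<Rightarrow> complex)) list \<Rightarrow> h_point set \<Rightarrow> bool" where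
  "second_centres_ok n [] D \<longleftrightarrow> True"
| "second_centres_ok n ((a, q) # bs) D \<longleftrightarrow>
     binary_form n q \<and> centre2 n a q \<notin> D \<and>
     second_centres_ok (n - 1) bs (snd ` proper_transform (elem2 n a q) (centre2 n a q) D)"

definition repeat_each :: "nat list \<Rightarrow> 'a list \<Rightarrow> 'a list" where
  "repeat_each ns xs = concat (map2 replicate ns xs)"

text \<open>
  The lines \<open>Q\<^sub>i\<close> and \<open>P\<^sub>j\<close> through \<open>O = vertex fr\<close> are given by their directions \<open>qs\<close> and \<open>ps\<close>.
  Their cyclic order around \<open>O\<close> only fixes a labelling and is left arbitrary.
\<close>

definition admissible_lines ::
    "(complex ^ 3 \<Rightarrow> complex) \<Rightarrow> frame \<Rightarrow> p1_coord list \<Rightarrow> p1_coord list \<Rightarrow> bool" where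
  "admissible_lines F fr qs ps \<longleftrightarrow>
     is_frame fr \<and> F (vertex fr) \<noteq> 0 \<and>
     (\<forall>a \<in> set (qs @ ps). a \<noteq> 0 \<and> meets_transversally F (vertex fr) (direction fr a)) \<and>
     (\<forall>i < length (qs @ ps). \<forall>j < length (qs @ ps).
        i \<noteq> j \<longrightarrow> lin ((qs @ ps) ! i) ((qs @ ps) ! j) \<noteq> 0)"

text \<open>
  Below, \<open>as\<close> is the list of fibres of the successive transformations of the first type, \<open>bs\<close> that of
  the fibres of the second type together with the forms defining the centres, and \<open>fr'\<close> fixes the
  identification with \<open>P\<^sup>2\<close> of the surface finally obtained.
\<close>

definition first_steps :: "nat list \<Rightarrow> p1_coord list \<Rightarrow> p1_coord list" where
  "first_steps ns qs = repeat_each ns qs"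

definition second_steps ::
    "nat list \<Rightarrow> p1_coord list \<Rightarrow> (p1_coord \<Rightarrow> complex) list \<Rightarrow>
     (p1_coord \<times> (p1_coord \<Rightarrow> complex)) list" where
  "second_steps ms ps cs = zip (repeat_each ms ps) cs"

definition curve_on_top ::
    "frame \<Rightarrow> p1_coord list \<Rightarrow> (complex ^ 3 \<Rightarrow> complex) \<Rightarrow> h_point set" where
  "curve_on_top fr as F =
     first_curve 1 as (snd ` proper_transform (blow_up_P2 fr) (ppt (vertex fr)) (curve_points F))"

definition cremona_rel ::
    "frame \<Rightarrow> frame \<Rightarrow> p1_coord list \<Rightarrow> (p1_coord \<times> (p1_coord \<Rightarrow> complex)) list \<Rightarrow>
     (p2_point \<times> p2_point) set" where
  "cremona_rel fr fr' as bs =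
     blow_up_P2 fr O first_rel 1 as O second_rel (length as + 1) bs O (blow_up_P2 fr')\<inverse>"

definition cremona_image ::
    "frame \<Rightarrow> frame \<Rightarrow> p1_coord list \<Rightarrow> (p1_coord \<times> (p1_coord \<Rightarrow> complex)) list \<Rightarrow>
     (complex ^ 3 \<Rightarrow> complex) \<Rightarrow> p2_point set" where
  "cremona_image fr fr' as bs F =
     (blow_up_P2 fr')\<inverse> `` second_curve (length as + 1) bs (curve_on_top fr as F)"

end

theory Submission
  imports Defs "HOL-Complex_Analysis.Complex_Analysis"
    "HOL-Computational_Algebra.Fundamental_Theorem_Algebra"
begin

text \<open>
  In homogeneous coordinates \<open>(X, Z)\<close>, \<open>X\<close> a pair, in which the vertex is \<open>X = 0\<close>, every elementary
  transformation is an explicit substitution.  Let \<open>Q\<close> and \<open>R\<close> be the products of the equations of the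
  lines \<open>Q\<^sub>i\<close> and \<open>P\<^sub>j\<close> with their multiplicities, of common degree \<open>N\<close>.  The image of \<open>F = 0\<close> is
  \<open>G = F \<circ> \<tau>\<close> with \<open>\<tau> (X, Z) = (Q(X) X, R(X) Z + S(X))\<close>, where the form \<open>S\<close> records the centres of the
  second type, and \<open>\<sigma> (X, Z) = (R(X) X, Q(X) Z - S(X))\<close> inverts \<open>\<tau>\<close> up to a scalar that vanishes only on
  the lines.  The curve being smooth on the lines, its singular points correspond to those of \<open>G = 0\<close>
  outside the lines.  Near a line, parametrised by \<open>X(u)\<close>, the implicit function theorem gives
  \<open>F(X(u), Z) = c \<Prod>\<^sub>i (Z - \<rho>\<^sub>i(u))\<close> with distinct \<open>\<rho>\<^sub>i(0)\<close>.  In the coordinate \<open>w = R Z + S\<close> the branches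
  of \<open>G = 0\<close> over a zero of \<open>Q\<close> are \<open>w = Q \<rho>\<^sub>i\<close>, a tacnode.  Blowing up the vertex,
  \<open>G(s X, 1) = s\<^sup>d\<^sup>N F(s Q X, R + s S)\<close>, so that over a zero of \<open>R\<close> the branches are
  \<open>s = R / (Q \<rho>\<^sub>i - S)\<close>; the denominators do not vanish since the centres of the second type avoid the
  curve.  If \<open>g\<^sup>2\<close> divides \<open>G\<close>, then \<open>g\<close> has no zero on the lines near \<open>Q\<^sub>1\<close> outside the vertex, so \<open>g\<close>
  depends on \<open>X\<close> only, and a zero of \<open>g\<close> gives a line contained in \<open>G = 0\<close>, which cannot occur.
\<close>

text \<open>The transformations are given as correspondences of point sets with closures, so they
  have to be turned into equations. Two facts make each new equation a mere substitution. No centre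
  of a blow-up lies on the current curve: O is off \<open>F = 0\<close>, hence the curve avoids the
  exceptional section as long as only steps of the first type are made, and for the second type this
  is \<open>second_centres_ok\<close>. So closures add nothing, and the proper transform is the
  plain image. Moreover the curve meets every fibre, its equation being a form of degree
  \<open>d \<ge> 1\<close> in the fibre coordinates \<open>(y, z)\<close>; so the point to which a
  fibre is contracted lies on the new curve, as the substituted equation predicts.

  The new singular points need no search: they are zeros of \<tau>, and a composite
  \<open>F \<circ> \<tau>\<close> is singular there because \<open>d \<ge> 2\<close>. Local
  isomorphism asks for equal germs, not for germs equal up to a unit; this is why lifts to
  homogeneous coordinates get rescaled by roots of units.\<close>

no_notation fps_nth (infixl "$" 75)

section \<open>Binary and ternary forms\<close>

abbreviation dil :: "complex \<Rightarrow> p1_coord \<Rightarrow> p1_coord" where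
  "dil c x \<equiv> (c * fst x, c * snd x)"

abbreviation line_at :: "p1_coord \<Rightarrow> p1_coord \<Rightarrow> complex \<Rightarrow> p1_coord" where
  "line_at a a' u \<equiv> (fst a + u * fst a', snd a + u * snd a')"

lemma binary_form_const [simp]: "binary_form 0 (\<lambda>_. c)"
  unfolding binary_form_def by (intro exI[of _ "\<lambda>_. c"]) simp

lemma binary_form_monomial:
  assumes "i + j = n"
  shows "binary_form n (\<lambda>x. c * fst x ^ i * snd x ^ j)"
  unfolding binary_form_def
proof (intro exI allI)
  fix x :: p1_coord
  have "(\<Sum>i'\<le>n. (if i' = i then c else 0) * fst x ^ i' * snd x ^ (n - i')) =
        (\<Sum>i'\<le>n. if i = i' then c * fst x ^ i' * snd x ^ (n - i') else 0)"
    by (intro sum.cong) auto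
  also have "\<dots> = c * fst x ^ i * snd x ^ j"
    using assms by (subst sum.delta') auto
  finally show "c * fst x ^ i * snd x ^ j =
    (\<Sum>i'\<le>n. (if i' = i then c else 0) * fst x ^ i' * snd x ^ (n - i'))" by simp
qed

lemma binary_form_fst: "binary_form 1 fst"
  using binary_form_monomial[of 1 0 1 1] by simp

lemma binary_form_snd: "binary_form 1 snd"
  using binary_form_monomial[of 0 1 1 1] by simp

lemma binary_form_add:
  assumes "binary_form n f" "binary_form n g"
  shows "binary_form n (\<lambda>x. f x + g x)"
proof -
  obtain c c' where "\<And>x. f x = (\<Sum>i\<le>n. c i * fst x ^ i * snd x ^ (n - i))"
      "\<And>x. g x = (\<Sum>i\<le>n. c' i * fst x ^ i * snd x ^ (n - i))"
    using assms unfolding binary_form_def by blast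
  then have "f x + g x = (\<Sum>i\<le>n. (c i + c' i) * fst x ^ i * snd x ^ (n - i))" for x
    by (simp add: algebra_simps sum.distrib)
  then show ?thesis unfolding binary_form_def by (intro exI[of _ "\<lambda>i. c i + c' i"]) blast
qed

lemma binary_form_zero: "binary_form n (\<lambda>_. 0)"
  unfolding binary_form_def by (intro exI[of _ "\<lambda>_. 0"]) simp

lemma binary_form_sum:
  "(\<And>a. a \<in> A \<Longrightarrow> binary_form n (f a)) \<Longrightarrow> binary_form n (\<lambda>x. \<Sum>a\<in>A. f a x)"
  by (induction A rule: infinite_finite_induct) (simp_all add: binary_form_zero binary_form_add)

lemma binary_form_mult:
  assumes "binary_form m f" "binary_form n g"
  shows "binary_form (m + n) (\<lambda>x. f x * g x)"
proof -
  obtain c c' where *: "\<And>x. f x = (\<Sum>i\<le>m. c i * fst x ^ i * snd x ^ (m - i))"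
      "\<And>x. g x = (\<Sum>i\<le>n. c' i * fst x ^ i * snd x ^ (n - i))"
    using assms unfolding binary_form_def by blast
  have "f x * g x = (\<Sum>i\<le>m. \<Sum>j\<le>n. (c i * c' j) * fst x ^ (i + j) * snd x ^ ((m - i) + (n - j)))" for x
    unfolding * sum_product by (intro sum.cong refl) (simp only: power_add mult_ac)
  then show ?thesis
    by (simp only:) (intro binary_form_sum binary_form_monomial, auto)
qed

lemma binary_form_scaleC: "binary_form n f \<Longrightarrow> binary_form n (\<lambda>x. c * f x)"
  using binary_form_mult[OF binary_form_const[of c]] by simp

lemma binary_form_lin: "binary_form 1 (lin a)"
proof -
  have "binary_form 1 (\<lambda>x. fst a * snd x + (- snd a) * fst x)"
    by (intro binary_form_add binary_form_scaleC binary_form_fst binary_form_snd)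
  then show ?thesis by (simp add: lin_def[abs_def])
qed

lemma binary_form_zero_at_0:
  assumes "binary_form n q" "n \<ge> 1"
  shows "q 0 = 0"
  using binary_form_scale[OF assms(1), of 0 0] assms(2) by (simp add: zero_prod_def power_0_left)

section \<open>Ternary forms\<close>

lemma ternary_form_monomial:
  assumes "i + j + k = n"
  shows "ternary_form n (\<lambda>v. c * v $ 1 ^ i * v $ 2 ^ j * v $ 3 ^ k)"
  unfolding ternary_form_def
proof (intro exI allI)
  fix v :: "complex ^ 3"
  have "(\<Sum>i'\<le>n. \<Sum>j'\<le>n - i'. (if i' = i \<and> j' = j then c else 0) * v $ 1 ^ i' * v $ 2 ^ j' * v $ 3 ^ (n - i' - j')) =
        (\<Sum>i'\<le>n. if i = i' then (\<Sum>j'\<le>n - i'. if j = j' then c * v $ 1 ^ i' * v $ 2 ^ j' * v $ 3 ^ (n - i' - j') else 0) else 0)"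
  proof (intro sum.cong refl)
    fix i' show "(\<Sum>j'\<le>n - i'. (if i' = i \<and> j' = j then c else 0) * v $ 1 ^ i' * v $ 2 ^ j' * v $ 3 ^ (n - i' - j')) =
      (if i = i' then (\<Sum>j'\<le>n - i'. if j = j' then c * v $ 1 ^ i' * v $ 2 ^ j' * v $ 3 ^ (n - i' - j') else 0) else 0)"
    proof (cases "i = i'")
      case True
      show ?thesis unfolding if_P[OF True] by (intro sum.cong refl) (simp add: True)
    qed simp
  qed
  also have "\<dots> = c * v $ 1 ^ i * v $ 2 ^ j * v $ 3 ^ k"
  proof -
    have "n - i - j = k" "i \<le> n" "j \<le> n - i" using assms by auto
    then show ?thesis by (simp add: sum.delta')
  qed
  finally show "c * v $ 1 ^ i * v $ 2 ^ j * v $ 3 ^ k =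
     (\<Sum>i'\<le>n. \<Sum>j'\<le>n - i'. (if i' = i \<and> j' = j then c else 0) * v $ 1 ^ i' * v $ 2 ^ j' * v $ 3 ^ (n - i' - j'))" by simp
qed

lemma ternary_form_const [simp]: "ternary_form 0 (\<lambda>_. c)"
  using ternary_form_monomial[of 0 0 0 0 c] by simp

lemma ternary_form_coord: "ternary_form 1 (\<lambda>v. v $ i)"
  using ternary_form_monomial[of 1 0 0 1 1] ternary_form_monomial[of 0 1 0 1 1]
    ternary_form_monomial[of 0 0 1 1 1] exhaust_3[of i] by auto

lemma ternary_form_add:
  assumes "ternary_form n f" "ternary_form n g"
  shows "ternary_form n (\<lambda>x. f x + g x)"
proof -
  obtain c c' where "\<And>v. f v = (\<Sum>i\<le>n. \<Sum>j\<le>n - i. c i j * (v $ 1) ^ i * (v $ 2) ^ j * (v $ 3) ^ (n - i - j))"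
      "\<And>v. g v = (\<Sum>i\<le>n. \<Sum>j\<le>n - i. c' i j * (v $ 1) ^ i * (v $ 2) ^ j * (v $ 3) ^ (n - i - j))"
    using assms unfolding ternary_form_def by blast
  then have "f v + g v = (\<Sum>i\<le>n. \<Sum>j\<le>n - i. (c i j + c' i j) * (v $ 1) ^ i * (v $ 2) ^ j * (v $ 3) ^ (n - i - j))" for v
    by (simp add: algebra_simps sum.distrib)
  then show ?thesis unfolding ternary_form_def by (intro exI[of _ "\<lambda>i j. c i j + c' i j"]) blast
qed

lemma ternary_form_zero: "ternary_form n (\<lambda>_. 0)"
  unfolding ternary_form_def by (intro exI[of _ "\<lambda>_ _. 0"]) simp

lemma ternary_form_sum:
  "(\<And>a. a \<in> A \<Longrightarrow> ternary_form n (f a)) \<Longrightarrow> ternary_form n (\<lambda>x. \<Sum>a\<in>A. f a x)"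
  by (induction A rule: infinite_finite_induct) (simp_all add: ternary_form_zero ternary_form_add)

lemma ternary_form_mult:
  assumes "ternary_form m f" "ternary_form n g"
  shows "ternary_form (m + n) (\<lambda>x. f x * g x)"
proof -
  obtain c c' where *: "\<And>v. f v = (\<Sum>i\<le>m. \<Sum>j\<le>m - i. c i j * (v $ 1) ^ i * (v $ 2) ^ j * (v $ 3) ^ (m - i - j))"
      "\<And>v. g v = (\<Sum>i\<le>n. \<Sum>j\<le>n - i. c' i j * (v $ 1) ^ i * (v $ 2) ^ j * (v $ 3) ^ (n - i - j))"
    using assms unfolding ternary_form_def by blast
  have "f v * g v = (\<Sum>i\<le>m. \<Sum>i'\<le>n. \<Sum>j\<le>m - i. \<Sum>j'\<le>n - i'. (c i j * c' i' j') *
      (v $ 1) ^ (i + i') * (v $ 2) ^ (j + j') * (v $ 3) ^ ((m - i - j) + (n - i' - j')))" for v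
    unfolding * sum_product by (intro sum.cong refl) (simp only: power_add mult_ac)
  then show ?thesis
    by (simp only:) (intro ternary_form_sum ternary_form_monomial, auto)
qed

lemma ternary_form_scaleC: "ternary_form n f \<Longrightarrow> ternary_form n (\<lambda>x. c * f x)"
  using ternary_form_mult[OF ternary_form_const[of c]] by simp

lemma ternary_form_power:
  "ternary_form e f \<Longrightarrow> ternary_form (n * e) (\<lambda>x. f x ^ n)"
  by (induction n) (simp_all add: ternary_form_mult)

text \<open>An induction principle: a form is a sum of products of coordinates, so a degree-graded
  property \<open>P\<close> that survives sums and products passes to
  \<open>F \<circ> \<psi>\<close>. Degrees of composites, derivatives, holomorphy and orders of
  vanishing are all instances; for properties without a degree the grading is ignored.\<close>

lemma ternary_form_closure:
  fixes \<psi> :: "'a \<Rightarrow> complex ^ 3"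
  assumes F: "ternary_form d F" and \<psi>: "\<And>i. P e (\<lambda>x. \<psi> x $ i)"
    and const: "\<And>c. P 0 (\<lambda>_. c)" and zero: "\<And>n. P n (\<lambda>_. 0)"
    and add: "\<And>n f g. P n f \<Longrightarrow> P n g \<Longrightarrow> P n (\<lambda>x. f x + g x)"
    and mult: "\<And>m n f g. P m f \<Longrightarrow> P n g \<Longrightarrow> P (m + n) (\<lambda>x. f x * g x)"
  shows "P (d * e) (\<lambda>x. F (\<psi> x) :: complex)"
proof -
  obtain c where *: "\<And>v. F v = (\<Sum>i\<le>d. \<Sum>j\<le>d - i. c i j * (v $ 1) ^ i * (v $ 2) ^ j * (v $ 3) ^ (d - i - j))"
    using F unfolding ternary_form_def by blast
  have power: "P (n * e) (\<lambda>x. (\<psi> x $ i) ^ n)" for n i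
    by (induction n) (simp_all add: const mult[OF \<psi>])
  have sum: "P n (\<lambda>x. \<Sum>a\<in>A. f a x)" if "\<And>a. a \<in> A \<Longrightarrow> P n (f a)" for A :: "nat set" and f n
    using that by (induction A rule: infinite_finite_induct) (simp_all add: zero add)
  have "P (d * e) (\<lambda>x. c i j * (\<psi> x $ 1) ^ i * (\<psi> x $ 2) ^ j * (\<psi> x $ 3) ^ (d - i - j))"
    if "i \<le> d" "j \<le> d - i" for i j
  proof -
    have "P (0 + i * e + j * e + (d - i - j) * e)
       (\<lambda>x. c i j * (\<psi> x $ 1) ^ i * (\<psi> x $ 2) ^ j * (\<psi> x $ 3) ^ (d - i - j))"
      by (intro mult power const)
    moreover have "0 + i * e + j * e + (d - i - j) * e = d * e"
      using that by (simp flip: add_mult_distrib)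
    ultimately show ?thesis by simp
  qed
  then show ?thesis unfolding * by (intro sum) auto
qed

text \<open>Reduced to the ternary case by reading \<open>q\<close> as a form in which the third
  variable does not occur.\<close>

lemma binary_form_closure:
  fixes f g :: "'a \<Rightarrow> complex"
  assumes q: "binary_form n q" and fg: "P e f" "P e g"
    and const: "\<And>c. P 0 (\<lambda>_. c)" and zero: "\<And>n. P n (\<lambda>_. 0)"
    and add: "\<And>n f g. P n f \<Longrightarrow> P n g \<Longrightarrow> P n (\<lambda>x. f x + g x)"
    and mult: "\<And>m n f g. P m f \<Longrightarrow> P n g \<Longrightarrow> P (m + n) (\<lambda>x. f x * g x)"
  shows "P (n * e) (\<lambda>x. q (f x, g x) :: complex)"
proof -
  obtain c where *: "\<And>x. q x = (\<Sum>i\<le>n. c i * fst x ^ i * snd x ^ (n - i))"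
    using q unfolding binary_form_def by blast
  have "ternary_form n (\<lambda>v. \<Sum>i\<le>n. c i * v $ 1 ^ i * v $ 2 ^ (n - i) * v $ 3 ^ 0)"
    by (intro ternary_form_sum ternary_form_monomial) auto
  then have t: "ternary_form n (\<lambda>v. q (v $ 1, v $ 2))" by (simp add: *)
  define \<psi> where "\<psi> = (\<lambda>x. vector [f x, g x, 0] :: complex ^ 3)"
  have \<psi>: "P e (\<lambda>x. \<psi> x $ i)" for i
    using exhaust_3[of i] fg zero[of e] by (elim disjE) (simp_all add: \<psi>_def)
  have "P (n * e) (\<lambda>x. q (\<psi> x $ 1, \<psi> x $ 2))"
    by (rule ternary_form_closure[where P = P and e = e and \<psi> = \<psi> and F = "\<lambda>v. q (v $ 1, v $ 2)", OF t])
      (fact \<psi> const zero add mult)+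
  then show ?thesis by (simp add: \<psi>_def)
qed

lemma ternary_form_compose:
  assumes "ternary_form d F" "\<And>i. ternary_form e (\<lambda>v. T v $ i)"
  shows "ternary_form (d * e) (\<lambda>v. F (T v))"
  using assms by (rule ternary_form_closure[where P = ternary_form])
    (simp_all add: ternary_form_zero ternary_form_add ternary_form_mult)

lemma binary_form_compose_ternary:
  assumes "binary_form n q" "ternary_form e f" "ternary_form e g"
  shows "ternary_form (n * e) (\<lambda>v. q (f v, g v))"
  using assms by (rule binary_form_closure[where P = ternary_form])
    (simp_all add: ternary_form_zero ternary_form_add ternary_form_mult)

lemma ternary_form_scale:
  assumes "ternary_form d F"
  shows "F (c *s v) = c ^ d * F v"
proof -
  obtain k where *: "\<And>v. F v = (\<Sum>i\<le>d. \<Sum>j\<le>d - i. k i j * (v $ 1) ^ i * (v $ 2) ^ j * (v $ 3) ^ (d - i - j))"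
    using assms(1) unfolding ternary_form_def by blast
  have "k i j * ((c *s v) $ 1) ^ i * ((c *s v) $ 2) ^ j * ((c *s v) $ 3) ^ (d - i - j) =
      c ^ d * (k i j * (v $ 1) ^ i * (v $ 2) ^ j * (v $ 3) ^ (d - i - j))" if "i \<le> d" "j \<le> d - i" for i j
  proof -
    have "c ^ d = c ^ i * c ^ j * c ^ (d - i - j)" using that by (simp flip: power_add)
    then show ?thesis by (simp add: power_mult_distrib)
  qed
  then show ?thesis
    unfolding * sum_distrib_left by (intro sum.cong refl) auto
qed

lemma ternary_form_zero_at_0: "ternary_form d F \<Longrightarrow> d \<ge> 1 \<Longrightarrow> F 0 = 0"
  using ternary_form_scale[of d F 0 0] by (simp add: power_0_left)

text \<open>The coefficient at \<open>t ^ d\<close> is the value of \<open>F\<close> at the point at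
  infinity \<open>w\<close> of the line. With the vertex for \<open>w\<close>, which is off the
  curve, the degree is therefore exactly \<open>d\<close> and the leading coefficient is
  known.\<close>

lemma ternary_form_line:
  assumes "ternary_form d F"
  shows "\<exists>p. degree p \<le> d \<and> coeff p d = F w \<and> (\<forall>t. poly p t = F (v + t *s w))"
proof -
  define P where "P = (\<lambda>m (f :: complex ^ 3 \<Rightarrow> complex).
    \<exists>p. degree p \<le> m \<and> coeff p m = f w \<and> (\<forall>t. poly p t = f (v + t *s w)))"
  have "P (d * 1) (\<lambda>v. F v)"
  proof (rule ternary_form_closure[OF assms])
    show "P 1 (\<lambda>v. v $ i)" for i
      unfolding P_def by (intro exI[of _ "[:v $ i, w $ i:]"]) simp
    show "P 0 (\<lambda>_. c)" for c unfolding P_def by (intro exI[of _ "[:c:]"]) simp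
    show "P n (\<lambda>_. 0)" for n unfolding P_def by (intro exI[of _ 0]) simp
  next
    fix n f g assume "P n f" "P n g"
    then obtain p q where "degree p \<le> n" "coeff p n = f w" "\<And>t. poly p t = f (v + t *s w)"
        "degree q \<le> n" "coeff q n = g w" "\<And>t. poly q t = g (v + t *s w)"
      unfolding P_def by blast
    then show "P n (\<lambda>v. f v + g v)"
      unfolding P_def by (intro exI[of _ "p + q"]) (simp add: degree_add_le)
  next
    fix m n f g assume "P m f" "P n g"
    then obtain p q where pq: "degree p \<le> m" "coeff p m = f w" "\<And>t. poly p t = f (v + t *s w)"
        "degree q \<le> n" "coeff q n = g w" "\<And>t. poly q t = g (v + t *s w)"
      unfolding P_def by blast
    \<comment> \<open>For \<open>i \<noteq> m\<close> one of the two factors is a coefficient beyond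
      the degree bound.\<close>
    have "coeff (p * q) (m + n) = (\<Sum>i\<le>m + n. if i = m then coeff p m * coeff q n else 0)"
      unfolding coeff_mult
    proof (intro sum.cong refl)
      fix i
      show "coeff p i * coeff q (m + n - i) = (if i = m then coeff p m * coeff q n else 0)"
        using pq(1,4) coeff_eq_0[of p i] coeff_eq_0[of q "m + n - i"]
        by (cases i m rule: linorder_cases) auto
    qed
    then have "coeff (p * q) (m + n) = f w * g w" using pq by simp
    moreover have "degree (p * q) \<le> m + n"
      using degree_mult_le[of p q] pq by linarith
    ultimately show "P (m + n) (\<lambda>v. f v * g v)"
      unfolding P_def using pq by (intro exI[of _ "p * q"]) simp
  qed
  then show ?thesis by (simp add: P_def)
qed

section \<open>Complex differentiability\<close>

lemma has_derivative_vec: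
  fixes f :: "'a::real_normed_vector \<Rightarrow> complex ^ 'n"
  assumes "\<And>i. ((\<lambda>x. f x $ i) has_derivative (\<lambda>h. f' h $ i)) (at a within S)"
  shows "(f has_derivative f') (at a within S)"
proof (subst has_derivative_componentwise_within, intro ballI)
  fix b :: "complex ^ 'n" assume "b \<in> Basis"
  then obtain i k where b: "b = axis i k" by (auto simp: Basis_vec_def)
  show "((\<lambda>x. f x \<bullet> b) has_derivative (\<lambda>x. f' x \<bullet> b)) (at a within S)"
    unfolding b inner_axis by (intro has_derivative_inner_left assms)
qed

text \<open>\<open>D\<close> is the gradient. Its continuity feeds the inverse function theorem, and
  the explicit formula records complex linearity, which \<open>has_derivative\<close> alone does not
  give.\<close>

lemma ternary_form_has_derivative:
  assumes "ternary_form d F"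
  shows "\<exists>D :: complex ^ 3 \<Rightarrow> complex ^ 3. continuous_on UNIV D \<and>
    (\<forall>v. (F has_derivative (\<lambda>h. D v $ 1 * h $ 1 + D v $ 2 * h $ 2 + D v $ 3 * h $ 3)) (at v))"
proof -
  define P where "P = (\<lambda>(_ :: nat) f. \<exists>D :: complex ^ 3 \<Rightarrow> complex ^ 3. continuous_on UNIV D \<and>
    (\<forall>v. (f has_derivative (\<lambda>h. D v $ 1 * h $ 1 + D v $ 2 * h $ 2 + D v $ 3 * h $ 3)) (at v)))"
  have const: "P n (\<lambda>_. k)" for n k
    unfolding P_def by (intro exI[of _ "\<lambda>_. 0"]) simp
  have coord: "P n (\<lambda>v. v $ i)" for n i
  proof -
    have "((\<lambda>v. v $ i) has_derivative (\<lambda>h. axis i 1 $ 1 * h $ 1 + axis i 1 $ 2 * h $ 2 + axis i 1 $ 3 * h $ 3)) (at v)"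
      for v :: "complex ^ 3"
    proof -
      have "((\<lambda>v. v $ i) has_derivative (\<lambda>h. h $ i)) (at v)"
        by (rule bounded_linear_imp_has_derivative[OF bounded_linear_vec_nth])
      moreover have "(\<lambda>h :: complex ^ 3. h $ i) = (\<lambda>h. axis i 1 $ 1 * h $ 1 + axis i 1 $ 2 * h $ 2 + axis i 1 $ 3 * h $ 3)"
        using exhaust_3[of i] by (auto simp: axis_def fun_eq_iff)
      ultimately show ?thesis by simp
    qed
    then show ?thesis unfolding P_def by (intro exI[of _ "\<lambda>_. axis i 1"]) auto
  qed
  have add: "P n (\<lambda>v. f v + g v)" if "P n f" "P n g" for n f g
  proof -
    from that obtain D D' :: "complex ^ 3 \<Rightarrow> complex ^ 3" where "continuous_on UNIV D" "continuous_on UNIV D'"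
      "\<And>v. (f has_derivative (\<lambda>h. D v $ 1 * h $ 1 + D v $ 2 * h $ 2 + D v $ 3 * h $ 3)) (at v)"
      "\<And>v. (g has_derivative (\<lambda>h. D' v $ 1 * h $ 1 + D' v $ 2 * h $ 2 + D' v $ 3 * h $ 3)) (at v)"
      unfolding P_def by blast
    then show ?thesis unfolding P_def
      by (intro exI[of _ "\<lambda>v. D v + D' v"] conjI allI has_derivative_eq_rhs[OF has_derivative_add])
         (auto intro!: continuous_intros simp: algebra_simps fun_eq_iff)
  qed
  have mult: "P (m + n) (\<lambda>v. f v * g v)" if "P m f" "P n g" for m n f g
  proof -
    from that obtain D D' :: "complex ^ 3 \<Rightarrow> complex ^ 3" where D: "continuous_on UNIV D" "continuous_on UNIV D'"
      "\<And>v. (f has_derivative (\<lambda>h. D v $ 1 * h $ 1 + D v $ 2 * h $ 2 + D v $ 3 * h $ 3)) (at v)"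
      "\<And>v. (g has_derivative (\<lambda>h. D' v $ 1 * h $ 1 + D' v $ 2 * h $ 2 + D' v $ 3 * h $ 3)) (at v)"
      unfolding P_def by blast
    have cont: "continuous_on UNIV f" "continuous_on UNIV g"
      by (auto simp: continuous_on_eq_continuous_at
          intro: has_derivative_continuous[OF D(3)] has_derivative_continuous[OF D(4)])
    have "continuous_on UNIV (\<lambda>v. \<chi> i. f v * D' v $ i + D v $ i * g v)"
      by (intro continuous_intros cont D)
    then show ?thesis unfolding P_def
      by (intro exI[of _ "\<lambda>v. \<chi> i. f v * D' v $ i + D v $ i * g v"] conjI allI
            has_derivative_eq_rhs[OF has_derivative_mult[OF D(3,4)]])
         (auto simp: algebra_simps fun_eq_iff)
  qed
  have "P (d * 1) F"
    by (rule ternary_form_closure[where P = P and \<psi> = "\<lambda>x. x", OF assms]) (fact coord const add mult)+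
  then show ?thesis unfolding P_def .
qed

lemma ternary_form_continuous: "ternary_form d F \<Longrightarrow> continuous_on S F"
  using ternary_form_has_derivative[of d F]
  by (meson continuous_at_imp_continuous_on has_derivative_continuous)

section \<open>Holomorphic functions of two variables\<close>

definition cdiff2 :: "(complex \<times> complex \<Rightarrow> complex) \<Rightarrow> complex \<times> complex \<Rightarrow> bool" where
  "cdiff2 f x \<longleftrightarrow> (\<exists>a b. (f has_derivative (\<lambda>(h, k). a * h + b * k)) (at x))"

text \<open>The rules of calculus are proved for \<open>cdiff2\<close> at a single point and then
  combined under \<open>eventually\<close>.\<close>

lemma holo2_iff: "holo2 f \<longleftrightarrow> eventually (cdiff2 f) (nhds 0)"
  unfolding holo2_def cdiff2_def ..

lemma cdiff2I:
  "(f has_derivative D) (at x) \<Longrightarrow> D = (\<lambda>(h, k). a * h + b * k) \<Longrightarrow> cdiff2 f x"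
  unfolding cdiff2_def by blast

lemma cdiff2_const: "cdiff2 (\<lambda>_. c) x"
  unfolding cdiff2_def by (intro exI[of _ 0]) (auto simp: case_prod_unfold)

lemma cdiff2_fst: "cdiff2 fst x"
  unfolding cdiff2_def
  by (rule exI[of _ 1], rule exI[of _ 0]) (auto simp: case_prod_unfold intro!: derivative_eq_intros)

lemma cdiff2_snd: "cdiff2 snd x"
  unfolding cdiff2_def
  by (rule exI[of _ 0], rule exI[of _ 1]) (auto simp: case_prod_unfold intro!: derivative_eq_intros)

lemma cdiff2_add:
  assumes "cdiff2 f x" "cdiff2 g x"
  shows "cdiff2 (\<lambda>x. f x + g x) x"
proof -
  from assms obtain a b a' b' where "(f has_derivative (\<lambda>(h, k). a * h + b * k)) (at x)"
    "(g has_derivative (\<lambda>(h, k). a' * h + b' * k)) (at x)"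
    unfolding cdiff2_def by blast
  from has_derivative_add[OF this] show ?thesis
    by (rule cdiff2I[where a = "a + a'" and b = "b + b'"]) (simp add: fun_eq_iff algebra_simps)
qed

lemma cdiff2_mult:
  assumes "cdiff2 f x" "cdiff2 g x"
  shows "cdiff2 (\<lambda>x. f x * g x) x"
proof -
  from assms obtain a b a' b' where "(f has_derivative (\<lambda>(h, k). a * h + b * k)) (at x)"
    "(g has_derivative (\<lambda>(h, k). a' * h + b' * k)) (at x)"
    unfolding cdiff2_def by blast
  from has_derivative_mult[OF this] show ?thesis
    by (rule cdiff2I[where a = "f x * a' + a * g x" and b = "f x * b' + b * g x"]) (simp add: fun_eq_iff algebra_simps)
qed

lemma cdiff2_comp:
  assumes "cdiff2 f (p x, q x)" "cdiff2 p x" "cdiff2 q x"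
  shows "cdiff2 (\<lambda>x. f (p x, q x)) x"
proof -
  from assms obtain a b c d e g where
    D: "(f has_derivative (\<lambda>(h, k). a * h + b * k)) (at (p x, q x))"
    "(p has_derivative (\<lambda>(h, k). c * h + d * k)) (at x)"
    "(q has_derivative (\<lambda>(h, k). e * h + g * k)) (at x)"
    unfolding cdiff2_def by blast
  from has_derivative_compose[OF has_derivative_Pair[OF D(2,3)] D(1)] show ?thesis
    by (rule cdiff2I[where a = "a * c + b * e" and b = "a * d + b * g"]) (simp add: fun_eq_iff algebra_simps)
qed

lemma cdiff2_comp1:
  assumes "cdiff2 f x" "g field_differentiable (at (f x))"
  shows "cdiff2 (\<lambda>x. g (f x)) x"
proof -
  from assms obtain a b c where D: "(f has_derivative (\<lambda>(h, k). a * h + b * k)) (at x)"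
    "(g has_derivative (\<lambda>h. c * h)) (at (f x))"
    unfolding cdiff2_def field_differentiable_def has_field_derivative_def by blast
  from has_derivative_compose[OF D] show ?thesis
    by (rule cdiff2I[where a = "c * a" and b = "c * b"]) (simp add: fun_eq_iff algebra_simps)
qed

lemma cdiff2_isCont: "cdiff2 f x \<Longrightarrow> isCont f x"
  unfolding cdiff2_def using has_derivative_continuous by blast

lemma holo2_at_0: "holo2 f \<Longrightarrow> cdiff2 f 0"
  unfolding holo2_iff by (rule eventually_nhds_x_imp_x)

lemma holo2_isCont: "holo2 f \<Longrightarrow> isCont f 0"
  by (intro cdiff2_isCont holo2_at_0)

lemma holo2_const [simp]: "holo2 (\<lambda>_. c)"
  unfolding holo2_iff by (intro always_eventually allI cdiff2_const)

lemma holo2_fst [simp]: "holo2 (\<lambda>x. fst x)"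
  unfolding holo2_iff by (intro always_eventually allI cdiff2_fst)

lemma holo2_snd [simp]: "holo2 (\<lambda>x. snd x)"
  unfolding holo2_iff by (intro always_eventually allI cdiff2_snd)

lemma holo2_add: "holo2 f \<Longrightarrow> holo2 g \<Longrightarrow> holo2 (\<lambda>x. f x + g x)"
  unfolding holo2_iff by (auto elim: eventually_elim2 intro: cdiff2_add)

lemma holo2_mult: "holo2 f \<Longrightarrow> holo2 g \<Longrightarrow> holo2 (\<lambda>x. f x * g x)"
  unfolding holo2_iff by (auto elim: eventually_elim2 intro: cdiff2_mult)

lemma holo2_minus: "holo2 f \<Longrightarrow> holo2 (\<lambda>x. - f x)"
  using holo2_mult[OF holo2_const[of "-1"]] by simp

lemma holo2_diff: "holo2 f \<Longrightarrow> holo2 g \<Longrightarrow> holo2 (\<lambda>x. f x - g x)"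
  using holo2_add[OF _ holo2_minus] by simp

lemma holo2_power: "holo2 f \<Longrightarrow> holo2 (\<lambda>x. f x ^ n)"
  by (induction n) (simp_all add: holo2_mult)

lemma holo2_prod: "(\<And>a. a \<in> A \<Longrightarrow> holo2 (f a)) \<Longrightarrow> holo2 (\<lambda>x. \<Prod>a\<in>A. f a x)"
  by (induction A rule: infinite_finite_induct) (simp_all add: holo2_mult)

lemma eventually_nhds_compose:
  assumes "eventually P (nhds (f x))" "isCont f x"
  shows "eventually (\<lambda>y. P (f y)) (nhds x)"
  using assms(1)
proof (rule eventually_compose_filterlim)
  show "filterlim f (nhds (f x)) (nhds x)"
    using assms(2) by (simp add: isCont_def tendsto_at_iff_tendsto_nhds)
qed

lemma holo2_analytic:
  assumes "holo2 f" "g analytic_on {f 0}"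
  shows "holo2 (\<lambda>x. g (f x))"
proof -
  from assms(2) obtain S where S: "open S" "f 0 \<in> S" "g holomorphic_on S"
    by (meson analytic_at)
  then have "eventually (\<lambda>z. z \<in> S) (nhds (f 0))" by (simp add: eventually_nhds_in_open)
  from eventually_nhds_compose[OF this holo2_isCont[OF assms(1)]] assms(1)
  show ?thesis unfolding holo2_iff
  proof eventually_elim
    case (elim x)
    then have "g field_differentiable (at (f x))"
      using S holomorphic_on_imp_differentiable_at by blast
    from elim(2) this show ?case by (rule cdiff2_comp1)
  qed
qed

lemma holo2_inverse: "holo2 f \<Longrightarrow> f 0 \<noteq> 0 \<Longrightarrow> holo2 (\<lambda>x. inverse (f x))"
  by (rule holo2_analytic) (auto intro!: analytic_intros)

lemma holo2_divide: "holo2 f \<Longrightarrow> holo2 g \<Longrightarrow> g 0 \<noteq> 0 \<Longrightarrow> holo2 (\<lambda>x. f x / g x)"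
  unfolding divide_inverse by (intro holo2_mult holo2_inverse)

lemma holo2_comp:
  assumes "holo2 f" "holo2 p" "holo2 q" "p 0 = 0" "q 0 = 0"
  shows "holo2 (\<lambda>x. f (p x, q x))"
proof -
  have "isCont (\<lambda>x. (p x, q x)) 0" using assms by (intro continuous_intros holo2_isCont)
  moreover have "eventually (cdiff2 f) (nhds (p 0, q 0))"
    using assms unfolding holo2_iff by (simp add: zero_prod_def)
  ultimately have "eventually (\<lambda>x. cdiff2 f (p x, q x)) (nhds 0)"
    by (intro eventually_nhds_compose[where f = "\<lambda>x. (p x, q x)"])
  moreover have "eventually (cdiff2 p) (nhds 0)" "eventually (cdiff2 q) (nhds 0)"
    using assms unfolding holo2_iff by auto
  ultimately show ?thesis unfolding holo2_iff
    by eventually_elim (rule cdiff2_comp)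
qed

lemma holo2_ternary_form:
  assumes "ternary_form d F" "\<And>i. holo2 (\<lambda>x. \<psi> x $ i)"
  shows "holo2 (\<lambda>x. F (\<psi> x))"
  using assms by (rule ternary_form_closure[where P = "\<lambda>_. holo2"]) (simp_all add: holo2_add holo2_mult)

section \<open>Orders of vanishing\<close>

lemma vanishes_to_order_const: "vanishes_to_order 0 (\<lambda>_. c)"
  unfolding vanishes_to_order_def by (intro exI[of _ "norm c"]) simp

lemma vanishes_to_order_0:
  assumes "isCont f 0"
  shows "vanishes_to_order 0 f"
proof -
  have "eventually (\<lambda>z. norm (z - f 0) < 1) (nhds (f 0))"
    using eventually_nhds_in_open[of "ball (f 0) 1" "f 0"] by (simp add: dist_norm norm_minus_commute)
  from eventually_nhds_compose[OF this assms]
  have "\<forall>\<^sub>F x in nhds 0. norm (f x) \<le> (norm (f 0) + 1) * norm x ^ 0"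
  proof eventually_elim
    case (elim x)
    then show ?case using norm_triangle_sub[of "f x" "f 0"] by simp
  qed
  then show ?thesis unfolding vanishes_to_order_def by blast
qed

lemma vanishes_to_order_1:
  assumes "holo2 f" "f 0 = 0"
  shows "vanishes_to_order 1 f"
proof -
  obtain D where D: "(f has_derivative D) (at 0)"
    using holo2_at_0[OF assms(1)] unfolding cdiff2_def by blast
  then obtain B where B: "\<And>x. norm (D x) \<le> norm x * B"
    using bounded_linear.bounded has_derivative_bounded_linear by blast
  obtain e where e: "e > 0" "\<And>y. norm y < e \<Longrightarrow> norm (f y - D y) \<le> norm y"
    using D assms(2) unfolding has_derivative_at_alt
    by (metis diff_zero mult_1 zero_less_one)
  have "eventually (\<lambda>y :: complex \<times> complex. norm y < e) (nhds 0)"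
    using eventually_nhds_in_open[of "ball (0 :: complex \<times> complex) e" 0] e(1) by simp
  then have "\<forall>\<^sub>F x in nhds 0. norm (f x) \<le> (B + 1) * norm x ^ 1"
  proof eventually_elim
    case (elim x)
    have "norm (f x) \<le> norm (D x) + norm (f x - D x)" by (metis norm_triangle_sub)
    with e(2)[OF elim] B[of x] show ?case by (simp add: algebra_simps)
  qed
  then show ?thesis unfolding vanishes_to_order_def by blast
qed

lemma vanishes_to_order_add:
  assumes "vanishes_to_order t f" "vanishes_to_order t g"
  shows "vanishes_to_order t (\<lambda>x. f x + g x)"
proof -
  obtain K L where "\<forall>\<^sub>F x in nhds 0. norm (f x) \<le> K * norm x ^ t" "\<forall>\<^sub>F x in nhds 0. norm (g x) \<le> L * norm x ^ t"
    using assms unfolding vanishes_to_order_def by blast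
  then have "\<forall>\<^sub>F x in nhds 0. norm (f x + g x) \<le> (K + L) * norm x ^ t"
    by eventually_elim (simp add: algebra_simps norm_triangle_le)
  then show ?thesis unfolding vanishes_to_order_def by blast
qed

lemma vanishes_to_order_mult:
  assumes "vanishes_to_order s f" "vanishes_to_order t g"
  shows "vanishes_to_order (s + t) (\<lambda>x. f x * g x)"
proof -
  obtain K L where "\<forall>\<^sub>F x in nhds 0. norm (f x) \<le> K * norm x ^ s" "\<forall>\<^sub>F x in nhds 0. norm (g x) \<le> L * norm x ^ t"
    using assms unfolding vanishes_to_order_def by blast
  then have "\<forall>\<^sub>F x in nhds 0. norm (f x * g x) \<le> (K * L) * norm x ^ (s + t)"
  proof eventually_elim
    case (elim x)
    have "norm (f x) * norm (g x) \<le> (K * norm x ^ s) * (L * norm x ^ t)"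
      by (intro mult_mono elim order_trans[OF norm_ge_zero elim(1)]) simp
    then show ?case by (simp add: norm_mult power_add mult_ac)
  qed
  then show ?thesis unfolding vanishes_to_order_def by blast
qed

lemma vanishes_to_order_mono:
  assumes "vanishes_to_order s f" "t \<le> s"
  shows "vanishes_to_order t f"
proof -
  obtain K where K: "\<forall>\<^sub>F x in nhds 0. norm (f x) \<le> K * norm x ^ s"
    using assms(1) unfolding vanishes_to_order_def by blast
  have "eventually (\<lambda>x :: complex \<times> complex. norm x < 1) (nhds 0)"
    using eventually_nhds_in_open[of "ball (0 :: complex \<times> complex) 1" 0] by simp
  with K have "\<forall>\<^sub>F x in nhds 0. norm (f x) \<le> \<bar>K\<bar> * norm x ^ t"
  proof eventually_elim
    case (elim x)
    have "K * norm x ^ s \<le> \<bar>K\<bar> * norm x ^ t"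
      using elim assms(2) by (intro mult_mono power_decreasing) auto
    with elim show ?case by linarith
  qed
  then show ?thesis unfolding vanishes_to_order_def by blast
qed

lemma vanishes_to_order_zero: "vanishes_to_order t (\<lambda>_. 0)"
  unfolding vanishes_to_order_def by (intro exI[of _ 0]) simp

lemma vanishes_to_order_prod:
  "finite A \<Longrightarrow> (\<And>a. a \<in> A \<Longrightarrow> vanishes_to_order t (f a)) \<Longrightarrow>
     vanishes_to_order (card A * t) (\<lambda>x. \<Prod>a\<in>A. f a x)"
  by (induction A rule: finite_induct)
     (simp_all add: vanishes_to_order_const vanishes_to_order_mult)

lemma vanishes_to_order_ternary_form:
  assumes "ternary_form d F" "\<And>i. vanishes_to_order e (\<lambda>x. \<psi> x $ i)"
  shows "vanishes_to_order (d * e) (\<lambda>x. F (\<psi> x))"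
  using assms by (rule ternary_form_closure[where P = vanishes_to_order])
    (simp_all add: vanishes_to_order_const vanishes_to_order_zero vanishes_to_order_add vanishes_to_order_mult)

lemma vanishes_to_order_binary_form:
  assumes "binary_form n q" "vanishes_to_order e f" "vanishes_to_order e g"
  shows "vanishes_to_order (n * e) (\<lambda>x. q (f x, g x))"
  using assms by (rule binary_form_closure[where P = vanishes_to_order])
    (simp_all add: vanishes_to_order_const vanishes_to_order_zero vanishes_to_order_add vanishes_to_order_mult)

lemma vanishes_to_order_cong:
  assumes "\<forall>\<^sub>F x in nhds 0. f x = g x"
  shows "vanishes_to_order t f \<longleftrightarrow> vanishes_to_order t g"
proof -
  have "(\<forall>\<^sub>F x in nhds 0. norm (f x) \<le> K * norm x ^ t) \<longleftrightarrow> (\<forall>\<^sub>F x in nhds 0. norm (g x) \<le> K * norm x ^ t)" for K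
    by (rule eventually_cong[OF assms]) simp
  then show ?thesis unfolding vanishes_to_order_def by simp
qed

section \<open>Types of germs\<close>

lemma blow_chart_0 [simp]: "blow_chart \<theta> (0, 0) = (0, 0)"
  by (cases \<theta>) auto

lemma holo2_blow_chart:
  assumes "holo2 f"
  shows "holo2 (\<lambda>x. f (blow_chart \<theta> x))"
proof (cases \<theta>)
  case None
  have "holo2 (\<lambda>x. f (fst x * snd x, fst x))"
    by (rule holo2_comp[OF assms]) (auto intro!: holo2_mult)
  moreover have "blow_chart \<theta> x = (fst x * snd x, fst x)" for x
    using None by (cases x) auto
  ultimately show ?thesis by simp
next
  case (Some b)
  have "holo2 (\<lambda>x. f (fst x, fst x * (b + snd x)))"
    by (rule holo2_comp[OF assms]) (auto intro!: holo2_mult holo2_add)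
  moreover have "blow_chart \<theta> x = (fst x, fst x * (b + snd x))" for x
    using Some by (cases x) auto
  ultimately show ?thesis by simp
qed

lemma isCont_blow_chart: "isCont (blow_chart \<theta>) x"
proof (cases \<theta>)
  case None
  have eq: "blow_chart \<theta> = (\<lambda>x. (fst x * snd x, fst x))" using None by (auto simp: fun_eq_iff)
  show ?thesis unfolding eq by (intro continuous_intros)
next
  case (Some b)
  have eq: "blow_chart \<theta> = (\<lambda>x. (fst x, fst x * (b + snd x)))" using Some by (auto simp: fun_eq_iff)
  show ?thesis unfolding eq by (intro continuous_intros)
qed

lemma eventually_blow_chart:
  "eventually P (nhds 0) \<Longrightarrow> \<forall>\<^sub>F x in nhds 0. P (blow_chart \<theta> x)"
  by (rule eventually_nhds_compose) (simp_all add: zero_prod_def isCont_blow_chart)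

lemma germ_type_cong:
  assumes "germ_type f \<tau>" "\<forall>\<^sub>F x in nhds 0. f x = f' x"
  shows "germ_type f' \<tau>"
  using assms(1)
proof cases
  case (1 t g dirs \<tau>s)
  have "has_mult f' t"
    using 1 vanishes_to_order_cong[OF assms(2)] unfolding has_mult_def by simp
  moreover have "strict_transform t f' \<theta> (g \<theta>)" for \<theta>
  proof -
    have *: "holo2 (g \<theta>)" "\<forall>\<^sub>F x in nhds 0. f (blow_chart \<theta> x) = fst x ^ t * g \<theta> x"
      using 1 unfolding strict_transform_def by auto
    have "\<forall>\<^sub>F x in nhds 0. f' (blow_chart \<theta> x) = fst x ^ t * g \<theta> x"
      using *(2) eventually_blow_chart[OF assms(2), of \<theta>] by eventually_elim simp
    with * show ?thesis unfolding strict_transform_def by auto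
  qed
  moreover have "list_all2 (\<lambda>\<theta>. germ_type (g \<theta>)) dirs \<tau>s"
    using 1 by (auto elim: list_all2_mono)
  ultimately show ?thesis using 1 unfolding \<open>\<tau> = Sing t \<tau>s\<close>
    by (intro germ_type.intros[of t f' g dirs \<tau>s]) auto
qed

text \<open>Along the line \<open>u = 0\<close> of the chart, \<open>f\<close> equals
  \<open>s ^ t * g (s, 0)\<close> while the argument of \<open>f\<close> has norm
  \<open>O(s)\<close>. Vanishing to order \<open>t + 1\<close> would force \<open>g (s, 0)\<close>
  to tend to 0 with \<open>s\<close>.\<close>

lemma not_vanishes_to_Suc_order:
  assumes "\<forall>\<^sub>F x in nhds 0. f (blow_chart \<theta> x) = fst x ^ t * g x" "isCont g 0" "g 0 \<noteq> 0"
  shows "\<not> vanishes_to_order (Suc t) f"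
proof
  assume "vanishes_to_order (Suc t) f"
  then obtain K where K: "\<forall>\<^sub>F x in nhds 0. norm (f x) \<le> K * norm x ^ Suc t"
    unfolding vanishes_to_order_def by blast
  \<comment> \<open>\<open>L\<close> bounds the length of the direction vector of the chart,
    \<open>(0, 1)\<close> or \<open>(1, b)\<close>.\<close>
  define L where "L = (case \<theta> of None \<Rightarrow> 1 | Some b \<Rightarrow> 1 + norm b)"
  have L: "norm (blow_chart \<theta> (s, 0)) \<le> norm s * L" for s :: complex
  proof (cases \<theta>)
    case None
    then show ?thesis by (simp add: L_def norm_Pair)
  next
    case (Some b)
    then show ?thesis using norm_Pair_le[of s "s * b"] by (simp add: L_def norm_mult algebra_simps)
  qed
  have L0: "L \<ge> 0" by (auto simp: L_def split: option.splits)
  have ct: "isCont (\<lambda>s :: complex. (s, 0 :: complex)) 0" by (intro continuous_intros)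
  have "\<forall>\<^sub>F x in nhds 0. norm (fst x ^ t * g x) \<le> K * norm (blow_chart \<theta> x) ^ Suc t"
    using assms(1) eventually_blow_chart[OF K, of \<theta>] by eventually_elim metis
  then have "\<forall>\<^sub>F s in nhds 0. norm (s ^ t * g (s, 0)) \<le> K * norm (blow_chart \<theta> (s, 0)) ^ Suc t"
    using eventually_nhds_compose[OF _ ct, of "\<lambda>x. norm (fst x ^ t * g x) \<le> K * norm (blow_chart \<theta> x) ^ Suc t"]
    by (simp add: zero_prod_def)
  then have "\<forall>\<^sub>F s in at 0. norm (g (s, 0)) \<le> \<bar>K\<bar> * L ^ Suc t * norm s"
    unfolding eventually_at_filter
  proof eventually_elim
    case (elim s)
    show ?case
    proof (intro impI)
      assume "s \<noteq> 0"
      have "norm s ^ t * norm (g (s, 0)) \<le> K * norm (blow_chart \<theta> (s, 0)) ^ Suc t"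
        using elim by (simp add: norm_mult norm_power)
      also have "\<dots> \<le> \<bar>K\<bar> * norm (blow_chart \<theta> (s, 0)) ^ Suc t"
        by (intro mult_right_mono) auto
      also have "\<dots> \<le> \<bar>K\<bar> * (norm s * L) ^ Suc t"
        by (intro mult_left_mono power_mono L) auto
      also have "\<dots> = norm s ^ t * (\<bar>K\<bar> * L ^ Suc t * norm s)"
        by (simp add: power_mult_distrib mult_ac)
      finally show "norm (g (s, 0)) \<le> \<bar>K\<bar> * L ^ Suc t * norm s"
        using \<open>s \<noteq> 0\<close> by (simp add: mult_le_cancel_left)
    qed
  qed
  moreover have "((\<lambda>s. norm (g (s, 0))) \<longlongrightarrow> norm (g 0)) (at 0)"
  proof -
    have "isCont (\<lambda>s. g (s, 0)) 0"
      using isCont_o2[OF ct, of g] assms(2) by (simp add: zero_prod_def)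
    then have "((\<lambda>s. g (s, 0)) \<longlongrightarrow> g (0, 0)) (at 0)" by (simp add: isCont_def)
    from tendsto_norm[OF this] show ?thesis by (simp add: zero_prod_def)
  qed
  moreover have "((\<lambda>s :: complex. \<bar>K\<bar> * L ^ Suc t * norm s) \<longlongrightarrow> \<bar>K\<bar> * L ^ Suc t * norm (0 :: complex)) (at 0)"
    by (intro tendsto_intros)
  ultimately have "norm (g 0) \<le> \<bar>K\<bar> * L ^ Suc t * norm (0 :: complex)"
    by (intro tendsto_le[of "at 0"]) auto
  with assms(3) show False by simp
qed

text \<open>At most one factor vanishes at 0, so by the product rule the differential is a nonzero
  multiple of the differential of that factor, which does not vanish along the exceptional curve
  \<open>s = 0\<close>.\<close>

lemma not_germ_singular_prod:
  fixes d :: nat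
  assumes U: "holo2 U" "U 0 \<noteq> 0" and h: "\<And>i. i < d \<Longrightarrow> holo2 (h i)"
    and inj: "\<And>i j. i < d \<Longrightarrow> j < d \<Longrightarrow> h i 0 = 0 \<Longrightarrow> h j 0 = 0 \<Longrightarrow> i = j"
    and der: "\<And>i. i < d \<Longrightarrow> h i 0 = 0 \<Longrightarrow> \<exists>c. c \<noteq> 0 \<and> ((\<lambda>u. h i (0, u)) has_field_derivative c) (at 0)"
  shows "\<not> germ_singular (\<lambda>x. U x * (\<Prod>i<d. h i x))"
proof
  assume sing: "germ_singular (\<lambda>x. U x * (\<Prod>i<d. h i x))"
  then obtain i where i: "i < d" "h i 0 = 0"
    using U(2) unfolding germ_singular_def by auto
  define r where "r = (\<lambda>x. U x * (\<Prod>j\<in>{..<d} - {i}. h j x))"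
  have "holo2 r" unfolding r_def using U h by (intro holo2_mult holo2_prod) auto
  then obtain E where E: "(r has_derivative E) (at 0)"
    using holo2_at_0 unfolding cdiff2_def by blast
  have r0: "r 0 \<noteq> 0" unfolding r_def using U i inj by auto
  have eq: "(\<lambda>x. U x * (\<Prod>i<d. h i x)) = (\<lambda>x. h i x * r x)"
    unfolding r_def using i by (auto simp: fun_eq_iff prod.remove[of "{..<d}" i] mult_ac)
  obtain D where D: "(h i has_derivative D) (at 0)"
    using holo2_at_0[OF h[OF i(1)]] unfolding cdiff2_def by blast
  have "((\<lambda>x. h i x * r x) has_derivative (\<lambda>_. 0)) (at 0)"
    using sing unfolding germ_singular_def eq by simp
  with has_derivative_mult[OF D E] have "(\<lambda>k. h i 0 * E k + D k * r 0) = (\<lambda>_. 0)"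
    by (rule has_derivative_unique)
  from fun_cong[OF this, of "(0, 1)"] have "D (0, 1) * r 0 = 0" using i by simp
  then have D0: "D (0, 1) = 0" using r0 by simp
  obtain c where c: "c \<noteq> 0" "((\<lambda>u. h i (0, u)) has_field_derivative c) (at 0)"
    using der[OF i] by blast
  have "((\<lambda>u. (0, u)) has_derivative (\<lambda>u. (0 :: complex, u))) (at (0 :: complex))"
    by (auto intro!: derivative_eq_intros)
  from has_derivative_compose[OF this, of "h i" D] D
  have "((\<lambda>u. h i (0, u)) has_derivative (\<lambda>u. D (0, u))) (at 0)" by (simp add: zero_prod_def)
  from has_derivative_unique[OF this c(2)[unfolded has_field_derivative_def]]
  have "(\<lambda>u. D (0, u)) = (*) c" .
  from fun_cong[OF this, of 1] have "D (0, 1) = c" by simp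
  with c D0 show False by simp
qed

lemma rep_type_1 [simp]: "rep_type d (Suc 0) = Sing d []"
  by (simp add: rep_type_def)

lemma rep_type_Suc_Suc [simp]: "rep_type d (Suc (Suc n)) = Sing d [rep_type d (Suc n)]"
  by (simp add: rep_type_def)

lemma compose_blow_chart_0 [simp]: "f (blow_chart \<theta> 0) = f 0"
  by (simp add: zero_prod_def)

text \<open>One level of \<open>germ_type\<close> for a product of \<open>d\<close> smooth branches:
  each equation \<open>h i\<close> loses exactly one factor \<open>s\<close> in every chart and
  becomes \<open>k \<theta> i\<close>. The direction \<open>\<theta>'\<close> is tangent to no
  branch and shows that the multiplicity is not larger than \<open>d\<close>.\<close>

lemma germ_type_prodI:
  fixes d :: nat
  defines "g \<equiv> \<lambda>U k \<theta> x. U (blow_chart \<theta> x) * (\<Prod>i<d. k \<theta> i x)"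
  assumes d: "d \<ge> 2" and U: "holo2 U" "U 0 \<noteq> 0" and h: "\<And>i. i < d \<Longrightarrow> holo2 (h i)"
    and k: "\<And>\<theta> i. i < d \<Longrightarrow> holo2 (k \<theta> i)"
    and eq: "\<And>\<theta> i x. i < d \<Longrightarrow> h i (blow_chart \<theta> x) = fst x * k \<theta> i x"
    and k0: "\<And>i. i < d \<Longrightarrow> k \<theta>' i 0 \<noteq> 0"
    and dirs: "distinct dirs" "list_all2 (\<lambda>\<theta>. germ_type (g U k \<theta>)) dirs \<tau>s"
      "\<And>\<theta>. \<theta> \<notin> set dirs \<Longrightarrow> \<not> germ_singular (g U k \<theta>)"
  shows "germ_type (\<lambda>x. U x * (\<Prod>i<d. h i x)) (Sing d \<tau>s)"
proof -
  let ?f = "\<lambda>x. U x * (\<Prod>i<d. h i x)"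
  have g: "holo2 (g U k \<theta>)" for \<theta>
    unfolding g_def using U k by (intro holo2_mult holo2_prod holo2_blow_chart) auto
  have fg: "?f (blow_chart \<theta> x) = fst x ^ d * g U k \<theta> x" for \<theta> x
  proof -
    have "(\<Prod>i<d. h i (blow_chart \<theta> x)) = (\<Prod>i<d. fst x * k \<theta> i x)"
      by (intro prod.cong refl) (simp add: eq)
    then show ?thesis by (simp add: g_def prod.distrib mult_ac)
  qed
  have "h i 0 = 0" if "i < d" for i using eq[OF that, of None 0] by simp
  then have "vanishes_to_order (0 + card {..<d} * 1) ?f"
    using U h by (intro vanishes_to_order_mult vanishes_to_order_prod vanishes_to_order_0
        vanishes_to_order_1 holo2_isCont) auto
  moreover have "\<not> vanishes_to_order (Suc d) ?f"
    by (rule not_vanishes_to_Suc_order[where g = "g U k \<theta>'" and \<theta> = \<theta>'])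
       (use fg holo2_isCont[OF g] U k0 in \<open>auto simp: g_def\<close>)
  ultimately have "has_mult ?f d" unfolding has_mult_def by simp
  then show ?thesis
    using d g fg dirs by (intro germ_type.intros[where g = "g U k" and dirs = dirs])
      (auto simp: strict_transform_def)
qed

lemma holo2_analytic_at_0:
  "\<epsilon> analytic_on {0} \<Longrightarrow> holo2 p \<Longrightarrow> p 0 = 0 \<Longrightarrow> holo2 (\<lambda>x. \<epsilon> (p x))"
  using holo2_analytic by metis

text \<open>Blowing up replaces \<open>y = x ^ (m + 1) * \<epsilon> i x\<close> by
  \<open>y = x ^ m * \<epsilon> i x\<close> in the chart \<open>Some 0\<close>. While
  \<open>m > 0\<close>, the direction \<open>Some 0\<close> is the only one where the branches pass;
  for \<open>m = 0\<close> they have the distinct slopes \<open>\<epsilon> i 0\<close> and are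
  separated. The unit \<open>U\<close> is pulled back along the chart, hence arbitrary in the
  induction.\<close>

lemma germ_type_tangent_branches:
  fixes d :: nat
  assumes "d \<ge> 2" "holo2 U" "U 0 \<noteq> 0"
    and \<epsilon>: "\<And>i. i < d \<Longrightarrow> \<epsilon> i analytic_on {0}"
    and inj: "\<And>i j. i < d \<Longrightarrow> j < d \<Longrightarrow> \<epsilon> i 0 = \<epsilon> j 0 \<Longrightarrow> i = j"
  shows "germ_type (\<lambda>x. U x * (\<Prod>i<d. snd x - fst x ^ Suc m * \<epsilon> i (fst x))) (rep_type d (Suc m))"
  using assms(2,3)
proof (induction m arbitrary: U)
  fix U m
  assume U: "holo2 U" "U 0 \<noteq> 0"
  \<comment> \<open>The equation of the branch in the chart, divided by \<open>s\<close>; the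
    exponent of the branch is \<open>Suc m\<close>.\<close>
  define k where "k = (\<lambda>m \<theta> i x. case \<theta> of
      None \<Rightarrow> 1 - fst x ^ m * snd x ^ Suc m * \<epsilon> i (fst x * snd x)
    | Some b \<Rightarrow> (b + snd x) - fst x ^ m * \<epsilon> i (fst x))"
  note hU = holo2_blow_chart[OF U(1)]
  have hk: "holo2 (k m \<theta> i)" if "i < d" for m \<theta> i
    unfolding k_def by (cases \<theta>; simp only: option.case; intro holo2_mult holo2_diff holo2_add
        holo2_power holo2_analytic_at_0[OF \<epsilon>[OF that]] holo2_const holo2_fst holo2_snd) auto
  have hh: "holo2 (\<lambda>x. snd x - fst x ^ Suc m * \<epsilon> i (fst x))" if "i < d" for m i
    by (intro holo2_mult holo2_diff holo2_power holo2_analytic_at_0[OF \<epsilon>[OF that]] holo2_fst holo2_snd) simp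
  have eq: "snd (blow_chart \<theta> x) - fst (blow_chart \<theta> x) ^ Suc m * \<epsilon> i (fst (blow_chart \<theta> x)) = fst x * k m \<theta> i x"
    for m \<theta> i x
    by (cases \<theta>; cases x) (simp_all add: k_def right_diff_distrib power_mult_distrib mult_ac)
  \<comment> \<open>The direction \<open>None\<close> of the axis \<open>x = 0\<close> is tangent to
    no branch, as these are graphs over \<open>x\<close>.\<close>
  note typeI = germ_type_prodI[where k = "k m" and \<theta>' = None for m, OF assms(1) U hh hk eq]
  have k0: "k m None i 0 \<noteq> 0" for m i by (simp add: k_def power_0_left)
  show "germ_type (\<lambda>x. U x * (\<Prod>i<d. snd x - fst x ^ Suc 0 * \<epsilon> i (fst x))) (rep_type d (Suc 0))"
    unfolding rep_type_1
  proof (rule typeI[where dirs = "[]"])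
    show "\<not> germ_singular (\<lambda>x. U (blow_chart \<theta> x) * (\<Prod>i<d. k 0 \<theta> i x))" for \<theta>
    proof (rule not_germ_singular_prod)
      show "\<exists>c. c \<noteq> 0 \<and> ((\<lambda>u. k 0 \<theta> i (0, u)) has_field_derivative c) (at 0)" if "k 0 \<theta> i 0 = 0" for i
        using that by (cases \<theta>) (auto simp: k_def intro!: exI[of _ 1] derivative_eq_intros)
      show "i = j" if "i < d" "j < d" "k 0 \<theta> i 0 = 0" "k 0 \<theta> j 0 = 0" for i j
        using that inj by (cases \<theta>) (auto simp: k_def)
    qed (use hU U hk in auto)
  qed (use k0 in auto)
  assume IH: "\<And>U. holo2 U \<Longrightarrow> U 0 \<noteq> 0 \<Longrightarrow>
    germ_type (\<lambda>x. U x * (\<Prod>i<d. snd x - fst x ^ Suc m * \<epsilon> i (fst x))) (rep_type d (Suc m))"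
  show "germ_type (\<lambda>x. U x * (\<Prod>i<d. snd x - fst x ^ Suc (Suc m) * \<epsilon> i (fst x))) (rep_type d (Suc (Suc m)))"
    unfolding rep_type_Suc_Suc
  proof (rule typeI[where dirs = "[Some 0]"])
    show "list_all2 (\<lambda>\<theta>. germ_type (\<lambda>x. U (blow_chart \<theta> x) * (\<Prod>i<d. k (Suc m) \<theta> i x))) [Some 0] [rep_type d (Suc m)]"
      using IH[OF hU, of "Some 0"] U by (simp add: k_def)
    fix \<theta> assume "\<theta> \<notin> set [Some (0 :: complex)]"
    then show "\<not> germ_singular (\<lambda>x. U (blow_chart \<theta> x) * (\<Prod>i<d. k (Suc m) \<theta> i x))"
      using U by (cases \<theta>) (auto simp: germ_singular_def k_def)
  qed (use k0 in auto)
qed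

text \<open>Here the branches \<open>s = u\<^sup>m \<epsilon> i u\<close> have the tangent \<open>s = 0\<close>, so that the chart \<open>None\<close> of the
  first blow-up leads back to the previous lemma.\<close>

lemma germ_type_tangent_branches_swap:
  fixes d :: nat
  assumes "d \<ge> 2" and U: "holo2 U" "U 0 \<noteq> 0"
    and \<epsilon>: "\<And>i. i < d \<Longrightarrow> \<epsilon> i analytic_on {0}"
    and inj: "\<And>i j. i < d \<Longrightarrow> j < d \<Longrightarrow> \<epsilon> i 0 = \<epsilon> j 0 \<Longrightarrow> i = j"
  shows "germ_type (\<lambda>x. U x * (\<Prod>i<d. fst x - snd x ^ Suc m * \<epsilon> i (snd x))) (rep_type d (Suc m))"
proof -
  define k where "k = (\<lambda>\<theta> i x. case \<theta> of
      None \<Rightarrow> snd x - fst x ^ m * \<epsilon> i (fst x)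
    | Some b \<Rightarrow> 1 - fst x ^ m * (b + snd x) ^ Suc m * \<epsilon> i (fst x * (b + snd x)))"
  note hU = holo2_blow_chart[OF U(1)]
  have hk: "holo2 (k \<theta> i)" if "i < d" for \<theta> i
    unfolding k_def by (cases \<theta>; simp only: option.case; intro holo2_mult holo2_diff holo2_add
        holo2_power holo2_analytic_at_0[OF \<epsilon>[OF that]] holo2_const holo2_fst holo2_snd) auto
  have hh: "holo2 (\<lambda>x. fst x - snd x ^ Suc m * \<epsilon> i (snd x))" if "i < d" for i
    by (intro holo2_mult holo2_diff holo2_power holo2_analytic_at_0[OF \<epsilon>[OF that]] holo2_fst holo2_snd) simp
  have eq: "fst (blow_chart \<theta> x) - snd (blow_chart \<theta> x) ^ Suc m * \<epsilon> i (snd (blow_chart \<theta> x)) = fst x * k \<theta> i x"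
    for \<theta> i x
    by (cases \<theta>; cases x) (simp_all add: k_def right_diff_distrib power_mult_distrib mult_ac)
  \<comment> \<open>Now the branches are graphs over \<open>y\<close>, and the direction
    \<open>(1, 0)\<close>, that is \<open>Some 0\<close>, is tangent to none of them.\<close>
  note typeI = germ_type_prodI[where k = k and \<theta>' = "Some 0", OF assms(1) U hh hk eq]
  have k0: "k (Some 0) i 0 \<noteq> 0" for i by (simp add: k_def power_0_left)
  show ?thesis
  proof (cases m)
    case 0
    show ?thesis
      unfolding 0 rep_type_1
    proof (rule typeI[where dirs = "[]", unfolded 0])
      show "\<not> germ_singular (\<lambda>x. U (blow_chart \<theta> x) * (\<Prod>i<d. k \<theta> i x))" for \<theta>
      proof (rule not_germ_singular_prod)
        show "\<exists>c. c \<noteq> 0 \<and> ((\<lambda>u. k \<theta> i (0, u)) has_field_derivative c) (at 0)" if "k \<theta> i 0 = 0" for i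
        proof (cases \<theta>)
          case None
          then show ?thesis by (auto simp: k_def 0 intro!: exI[of _ 1] derivative_eq_intros)
        next
          case (Some b)
          \<comment> \<open>A zero means \<open>b * \<epsilon> i 0 = 1\<close>; hence the derivative
            \<open>- \<epsilon> i 0\<close> along the exceptional curve is not zero.\<close>
          then have "\<epsilon> i 0 \<noteq> 0" using that by (auto simp: k_def 0)
          with Some show ?thesis
            by (auto simp: k_def 0 intro!: exI[of _ "- \<epsilon> i 0"] derivative_eq_intros)
        qed
        show "i = j" if ij: "i < d" "j < d" "k \<theta> i 0 = 0" "k \<theta> j 0 = 0" for i j
        proof (cases \<theta>)
          case None
          then show ?thesis using ij inj by (simp add: k_def 0)
        next
          case (Some b)
          then have "b * \<epsilon> i 0 = 1" "b * \<epsilon> j 0 = 1" using ij by (auto simp: k_def 0)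
          then have "\<epsilon> i 0 = \<epsilon> j 0" by (metis mult_cancel_left mult_zero_left zero_neq_one)
          with ij inj show ?thesis by blast
        qed
      qed (use hU U hk in auto)
    qed (use k0 in auto)
  next
    case (Suc n)
    show ?thesis
      unfolding Suc rep_type_Suc_Suc
    proof (rule typeI[where dirs = "[None]", unfolded Suc])
      show "list_all2 (\<lambda>\<theta>. germ_type (\<lambda>x. U (blow_chart \<theta> x) * (\<Prod>i<d. k \<theta> i x))) [None] [rep_type d (Suc n)]"
      proof -
        have "germ_type (\<lambda>x. U (blow_chart None x) * (\<Prod>i<d. snd x - fst x ^ Suc n * \<epsilon> i (fst x))) (rep_type d (Suc n))"
          by (rule germ_type_tangent_branches[OF assms(1) hU _ \<epsilon> inj]) (use U in auto)
        then show ?thesis by (simp add: k_def Suc)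
      qed
      fix \<theta> assume "\<theta> \<notin> set [None :: complex option]"
      then show "\<not> germ_singular (\<lambda>x. U (blow_chart \<theta> x) * (\<Prod>i<d. k \<theta> i x))"
        using U by (cases \<theta>) (auto simp: germ_singular_def k_def Suc)
    qed (use k0 in auto)
  qed
qed

lemma higher_deriv_power_mult_at_0:
  assumes "g analytic_on {0}" "r \<le> n"
  shows "(deriv ^^ r) (\<lambda>w. w ^ n * g w) (0 :: complex) = (if r = n then fact n * g 0 else 0)"
proof -
  have "(deriv ^^ r) (\<lambda>w. w ^ n * g w) 0 =
      (\<Sum>i = 0..r. of_nat (r choose i) * (deriv ^^ i) (\<lambda>w. w ^ n) 0 * (deriv ^^ (r - i)) g 0)"
    using assms by (intro higher_deriv_mult_at) (auto intro!: analytic_intros)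
  also have "\<dots> = (\<Sum>i = 0..r. if i = n then fact n * g 0 else 0)"
  proof (intro sum.cong refl)
    fix i assume i: "i \<in> {0..r}"
    show "of_nat (r choose i) * (deriv ^^ i) (\<lambda>w. w ^ n) 0 * (deriv ^^ (r - i)) g 0 = (if i = n then fact n * g 0 else 0)"
      using higher_deriv_power[of i 0 n "0 :: complex"] assms i by (auto simp: pochhammer_fact power_0_left)
  qed
  also have "\<dots> = (if r = n then fact n * g 0 else 0)" using assms(2) by auto
  finally show ?thesis .
qed

text \<open>The derivatives of \<open>w ^ (m + 1) * \<epsilon> i w\<close> at 0 vanish up to order
  \<open>m\<close>, and the next one is \<open>fact (m + 1) * \<epsilon> i 0\<close>. Hence contact
  exponent \<open>m + 1\<close> means order \<open>m\<close>, the shift by one between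
  \<open>d\<close>-tacnodes of order \<open>n - 1\<close> and the type
  \<open>rep_type d n\<close>.\<close>

lemma germ_tacnodeI:
  fixes d :: nat
  assumes \<kappa>: "coord_change \<kappa>" and U: "holo2 U" "U 0 \<noteq> 0"
    and \<epsilon>: "\<And>i. i < d \<Longrightarrow> \<epsilon> i analytic_on {0}"
    and inj: "\<And>i j. i < d \<Longrightarrow> j < d \<Longrightarrow> \<epsilon> i 0 = \<epsilon> j 0 \<Longrightarrow> i = j"
    and eq: "\<forall>\<^sub>F x in nhds 0. f (\<kappa> x) = U x * (\<Prod>i<d. snd x - fst x ^ Suc m * \<epsilon> i (fst x))"
  shows "germ_tacnode d m f"
proof -
  have deriv: "(deriv ^^ r) (\<lambda>w. w ^ Suc m * \<epsilon> i w) 0 = (if r = Suc m then fact (Suc m) * \<epsilon> i 0 else 0)"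
    if "i < d" "r \<le> Suc m" for i r
    by (rule higher_deriv_power_mult_at_0[OF \<epsilon>[OF that(1)] that(2)])
  show ?thesis
    unfolding germ_tacnode_def
  proof (rule exI[of _ \<kappa>], rule exI[of _ U], rule exI[of _ "\<lambda>i w. w ^ Suc m * \<epsilon> i w"], intro conjI allI impI)
    fix i j r assume ij: "i < d" "j < d" "i \<noteq> j"
    show "(deriv ^^ Suc m) (\<lambda>w. w ^ Suc m * \<epsilon> i w) 0 \<noteq> (deriv ^^ Suc m) (\<lambda>w. w ^ Suc m * \<epsilon> j w) 0"
      using inj[OF ij(1,2)] ij(3) unfolding deriv[OF ij(1) order_refl] deriv[OF ij(2) order_refl]
      by (auto simp del: fact_Suc)
    assume "r \<le> m"
    then show "(deriv ^^ r) (\<lambda>w. w ^ Suc m * \<epsilon> i w) 0 = (deriv ^^ r) (\<lambda>w. w ^ Suc m * \<epsilon> j w) 0"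
      using deriv[of i r] deriv[of j r] ij by simp
  next
    fix i assume "i < d"
    then show "(\<lambda>w. w ^ Suc m * \<epsilon> i w) analytic_on {0}"
      by (intro analytic_intros \<epsilon>)
  qed (use \<kappa> U eq in simp_all)
qed

lemma coord_change_id: "coord_change (\<lambda>x. x)"
  unfolding coord_change_def comp_def
  by (intro conjI holo2_fst holo2_snd refl, rule exI[of _ "\<lambda>x. x"]) simp

lemma coord_change_swap: "coord_change prod.swap"
proof -
  have "((\<lambda>x. (snd x, fst x)) has_derivative (\<lambda>x. (snd x, fst x))) (at (0 :: complex \<times> complex))"
    by (intro has_derivative_Pair has_derivative_fst has_derivative_snd has_derivative_ident)
  then have "(prod.swap has_derivative prod.swap) (at (0 :: complex \<times> complex))"
    by (simp add: prod.swap_def[abs_def])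
  then show ?thesis
    unfolding coord_change_def comp_def
    by (intro conjI exI[of _ prod.swap]) (simp_all add: zero_prod_def)
qed

section \<open>Branches of the curve along a transversal line\<close>

text \<open>The inverse function theorem is applied to
  \<open>(u, z) \<mapsto> (u, P (u, z))\<close>, and \<open>\<rho> u\<close> is the second component
  of the inverse at \<open>(u, 0)\<close>. That theorem is about real derivatives; holomorphy of
  \<rho> follows because the derivative of the inverse sends \<open>(h, 0)\<close> to
  \<open>(h, - A / B * h)\<close>, which is complex linear in \<open>h\<close>.\<close>

lemma analytic_implicit_function:
  fixes P :: "complex \<times> complex \<Rightarrow> complex"
  assumes der: "\<And>x. (P has_derivative (\<lambda>(h, k). A x * h + B x * k)) (at x)"
    and cont: "continuous_on UNIV A" "continuous_on UNIV B"
    and r: "P (0, r) = 0" "B (0, r) \<noteq> 0"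
  shows "\<exists>\<rho>. \<rho> analytic_on {0} \<and> \<rho> 0 = r \<and> (\<forall>\<^sub>F u in nhds 0. P (u, \<rho> u) = 0)"
proof -
  define f where "f = (\<lambda>x. (fst x, P x))"
  define f' where "f' = (\<lambda>x. Blinfun (\<lambda>h. (fst h, A x * fst h + B x * snd h)))"
  have bl: "bounded_linear (\<lambda>h. (fst h, A x * fst h + B x * snd h))" for x
    by (intro bounded_linear_intros bounded_linear_Pair bounded_linear_add
        bounded_linear_compose[OF bounded_linear_mult_right] bounded_linear_fst bounded_linear_snd)
  have f'_apply: "blinfun_apply (f' x) = (\<lambda>h. (fst h, A x * fst h + B x * snd h))" for x
    unfolding f'_def by (rule bounded_linear_Blinfun_apply[OF bl])
  have derf: "(f has_derivative blinfun_apply (f' x)) (at x)" for x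
    unfolding f_def f'_apply
    using der[of x] by (intro has_derivative_Pair) (auto simp: case_prod_unfold intro!: derivative_eq_intros)
  have contf: "continuous_on UNIV f'"
    by (rule continuous_on_blinfun_componentwise) (unfold f'_apply, intro continuous_intros cont)
  define invf where "invf = Blinfun (\<lambda>h. (fst h, (snd h - A (0, r) * fst h) / B (0, r)))"
  have "bounded_linear (\<lambda>h. (fst h, (snd h - A (0, r) * fst h) / B (0, r)))"
    by (intro bounded_linear_Pair bounded_linear_compose[OF bounded_linear_divide] bounded_linear_sub
        bounded_linear_compose[OF bounded_linear_mult_right] bounded_linear_fst bounded_linear_snd)
  then have invf_apply: "blinfun_apply invf = (\<lambda>h. (fst h, (snd h - A (0, r) * fst h) / B (0, r)))"
    unfolding invf_def by (rule bounded_linear_Blinfun_apply)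
  have inv: "invf o\<^sub>L f' (0, r) = id_blinfun"
    by (rule blinfun_eqI) (simp add: invf_apply f'_apply r(2))
  obtain U V g g' where g: "open U" "(0, r) \<in> U" "open V" "f (0, r) \<in> V" "homeomorphism U V f g"
    "\<And>y. y \<in> V \<Longrightarrow> (g has_derivative g' y) (at y)"
    "\<And>y. y \<in> V \<Longrightarrow> g' y = inv (blinfun_apply (f' (g y)))"
    "\<And>y. y \<in> V \<Longrightarrow> bij (blinfun_apply (f' (g y)))"
    using inverse_function_theorem[OF open_UNIV derf contf UNIV_I inv] by (metis UNIV_I)
  define W where "W = (\<lambda>u. (u, 0 :: complex)) -` V"
  define \<rho> where "\<rho> = (\<lambda>u. snd (g (u, 0)))"
  have "open W" unfolding W_def by (intro open_vimage g continuous_intros)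
  have "0 \<in> W" using g(4) r(1) by (simp add: W_def f_def)
  have fg: "f (g y) = y" if "y \<in> V" for y using g(5) that by (simp add: homeomorphism_def)
  have "g (f (0, r)) = (0, r)" using g(2,5) by (simp add: homeomorphism_def)
  then have "\<rho> 0 = r" using r(1) by (simp add: \<rho>_def f_def)
  have zero: "P (u, \<rho> u) = 0" if "u \<in> W" for u
  proof -
    have "f (g (u, 0)) = (u, 0)" using that fg by (simp add: W_def)
    then show ?thesis by (cases "g (u, 0)") (simp add: f_def \<rho>_def)
  qed
  have "\<rho> field_differentiable (at u)" if "u \<in> W" for u
  proof -
    have V: "(u, 0) \<in> V" using that by (simp add: W_def)
    define x where "x = g (u, 0)"
    have bij: "bij (\<lambda>h. (fst h, A x * fst h + B x * snd h))"
      using g(8)[OF V] by (simp add: f'_apply x_def)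
    \<comment> \<open>Away from \<open>(0, r)\<close> this comes from the bijectivity of the
      derivative, supplied by the inverse function theorem on all of \<open>V\<close>.\<close>
    have "B x \<noteq> 0"
    proof
      assume "B x = 0"
      with injD[OF bij_is_inj[OF bij], of "(0, 1)" "(0, 0)"] show False by simp
    qed
    have g': "g' (u, 0) (h, 0) = (h, - A x / B x * h)" for h
    proof -
      have "g' (u, 0) (h, 0) = inv (\<lambda>h. (fst h, A x * fst h + B x * snd h)) (h, 0)"
        using g(7)[OF V] by (simp add: f'_apply x_def)
      also have "\<dots> = (h, - A x / B x * h)"
        using \<open>B x \<noteq> 0\<close> by (intro inv_f_eq[OF bij_is_inj[OF bij]]) simp
      finally show ?thesis .
    qed
    have "((\<lambda>u. (u, 0)) has_derivative (\<lambda>h. (h, 0 :: complex))) (at u)"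
      by (auto intro!: derivative_eq_intros)
    from has_derivative_compose[OF this g(6)[OF V]]
    have "((\<lambda>u. g (u, 0)) has_derivative (\<lambda>h. (h, - A x / B x * h))) (at u)"
      unfolding g' .
    from has_derivative_snd[OF this] have "(\<rho> has_derivative (\<lambda>h. - A x / B x * h)) (at u)"
      by (simp add: \<rho>_def)
    then show ?thesis
      unfolding field_differentiable_def has_field_derivative_def by blast
  qed
  then have "\<rho> holomorphic_on W"
    using \<open>open W\<close> by (simp add: holomorphic_on_def field_differentiable_at_within)
  then have "\<rho> analytic_on {0}" using \<open>open W\<close> \<open>0 \<in> W\<close> analytic_at by blast
  moreover have "\<forall>\<^sub>F u in nhds 0. P (u, \<rho> u) = 0"
    using zero \<open>open W\<close> \<open>0 \<in> W\<close> eventually_nhds by blast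
  ultimately show ?thesis using \<open>\<rho> 0 = r\<close> by blast
qed

section \<open>Coordinates with respect to a frame\<close>

definition emb :: "frame \<Rightarrow> p1_coord \<Rightarrow> complex \<Rightarrow> complex ^ 3" where
  "emb fr x z = direction fr x + z *s vertex fr"

definition frame_matrix :: "frame \<Rightarrow> complex ^ 3 ^ 3" where
  "frame_matrix fr = transpose (vector [direction fr (1, 0), direction fr (0, 1), vertex fr])"

definition xcoord :: "frame \<Rightarrow> complex ^ 3 \<Rightarrow> p1_coord" where
  "xcoord fr v = ((matrix_inv (frame_matrix fr) *v v) $ 1, (matrix_inv (frame_matrix fr) *v v) $ 2)"

definition zcoord :: "frame \<Rightarrow> complex ^ 3 \<Rightarrow> complex" where
  "zcoord fr v = (matrix_inv (frame_matrix fr) *v v) $ 3"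

lemma direction_eq: "direction fr x = fst x *s direction fr (1, 0) + snd x *s direction fr (0, 1)"
  by (cases fr) simp

lemma direction_plus: "direction fr (x + y) = direction fr x + direction fr y"
  by (cases fr) (simp add: vector_sadd_rdistrib)

lemma direction_scale: "direction fr (dil c x) = c *s direction fr x"
  by (cases fr) (simp add: vector_add_ldistrib vector_smult_assoc)

lemma direction_0 [simp]: "direction fr (0, 0) = 0"
  by (cases fr) simp

lemma emb_scale: "c *s emb fr x z = emb fr (dil c x) (c * z)"
  by (simp add: emb_def direction_scale vector_add_ldistrib vector_smult_assoc)

lemma emb_component:
  "emb fr x z $ i = fst x * direction fr (1, 0) $ i + snd x * direction fr (0, 1) $ i + z * vertex fr $ i"
  unfolding emb_def by (subst direction_eq) simp

lemma vector_3_transpose_mult: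
  "transpose (vector [u, v, w] :: complex ^ 3 ^ 3) *v c = c $ 1 *s u + c $ 2 *s v + c $ 3 *s w"
  by (simp add: vec_eq_iff matrix_vector_mult_def transpose_def sum_3 mult.commute)

lemma frame_matrix_mult: "frame_matrix fr *v c = emb fr (c $ 1, c $ 2) (c $ 3)"
  unfolding frame_matrix_def vector_3_transpose_mult emb_def
  by (subst (3) direction_eq) simp

text \<open>Turns the immersion condition of \<open>local_coords\<close> into linear independence,
  so that no determinant is ever expanded.\<close>

lemma det_vector_3_iff:
  "det (vector [u, v, w] :: complex ^ 3 ^ 3) \<noteq> 0 \<longleftrightarrow>
     (\<forall>a b c. a *s u + b *s v + c *s w = 0 \<longrightarrow> a = 0 \<and> b = 0 \<and> c = 0)"
proof -
  have "det (vector [u, v, w] :: complex ^ 3 ^ 3) \<noteq> 0 \<longleftrightarrow>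
      (\<forall>x. transpose (vector [u, v, w] :: complex ^ 3 ^ 3) *v x = 0 \<longrightarrow> x = 0)"
    by (metis det_transpose invertible_det_nz invertible_left_inverse matrix_left_invertible_ker)
  also have "\<dots> \<longleftrightarrow> (\<forall>a b c. a *s u + b *s v + c *s w = 0 \<longrightarrow> a = 0 \<and> b = 0 \<and> c = 0)"
    unfolding vector_3_transpose_mult
  proof (intro iffI allI impI)
    fix a b c assume *: "\<forall>x :: complex ^ 3. x $ 1 *s u + x $ 2 *s v + x $ 3 *s w = 0 \<longrightarrow> x = 0"
      and ab: "a *s u + b *s v + c *s w = 0"
    have "vector [a, b, c] = (0 :: complex ^ 3)"
      by (rule mp[OF spec[OF *]]) (unfold vector_3, rule ab)
    from arg_cong[OF this, of "\<lambda>x. x $ 1"] arg_cong[OF this, of "\<lambda>x. x $ 2"] arg_cong[OF this, of "\<lambda>x. x $ 3"]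
    show "a = 0 \<and> b = 0 \<and> c = 0" unfolding vector_3 zero_index by (intro conjI)
  next
    fix x :: "complex ^ 3"
    assume "\<forall>a b c. a *s u + b *s v + c *s w = 0 \<longrightarrow> a = 0 \<and> b = 0 \<and> c = 0"
      "x $ 1 *s u + x $ 2 *s v + x $ 3 *s w = 0"
    then have "x $ 1 = 0 \<and> x $ 2 = 0 \<and> x $ 3 = 0" by blast
    then show "x = 0" by (simp only: vec_eq_iff forall_3) simp
  qed
  finally show ?thesis .
qed

lemma is_frame_invertible:
  assumes "is_frame fr"
  shows "invertible (frame_matrix fr)"
proof -
  obtain a b c where fr: "fr = (a, b, c)" by (cases fr)
  show ?thesis using assms unfolding fr frame_matrix_def by (simp add: invertible_det_nz)
qed

lemma matrix_inv_mult:
  assumes "invertible A"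
  shows "A ** matrix_inv A = mat 1" "matrix_inv A ** A = mat 1"
  using assms unfolding invertible_def matrix_inv_def by (metis (mono_tags, lifting) someI_ex)+

lemma emb_coords [simp]:
  assumes "is_frame fr"
  shows "emb fr (xcoord fr v) (zcoord fr v) = v"
proof -
  have "frame_matrix fr *v (matrix_inv (frame_matrix fr) *v v) = v"
    using is_frame_invertible[OF assms]
    by (simp add: matrix_vector_mul_assoc matrix_inv_mult)
  then show ?thesis unfolding frame_matrix_mult xcoord_def zcoord_def .
qed

lemma coords_emb [simp]:
  assumes "is_frame fr"
  shows "xcoord fr (emb fr x z) = x" "zcoord fr (emb fr x z) = z"
proof -
  have *: "frame_matrix fr *v vector [fst x, snd x, z] = emb fr x z"
    unfolding frame_matrix_mult by simp
  have "matrix_inv (frame_matrix fr) *v emb fr x z = vector [fst x, snd x, z]"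
    using is_frame_invertible[OF assms] unfolding *[symmetric]
    by (simp add: matrix_vector_mul_assoc matrix_inv_mult)
  then show "xcoord fr (emb fr x z) = x" "zcoord fr (emb fr x z) = z"
    unfolding xcoord_def zcoord_def by simp_all
qed

lemma emb_inject:
  assumes "is_frame fr"
  shows "emb fr x z = emb fr x' z' \<longleftrightarrow> x = x' \<and> z = z'"
  using coords_emb[OF assms] by metis

lemma emb_0 [simp]: "emb fr (0, 0) 0 = 0"
  by (simp add: emb_def)

lemma emb_eq_0_iff:
  "is_frame fr \<Longrightarrow> emb fr x z = 0 \<longleftrightarrow> x = 0 \<and> z = 0"
  using emb_inject[of fr x z "(0, 0)" 0] by (simp add: zero_prod_def)

lemma ternary_form_matrix_mult: "ternary_form 1 (\<lambda>v. (A *v v) $ i)"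
  unfolding matrix_vector_mult_def vec_lambda_beta by (intro ternary_form_sum ternary_form_scaleC ternary_form_coord)

lemma ternary_form_coords:
  "ternary_form 1 (\<lambda>v. fst (xcoord fr v))" "ternary_form 1 (\<lambda>v. snd (xcoord fr v))"
  "ternary_form 1 (\<lambda>v. zcoord fr v)"
  unfolding xcoord_def zcoord_def fst_conv snd_conv by (rule ternary_form_matrix_mult)+

lemma ternary_form_emb:
  assumes "ternary_form n (\<lambda>v. fst (f v))" "ternary_form n (\<lambda>v. snd (f v))" "ternary_form n g"
  shows "ternary_form n (\<lambda>v. emb fr (f v) (g v) $ i)"
proof -
  have "ternary_form n (\<lambda>v. direction fr (1, 0) $ i * fst (f v) + direction fr (0, 1) $ i * snd (f v) + vertex fr $ i * g v)"
    by (intro ternary_form_add ternary_form_scaleC assms)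
  then show ?thesis unfolding emb_component by (simp add: mult.commute)
qed

text \<open>By homogeneity \<open>F\<close> vanishes on the whole ray through \<open>w\<close>; real
  multiples near 1 are enough to compute this derivative.\<close>

lemma ternary_form_radial_derivative:
  assumes "ternary_form d F" "F w = 0" "(F has_derivative D) (at w)"
  shows "D w = 0"
proof -
  have "((\<lambda>t :: real. w + t *\<^sub>R w) has_derivative (\<lambda>h. h *\<^sub>R w)) (at 0)"
    by (auto intro!: derivative_eq_intros)
  from has_derivative_compose[OF this, of F D] assms(3)
  have *: "((\<lambda>t :: real. F (w + t *\<^sub>R w)) has_derivative (\<lambda>h. D (h *\<^sub>R w))) (at 0)" by simp
  have "F (w + t *\<^sub>R w) = 0" for t :: real
  proof -
    have "w + t *\<^sub>R w = (1 + of_real t) *s w"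
      by (simp add: vec_eq_iff) (simp add: scaleR_conv_of_real algebra_simps)
    then show ?thesis using ternary_form_scale[OF assms(1), of "1 + of_real t" w] assms(2) by simp
  qed
  then have "((\<lambda>t :: real. F (w + t *\<^sub>R w)) has_derivative (\<lambda>h. 0)) (at 0)" by simp
  from has_derivative_unique[OF * this] have "D (1 *\<^sub>R w) = 0" by metis
  then show ?thesis by simp
qed

text \<open>On the line over \<open>a\<close>, \<open>F\<close> is a polynomial in \<open>z\<close>
  of exact degree \<open>d\<close>, and transversality makes its roots simple. Each root extends
  analytically in \<open>u\<close>; for small \<open>u\<close> the roots stay distinct, so they are
  all the roots and the factorisation holds for every \<open>z\<close>. This uniformity in
  \<open>z\<close> is essential, since later \<open>z\<close> is not confined to a neighbourhood of
  a point.\<close>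

lemma transversal_line_branches:
  assumes F: "ternary_form d F" and fr: "is_frame fr" and O: "F (vertex fr) \<noteq> 0"
    and a: "a \<noteq> 0" "meets_transversally F (vertex fr) (direction fr a)"
  shows "\<exists>\<rho>. (\<forall>i<d. \<rho> i analytic_on {0}) \<and> (\<forall>i<d. \<forall>j<d. \<rho> i 0 = \<rho> j 0 \<longrightarrow> i = j) \<and>
    (\<forall>\<^sub>F u in nhds 0. (\<forall>i<d. \<forall>j<d. \<rho> i u = \<rho> j u \<longrightarrow> i = j) \<and>
      (\<forall>z. F (emb fr (line_at a a' u) z) =
        F (vertex fr) * (\<Prod>i<d. z - \<rho> i u)))"
proof -
  define w where "w = (\<lambda>x :: complex \<times> complex. emb fr (line_at a a' (fst x)) (snd x))"
  define P where "P = (\<lambda>x. F (w x))"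
  obtain DF :: "complex ^ 3 \<Rightarrow> complex ^ 3" where DF: "continuous_on UNIV DF"
    "\<And>v. (F has_derivative (\<lambda>h. DF v $ 1 * h $ 1 + DF v $ 2 * h $ 2 + DF v $ 3 * h $ 3)) (at v)"
    using ternary_form_has_derivative[OF F] by blast
  define DD where "DD = (\<lambda>v (h :: complex ^ 3). DF v $ 1 * h $ 1 + DF v $ 2 * h $ 2 + DF v $ 3 * h $ 3)"
  have DF': "(F has_derivative DD v) (at v)" for v using DF(2) unfolding DD_def .
  have DD_add: "DD v (h + k) = DD v h + DD v k" and DD_scale: "DD v (c *s h) = c * DD v h" for v h k c
    unfolding DD_def by (simp_all add: algebra_simps)
  have w_eq: "w x = emb fr a 0 + (fst x *s direction fr a' + snd x *s vertex fr)" for x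
    unfolding w_def emb_def
    using direction_plus[of fr a "dil (fst x) a'"] direction_scale[of fr "fst x" a']
    by (cases a) (simp add: plus_prod_def add.assoc)
  have wder: "(w has_derivative (\<lambda>h. fst h *s direction fr a' + snd h *s vertex fr)) (at x)" for x
    unfolding w_eq[abs_def]
    by (rule has_derivative_vec) (auto intro!: derivative_eq_intros)
  define A where "A = (\<lambda>x. DD (w x) (direction fr a'))"
  define B where "B = (\<lambda>x. DD (w x) (vertex fr))"
  have wcont: "continuous_on UNIV w"
    unfolding continuous_on_eq_continuous_at[OF open_UNIV]
    by (blast intro: has_derivative_continuous[OF wder])
  have DFw: "continuous_on UNIV (\<lambda>x. DF (w x))"
    by (rule continuous_on_compose2[OF DF(1) wcont]) auto
  have cont: "continuous_on UNIV A" "continuous_on UNIV B"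
    unfolding A_def B_def DD_def by (intro continuous_intros DFw)+
  have Pder: "(P has_derivative (\<lambda>(h, k). A x * h + B x * k)) (at x)" for x
    unfolding P_def using has_derivative_compose[OF wder DF']
    by (rule has_derivative_eq_rhs) (auto simp: A_def B_def DD_add DD_scale fun_eq_iff)
  have poly: "\<exists>p. degree p \<le> d \<and> coeff p d = F (vertex fr) \<and> (\<forall>z. poly p z = P (u, z))" for u
    using ternary_form_line[OF F, where w = "vertex fr" and v = "w (u, 0)"]
    by (simp add: P_def w_eq add.assoc)
  \<comment> \<open>If the derivative in the direction of the vertex vanished at a point of the
    curve, then, the radial one vanishing too, the differential would vanish on the whole line,
    against transversality.\<close>
  have B0: "B (0, z) \<noteq> 0" if "P (0, z) = 0" for z
  proof
    assume B: "B (0, z) = 0"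
    define v where "v = w (0, z)"
    have v: "v = direction fr a + z *s vertex fr" by (simp add: v_def w_def emb_def)
    have Fv: "F v = 0" using that by (simp add: P_def v_def)
    have "v \<noteq> 0"
      using emb_eq_0_iff[OF fr, of a z] a(1) by (simp add: v emb_def)
    moreover have "v \<in> {b *s vertex fr + c *s direction fr a | b c. True}"
      unfolding v by (rule CollectI, rule exI[of _ z], rule exI[of _ 1]) (simp add: add.commute)
    ultimately obtain D h where D: "(F has_derivative D) (at v)"
      "h \<in> {b *s vertex fr + c *s direction fr a | b c. True}" "D h \<noteq> 0"
      using a(2) Fv unfolding meets_transversally_def by blast
    have "D = DD v" using D(1) DF' by (rule has_derivative_unique)
    obtain b c where h: "h = b *s vertex fr + c *s direction fr a" using D(2) by blast
    have "DD v v = 0" using ternary_form_radial_derivative[OF F Fv DF'] .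
    moreover have O0: "DD v (vertex fr) = 0" using B by (simp add: B_def v_def)
    ultimately have "DD v (direction fr a) = 0"
      using DD_add[of v "direction fr a" "z *s vertex fr"] DD_scale[of v z] by (simp add: v)
    then have "D h = 0" unfolding \<open>D = DD v\<close> h DD_add DD_scale O0 by simp
    with D(3) show False by simp
  qed
  obtain p where p: "degree p \<le> d" "coeff p d = F (vertex fr)" "\<And>z. poly p z = P (0, z)"
    using poly[of 0] by blast
  have pP: "poly p = (\<lambda>z. P (0, z))" using p(3) by blast
  have deg: "degree p = d" using p O by (intro antisym le_degree) auto
  \<comment> \<open>The derivative of \<open>p\<close> is \<open>B (0, _)\<close>, so a double root
    would contradict \<open>B0\<close>.\<close>
  have "rsquarefree p"
    unfolding rsquarefree_roots
  proof (intro allI notI, elim conjE)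
    fix z assume z: "poly p z = 0" "poly (pderiv p) z = 0"
    have "(poly p has_derivative (\<lambda>h. poly (pderiv p) z * h)) (at z)"
      using poly_DERIV[of p z] by (simp add: has_field_derivative_def)
    moreover have "((\<lambda>z. (0, z)) has_derivative (\<lambda>h. (0 :: complex, h))) (at z)"
      by (auto intro!: derivative_eq_intros)
    from has_derivative_compose[OF this Pder]
    have "(poly p has_derivative (\<lambda>h. B (0, z) * h)) (at z)"
      unfolding pP by simp
    ultimately have "(\<lambda>h. poly (pderiv p) z * h) = (\<lambda>h. B (0, z) * h)" by (rule has_derivative_unique)
    from fun_cong[OF this, of 1] have "B (0, z) = 0" using z by simp
    with B0 z p(3) show False by metis
  qed
  define Z where "Z = {z. poly p z = 0}"
  have "p \<noteq> 0" using p O by auto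
  then have fin: "finite Z" unfolding Z_def by (rule poly_roots_finite)
  have "degree p = degree (smult (lead_coeff p) (\<Prod>z\<in>Z. [:- z, 1:]))"
    unfolding Z_def complex_poly_decompose_rsquarefree[OF \<open>rsquarefree p\<close>] ..
  also have "\<dots> = card Z" using \<open>p \<noteq> 0\<close> by (simp add: degree_prod_sum_eq)
  finally have "card Z = d" using deg by simp
  then obtain r where r: "bij_betw r {..<d} Z"
    using ex_bij_betw_nat_finite[OF fin] by (auto simp: atLeast0LessThan)
  have rz: "P (0, r i) = 0" if "i < d" for i
    using bij_betwE[OF r] that p(3) by (auto simp: Z_def)
  have "\<exists>\<rho>. \<rho> analytic_on {0} \<and> \<rho> 0 = r i \<and> (\<forall>\<^sub>F u in nhds 0. P (u, \<rho> u) = 0)" if "i < d" for i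
    by (rule analytic_implicit_function[OF Pder cont rz B0]) (use that rz in auto)
  then obtain \<rho> where \<rho>: "\<And>i. i < d \<Longrightarrow> \<rho> i analytic_on {0}" "\<And>i. i < d \<Longrightarrow> \<rho> i 0 = r i"
      "\<And>i. i < d \<Longrightarrow> \<forall>\<^sub>F u in nhds 0. P (u, \<rho> i u) = 0"
    by metis
  have inj0: "i = j" if "i < d" "j < d" "\<rho> i 0 = \<rho> j 0" for i j
    using bij_betw_imp_inj_on[OF r] that \<rho>(2) by (auto dest: inj_onD)
  have "\<forall>\<^sub>F u in nhds 0. \<rho> i u \<noteq> \<rho> j u" if ij: "i < d" "j < d" "i \<noteq> j" for i j
  proof -
    have "isCont (\<lambda>u. \<rho> i u - \<rho> j u) 0"
      by (intro continuous_diff analytic_at_imp_isCont \<rho>(1) ij)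
    moreover have "\<rho> i 0 - \<rho> j 0 \<noteq> 0" using inj0 ij by auto
    then have "\<forall>\<^sub>F z in nhds (\<rho> i 0 - \<rho> j 0). z \<in> - {0}"
      by (intro eventually_nhds_in_open) auto
    ultimately have "\<forall>\<^sub>F u in nhds 0. \<rho> i u - \<rho> j u \<in> - {0}"
      using eventually_nhds_compose[where f = "\<lambda>u. \<rho> i u - \<rho> j u" and x = 0 and P = "\<lambda>z. z \<in> - {0}"] by blast
    then show ?thesis by eventually_elim auto
  qed
  then have dist: "\<forall>\<^sub>F u in nhds 0. \<forall>i\<in>{..<d}. \<forall>j\<in>{..<d}. i \<noteq> j \<longrightarrow> \<rho> i u \<noteq> \<rho> j u"
    by (intro eventually_ball_finite ballI) auto
  have roots: "\<forall>\<^sub>F u in nhds 0. \<forall>i\<in>{..<d}. P (u, \<rho> i u) = 0"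
    using \<rho>(3) by (intro eventually_ball_finite ballI) auto
  have "\<forall>\<^sub>F u in nhds 0. (\<forall>i<d. \<forall>j<d. \<rho> i u = \<rho> j u \<longrightarrow> i = j) \<and>
      (\<forall>z. F (emb fr (line_at a a' u) z) =
      F (vertex fr) * (\<Prod>i<d. z - \<rho> i u))"
    using dist roots
  proof eventually_elim
    case (elim u)
    obtain p where p: "degree p \<le> d" "coeff p d = F (vertex fr)" "\<And>z. poly p z = P (u, z)"
      using poly[of u] by blast
    have inj: "inj_on (\<lambda>i. \<rho> i u) {..<d}" using elim(1) unfolding inj_on_def by blast
    have dg: "degree (\<Prod>i<d. [:- \<rho> i u, 1:]) = d" by (simp add: degree_prod_sum_eq)
    have lc: "coeff (\<Prod>i<d. [:- \<rho> i u, 1:]) d = 1"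
      using lead_coeff_prod[of "\<lambda>i. [:- \<rho> i u, 1:]" "{..<d}"] by (simp add: dg)
    \<comment> \<open>Two polynomials of degree at most \<open>d\<close> with the same coefficient
      at \<open>d\<close> and \<open>d\<close> common values coincide.\<close>
    have "p = smult (F (vertex fr)) (\<Prod>i<d. [:- \<rho> i u, 1:])"
    proof (rule poly_eqI_degree_lead_coeff[where n = d and A = "(\<lambda>i. \<rho> i u) ` {..<d}"])
      show "d \<le> card ((\<lambda>i. \<rho> i u) ` {..<d})" using card_image[OF inj] by simp
      fix z assume "z \<in> (\<lambda>i. \<rho> i u) ` {..<d}"
      then obtain i where i: "i < d" "z = \<rho> i u" by auto
      then have "(\<Prod>j<d. \<rho> i u - \<rho> j u) = 0" by (intro prod_zero) auto
      then show "poly p z = poly (smult (F (vertex fr)) (\<Prod>i<d. [:- \<rho> i u, 1:])) z"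
        using i elim(2) p(3) by (simp add: poly_prod)
    qed (use p lc dg in auto)
    then have "P (u, z) = F (vertex fr) * (\<Prod>i<d. z - \<rho> i u)" for z
      using p(3)[of z] by (simp add: poly_prod)
    moreover have "\<forall>i<d. \<forall>j<d. \<rho> i u = \<rho> j u \<longrightarrow> i = j" using elim(1) by blast
    ultimately show ?case by (simp add: P_def w_def)
  qed
  then show ?thesis using \<rho>(1) inj0 by (intro exI[of _ \<rho>]) auto
qed

section \<open>Curves on Hirzebruch surfaces\<close>

definition h_curve :: "nat \<Rightarrow> (p1_coord \<Rightarrow> complex \<Rightarrow> complex \<Rightarrow> complex) \<Rightarrow> h_point set" where
  "h_curve n \<Phi> = {hpt n x y z | x y z. x \<noteq> 0 \<and> (y, z) \<noteq> 0 \<and> \<Phi> x y z = 0}"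

text \<open>Only the zero set has to be invariant under the two scalings. Continuity makes the cone
  over the curve closed. The last condition says that the curve meets every fibre; it puts
  contracted points on the image curve, while vanishing at \<open>(0, 0)\<close> lets the
  substituted equation hold there.\<close>

definition h_equation :: "nat \<Rightarrow> (p1_coord \<Rightarrow> complex \<Rightarrow> complex \<Rightarrow> complex) \<Rightarrow> bool" where
  "h_equation n \<Phi> \<longleftrightarrow>
     continuous_on UNIV (\<lambda>(x, y, z). \<Phi> x y z) \<and>
     (\<forall>l m x y z. l \<noteq> 0 \<longrightarrow> m \<noteq> 0 \<longrightarrow>
        (\<Phi> (dil l x) (m * y / l ^ n) (m * z) = 0 \<longleftrightarrow> \<Phi> x y z = 0)) \<and>
     (\<forall>x. \<Phi> x 0 0 = 0) \<and>
     (\<forall>x. \<exists>y z. (y, z) \<noteq> 0 \<and> \<Phi> x y z = 0)"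

lemma hpt_in_h_curve_iff:
  assumes "h_equation n \<Phi>" "x \<noteq> 0" "(y, z) \<noteq> 0"
  shows "hpt n x y z \<in> h_curve n \<Phi> \<longleftrightarrow> \<Phi> x y z = 0"
proof
  assume "hpt n x y z \<in> h_curve n \<Phi>"
  then obtain x' y' z' where *: "hpt n x' y' z' = hpt n x y z" "\<Phi> x' y' z' = 0"
    unfolding h_curve_def by force
  from *(1) obtain l m where "l \<noteq> 0" "m \<noteq> 0" "x = dil l x'" "y = m * y' / l ^ n" "z = m * z'"
    by (rule hpt_eqD)
  with *(2) assms(1) show "\<Phi> x y z = 0" unfolding h_equation_def by blast
qed (unfold h_curve_def, use assms in blast)

lemma h_equation_0: "h_equation n \<Phi> \<Longrightarrow> \<Phi> x 0 0 = 0"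
  unfolding h_equation_def by blast

lemma h_equation_scale_fibre:
  assumes "h_equation n \<Phi>" "m \<noteq> 0"
  shows "\<Phi> x (m * y) (m * z) = 0 \<longleftrightarrow> \<Phi> x y z = 0"
  using assms(1)[unfolded h_equation_def, THEN conjunct2, THEN conjunct1, rule_format, of 1 m x y z] assms(2)
  by simp

lemma proportional_pair:
  fixes y z :: complex
  assumes "y * z' = z * y'" "(y, z) \<noteq> 0" "(y', z') \<noteq> 0"
  shows "\<exists>m. m \<noteq> 0 \<and> y' = m * y \<and> z' = m * z"
proof (cases "y = 0")
  case True
  then have "z \<noteq> 0" "y' = 0" "z' \<noteq> 0" using assms by (auto simp: zero_prod_def)
  then show ?thesis using True by (intro exI[of _ "z' / z"]) simp
next
  case False
  then have "y' \<noteq> 0" using assms by (auto simp: zero_prod_def)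
  then show ?thesis using False assms(1) by (intro exI[of _ "y' / y"]) (simp add: field_simps)
qed

text \<open>\<open>(Y x y' z', Z x y' z')\<close> is the point of the fibre over \<open>x\<close> of which \<open>(y', z')\<close> is the image,
  wherever the two are not both zero.\<close>

lemma image_h_curve:
  assumes \<Phi>: "h_equation n \<Phi>"
    and B: "\<And>x y z P'. x \<noteq> 0 \<Longrightarrow> (y, z) \<noteq> 0 \<Longrightarrow> (hpt n x y z, P') \<in> B \<longleftrightarrow>
      (\<exists>y' z'. (y', z') \<noteq> 0 \<and> P' = hpt n' x y' z' \<and> y * Z x y' z' = z * Y x y' z')"
  shows "B `` h_curve n \<Phi> = h_curve n' (\<lambda>x y z. \<Phi> x (Y x y z) (Z x y z))"
proof (intro equalityI subsetI)
  fix P' assume "P' \<in> B `` h_curve n \<Phi>"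
  then obtain x y z where *: "x \<noteq> 0" "(y, z) \<noteq> 0" "\<Phi> x y z = 0" "(hpt n x y z, P') \<in> B"
    unfolding h_curve_def by auto
  then obtain y' z' where P': "(y', z') \<noteq> 0" "P' = hpt n' x y' z'" "y * Z x y' z' = z * Y x y' z'"
    unfolding B[OF *(1,2)] by auto
  have "\<Phi> x (Y x y' z') (Z x y' z') = 0"
  proof (cases "(Y x y' z', Z x y' z') = 0")
    case True
    then show ?thesis using h_equation_0[OF \<Phi>] by (simp add: zero_prod_def)
  next
    case False
    from proportional_pair[OF P'(3) *(2) False] *(3) show ?thesis
      using h_equation_scale_fibre[OF \<Phi>] by metis
  qed
  then show "P' \<in> h_curve n' (\<lambda>x y z. \<Phi> x (Y x y z) (Z x y z))"
    using * P' unfolding h_curve_def by blast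
next
  fix P' assume "P' \<in> h_curve n' (\<lambda>x y z. \<Phi> x (Y x y z) (Z x y z))"
  then obtain x y' z' where *: "x \<noteq> 0" "(y', z') \<noteq> 0" "\<Phi> x (Y x y' z') (Z x y' z') = 0" "P' = hpt n' x y' z'"
    unfolding h_curve_def by auto
  obtain y z where yz: "(y, z) \<noteq> 0" "\<Phi> x y z = 0" "y * Z x y' z' = z * Y x y' z'"
  proof (cases "(Y x y' z', Z x y' z') = 0")
    \<comment> \<open>\<open>P'\<close> is the point to which the old fibre is contracted. All
      points of that fibre correspond to it, and one of them lies on the curve.\<close>
    case True
    moreover obtain y z where "(y, z) \<noteq> 0" "\<Phi> x y z = 0" using \<Phi> unfolding h_equation_def by blast
    ultimately show ?thesis using that[of y z] by (auto simp: zero_prod_def)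
  next
    case False
    show ?thesis by (rule that[OF False *(3)]) simp
  qed
  then have "(hpt n x y z, P') \<in> B" unfolding *(4) B[OF *(1) yz(1)] using *(2) by blast
  moreover have "hpt n x y z \<in> h_curve n \<Phi>" using * yz unfolding h_curve_def by blast
  ultimately show "P' \<in> B `` h_curve n \<Phi>" by blast
qed

lemma elem1_image_h_curve:
  assumes "h_equation n \<Phi>"
  shows "elem1 n a `` h_curve n \<Phi> = h_curve (n + 1) (\<lambda>x y z. \<Phi> x (lin a x * y) z)"
proof (rule image_h_curve[OF assms])
  have "y' * (lin a x * z) = z' * y \<longleftrightarrow> y * z' = z * (lin a x * y')" for x y z y' z'
    by (auto simp: mult_ac)
  then show "(hpt n x y z, P') \<in> elem1 n a \<longleftrightarrow> (\<exists>y' z'. (y', z') \<noteq> 0 \<and> P' = hpt (n + 1) x y' z' \<and>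
      y * z' = z * (lin a x * y'))" if "x \<noteq> 0" "(y, z) \<noteq> 0" for x y z P'
    using elem1_iff[OF that] by simp
qed

lemma elem2_image_h_curve:
  assumes "h_equation n \<Phi>" "n \<ge> 1" "binary_form n q"
  shows "elem2 n a q `` h_curve n \<Phi> = h_curve (n - 1) (\<lambda>x y z. \<Phi> x y (lin a x * z + q x * y))"
proof (rule image_h_curve[OF assms(1)])
  have "y' * (z - q x * y) = z' * (lin a x * y) \<longleftrightarrow> y * (lin a x * z' + q x * y') = z * y'" for x y z y' z'
    by (auto simp: algebra_simps)
  then show "(hpt n x y z, P') \<in> elem2 n a q \<longleftrightarrow> (\<exists>y' z'. (y', z') \<noteq> 0 \<and> P' = hpt (n - 1) x y' z' \<and>
      y * (lin a x * z' + q x * y') = z * y')" if "x \<noteq> 0" "(y, z) \<noteq> 0" for x y z P'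
    using elem2_iff[OF that assms(2,3)] by simp
qed

text \<open>\<open>K\<close> is the closed cone over \<open>D\<close>. First components of limits of
  pairs over \<open>D\<close> stay in \<open>K\<close>, so the closure contributes no pair over
  points outside \<open>D\<close>; and as the centre is not in \<open>D\<close>, nothing of
  \<open>D\<close> is removed beforehand.\<close>

lemma image_proper_transform:
  assumes "c \<notin> D" "\<And>P P'. (P, P') \<in> B \<Longrightarrow> P \<noteq> {} \<and> P' \<noteq> {}" and K: "closed K" "\<And>P. P \<in> D \<Longrightarrow> P \<subseteq> K"
    and D: "\<And>P P' v. (P, P') \<in> B \<Longrightarrow> v \<in> P \<Longrightarrow> v \<in> K \<Longrightarrow> P \<in> D"
  shows "snd ` proper_transform B c D = B `` D"
proof (intro equalityI subsetI)
  fix P' assume "P' \<in> snd ` proper_transform B c D"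
  then obtain P v v' where *: "(P, P') \<in> B" "v \<in> P" "v' \<in> P'"
    "(v, v') \<in> closure (\<Union>(R, R') \<in> {(R, R') \<in> B. R \<in> D - {c}}. R \<times> R')"
    unfolding proper_transform_def by auto
  have "closure (\<Union>(R, R') \<in> {(R, R') \<in> B. R \<in> D - {c}}. R \<times> R') \<subseteq> K \<times> UNIV"
    using K by (intro closure_minimal closed_Times) auto
  with * have "v \<in> K" by auto
  with * D show "P' \<in> B `` D" by blast
next
  fix P' assume "P' \<in> B `` D"
  then obtain P where *: "(P, P') \<in> B" "P \<in> D" by blast
  then obtain v v' where v: "v \<in> P" "v' \<in> P'" using assms(2) by blast
  then have "(v, v') \<in> (\<Union>(R, R') \<in> {(R, R') \<in> B. R \<in> D - {c}}. R \<times> R')"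
    using * assms(1) by blast
  from subsetD[OF closure_subset this] have "(P, P') \<in> proper_transform B c D"
    using * v unfolding proper_transform_def by blast
  then show "P' \<in> snd ` proper_transform B c D" by force
qed

lemma hpt_self: "(x, y, z) \<in> hpt n x y z"
  using hpt_memI[of 1 1 x y n z] by simp

lemma ppt_self: "v \<in> ppt v"
  unfolding ppt_def using vector_smult_lid by (metis (mono_tags, lifting) mem_Collect_eq zero_neq_one)

lemma image_proper_transform_h_curve:
  assumes \<Phi>: "h_equation n \<Phi>" and "c \<notin> h_curve n \<Phi>"
    and B: "\<And>P P'. (P, P') \<in> B \<Longrightarrow> P \<in> hirzebruch n \<and> P' \<noteq> {}"
  shows "snd ` proper_transform B c (h_curve n \<Phi>) = B `` h_curve n \<Phi>"
proof (rule image_proper_transform[where K = "{v. (\<lambda>(x, y, z). \<Phi> x y z) v = 0}"])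
  show "closed {v. (\<lambda>(x, y, z). \<Phi> x y z) v = 0}"
    using \<Phi> unfolding h_equation_def by (intro closed_Collect_eq) auto
next
  fix P assume "P \<in> h_curve n \<Phi>"
  then obtain x y z where P: "P = hpt n x y z" "\<Phi> x y z = 0" unfolding h_curve_def by blast
  show "P \<subseteq> {v. (\<lambda>(x, y, z). \<Phi> x y z) v = 0}"
    using \<Phi> P(2) unfolding P(1) by (auto simp: h_equation_def elim!: hpt_memE)
next
  fix P P' v assume *: "(P, P') \<in> B" "v \<in> P" "v \<in> {v. (\<lambda>(x, y, z). \<Phi> x y z) v = 0}"
  then obtain x y z where P: "P = hpt n x y z" "x \<noteq> 0" "(y, z) \<noteq> 0" using B unfolding hirzebruch_def by blast
  obtain l m where lm: "l \<noteq> 0" "m \<noteq> 0" "v = ((dil l x), m * y / l ^ n, m * z)"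
    using *(2) unfolding P(1) by (rule hpt_memE)
  then have "\<Phi> x y z = 0" using *(3) \<Phi> unfolding h_equation_def by auto
  then show "P \<in> h_curve n \<Phi>" using P unfolding h_curve_def by blast
next
  fix P P' assume "(P, P') \<in> B"
  with B[OF this] show "P \<noteq> {} \<and> P' \<noteq> {}" unfolding hirzebruch_def using hpt_self by blast
qed fact

lemma elem1_in: "(P, P') \<in> elem1 n a \<Longrightarrow> P \<in> hirzebruch n \<and> P' \<noteq> {}"
  unfolding elem1_def hirzebruch_def using hpt_self by blast

lemma elem2_in: "(P, P') \<in> elem2 n a q \<Longrightarrow> P \<in> hirzebruch n \<and> P' \<noteq> {}"
  unfolding elem2_def hirzebruch_def using hpt_self by blast

lemma binary_form_continuous: "binary_form n q \<Longrightarrow> continuous_on S q"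
  using binary_form_closure[where P = "\<lambda>_. continuous_on S" and f = fst and g = snd and e = 0]
  by (simp add: continuous_on_fst continuous_on_snd continuous_on_id continuous_on_add continuous_on_mult)

text \<open>The equations of the successive proper transforms of the curve \<open>F = 0\<close>.  With \<open>t\<close> the equation of
  the fibre, a step of the first type multiplies \<open>A\<close> and \<open>B\<close> by \<open>t\<close>, and one of the second type
  replaces \<open>B\<close> by \<open>B + C q\<close> and \<open>C\<close> by \<open>C t\<close>.\<close>

definition transform_eq :: "(complex ^ 3 \<Rightarrow> complex) \<Rightarrow> frame \<Rightarrow> (p1_coord \<Rightarrow> complex) \<Rightarrow>
    (p1_coord \<Rightarrow> complex) \<Rightarrow> (p1_coord \<Rightarrow> complex) \<Rightarrow> p1_coord \<Rightarrow> complex \<Rightarrow> complex \<Rightarrow> complex" where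
  "transform_eq F fr A B C x y z =
     F (emb fr (dil (A x * y) x) (B x * y + C x * z))"

text \<open>The degrees of \<open>A\<close>, \<open>B\<close>, \<open>C\<close> are such that both
  arguments of \<open>F\<close> acquire the same factor \<open>l ^ j * m\<close>. Here
  \<open>n\<close> is the index of the surface and \<open>j\<close> counts the steps of the second
  type already made.\<close>

lemma transform_eq_scale:
  assumes "ternary_form d F" "binary_form (j + n - 1) A" "binary_form (j + n) B" "binary_form j C"
    and n: "n \<ge> 1" and l: "l \<noteq> 0"
  shows "transform_eq F fr A B C (dil l x) (m * y / l ^ n) (m * z) =
     (l ^ j * m) ^ d * transform_eq F fr A B C x y z"
proof -
  have "l ^ (j + n) = l * l ^ (j + n - 1)" using n by (cases "j + n") auto
  then have "l * l ^ (j + n - 1) = l ^ j * l ^ n" by (simp add: power_add)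
  then have 1: "l ^ (j + n - 1) * A x * (m * y / l ^ n) * (l * t) = l ^ j * m * (A x * y * t)" for t
    using l by (simp add: field_simps)
  have 2: "l ^ (j + n) * B x * (m * y / l ^ n) + l ^ j * C x * (m * z) = l ^ j * m * (B x * y + C x * z)"
    using l by (simp add: power_add field_simps)
  have 3: "F (emb fr (c * s, c * t) (c * z)) = c ^ d * F (emb fr (s, t) z)" for c s t z
    using ternary_form_scale[OF assms(1), of c "emb fr (s, t) z"] by (simp add: emb_scale)
  show ?thesis
    unfolding transform_eq_def fst_conv snd_conv binary_form_scale[OF assms(2)]
      binary_form_scale[OF assms(3)] binary_form_scale[OF assms(4)] 1 2 3 ..
qed

lemma continuous_on_emb [continuous_intros]:
  assumes "continuous_on S (\<lambda>t. fst (f t))" "continuous_on S (\<lambda>t. snd (f t))" "continuous_on S g"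
  shows "continuous_on S (\<lambda>t. emb fr (f t) (g t))"
proof -
  have "emb fr (f t) (g t) = (\<chi> i. fst (f t) * direction fr (1, 0) $ i + snd (f t) * direction fr (0, 1) $ i + g t * vertex fr $ i)" for t
    by (simp add: vec_eq_iff emb_component)
  then show ?thesis
    by (simp, intro continuous_on_vec_lambda continuous_on_add continuous_on_mult continuous_on_const assms)
qed

lemma h_equation_transform_eq:
  assumes F: "ternary_form d F" "d \<ge> 1" "F (vertex fr) \<noteq> 0"
    and ABC: "binary_form (j + n - 1) A" "binary_form (j + n) B" "binary_form j C" and n: "n \<ge> 1"
  shows "h_equation n (transform_eq F fr A B C)"
  unfolding h_equation_def
proof (intro conjI allI impI)
  note cont = continuous_on_compose2[OF binary_form_continuous[where S = UNIV] continuous_on_fst[OF continuous_on_id]]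
  have "continuous_on UNIV (\<lambda>v. F (emb fr (dil (A (fst v) * fst (snd v)) (fst v))
      (B (fst v) * fst (snd v) + C (fst v) * snd (snd v))))"
    by (intro continuous_on_compose2[OF ternary_form_continuous[OF F(1), of UNIV]] continuous_intros)
       (auto intro!: continuous_intros cont[OF ABC(1)] cont[OF ABC(2)] cont[OF ABC(3)])
  then show "continuous_on UNIV (\<lambda>(x, y, z). transform_eq F fr A B C x y z)"
    by (simp add: transform_eq_def case_prod_unfold)
next
  fix l m :: complex and x y z assume "l \<noteq> 0" "m \<noteq> 0"
  then show "transform_eq F fr A B C (dil l x) (m * y / l ^ n) (m * z) = 0 \<longleftrightarrow>
      transform_eq F fr A B C x y z = 0"
    using transform_eq_scale[OF F(1) ABC n] by simp
next
  fix x show "transform_eq F fr A B C x 0 0 = 0"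
    using ternary_form_zero_at_0[OF F(1,2)] by (simp add: transform_eq_def)
next
  fix x
  show "\<exists>y z. (y, z) \<noteq> 0 \<and> transform_eq F fr A B C x y z = 0"
  proof (cases "C x = 0")
    case True
    then have "transform_eq F fr A B C x 0 1 = 0"
      using ternary_form_zero_at_0[OF F(1,2)] by (simp add: transform_eq_def)
    moreover have "(0 :: complex, 1 :: complex) \<noteq> 0" by (simp add: zero_prod_def)
    ultimately show ?thesis by blast
  next
    \<comment> \<open>The equation is a polynomial of degree \<open>d\<close> in \<open>z\<close>
      with nonzero leading coefficient, so it has a root; \<open>t\<close> runs through the values
      of \<open>B * y + C * z\<close> at \<open>y = 1\<close>.\<close>
    case False
    obtain p where p: "degree p \<le> d" "coeff p d = F (vertex fr)"
      "\<And>t. poly p t = F (emb fr (dil (A x) x) 0 + t *s vertex fr)"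
      using ternary_form_line[OF F(1), where w = "vertex fr"] by metis
    have "degree p = d" using p(1,2) F(3) by (intro antisym le_degree) auto
    then have "\<not> constant (poly p)" using F(2) by (simp add: constant_degree)
    then obtain t where "poly p t = 0" using fundamental_theorem_of_algebra by blast
    then have "F (emb fr (dil (A x) x) t) = 0" using p(3) by (simp add: emb_def)
    then have "transform_eq F fr A B C x 1 ((t - B x) / C x) = 0"
      using False by (simp add: transform_eq_def)
    moreover have "(1 :: complex, (t - B x) / C x) \<noteq> 0" by (simp add: zero_prod_def)
    ultimately show ?thesis by blast
  qed
qed

section \<open>Equations of the successive curves\<close>

abbreviation lin_prod :: "p1_coord list \<Rightarrow> p1_coord \<Rightarrow> complex" where
  "lin_prod as x \<equiv> \<Prod>a\<leftarrow>as. lin a x"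

lemma binary_form_lin_prod: "binary_form (length as) (lin_prod as)"
proof (induction as)
  case (Cons a as)
  from binary_form_mult[OF binary_form_lin[of a] Cons] show ?case by simp
qed simp

text \<open>Since \<open>C\<close> stays 1 and \<open>B\<close> stays 0, the equation at the centre
  \<open>y = 0\<close>, \<open>z = 1\<close> has the value \<open>F (vertex fr)\<close> at every
  step, so no centre is on the curve.\<close>

lemma first_curve_transform_eq:
  assumes F: "ternary_form d F" "d \<ge> 1" "F (vertex fr) \<noteq> 0"
    and A: "binary_form (n - 1) A" "n \<ge> 1" and as: "\<forall>a\<in>set as. a \<noteq> 0"
  shows "first_curve n as (h_curve n (transform_eq F fr A (\<lambda>_. 0) (\<lambda>_. 1))) =
     h_curve (n + length as) (transform_eq F fr (\<lambda>x. A x * lin_prod as x) (\<lambda>_. 0) (\<lambda>_. 1))"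
  using A as
proof (induction as arbitrary: n A)
  case (Cons a as)
  let ?T = "transform_eq F fr A (\<lambda>_. 0) (\<lambda>_. 1)"
  have \<Phi>: "h_equation n ?T"
    using Cons.prems by (intro h_equation_transform_eq[OF F, where j = 0]) (auto intro: binary_form_zero)
  have nz: "(0 :: complex, 1 :: complex) \<noteq> 0" by (simp add: zero_prod_def)
  have "centre1 n a \<notin> h_curve n ?T"
    using Cons.prems F(3) hpt_in_h_curve_iff[OF \<Phi> _ nz, of a] by (simp add: centre1_def transform_eq_def emb_def)
  then have "snd ` proper_transform (elem1 n a) (centre1 n a) (h_curve n ?T) = elem1 n a `` h_curve n ?T"
    by (rule image_proper_transform_h_curve[OF \<Phi> _ elem1_in])
  also have "\<dots> = h_curve (n + 1) (transform_eq F fr (\<lambda>x. A x * lin a x) (\<lambda>_. 0) (\<lambda>_. 1))"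
    unfolding elem1_image_h_curve[OF \<Phi>]
    by (rule arg_cong[where f = "h_curve (n + 1)"]) (simp add: fun_eq_iff transform_eq_def mult_ac)
  finally have "first_curve n (a # as) (h_curve n ?T) =
      first_curve (n + 1) as (h_curve (n + 1) (transform_eq F fr (\<lambda>x. A x * lin a x) (\<lambda>_. 0) (\<lambda>_. 1)))"
    by simp
  also have "\<dots> = h_curve (n + 1 + length as) (transform_eq F fr (\<lambda>x. A x * lin a x * lin_prod as x) (\<lambda>_. 0) (\<lambda>_. 1))"
    using Cons.prems binary_form_mult[OF Cons.prems(1) binary_form_lin[of a]] by (intro Cons.IH) auto
  finally show ?case by (simp add: mult_ac)
qed simp

text \<open>Accumulates \<open>B\<close> only: steps of the second type leave \<open>A\<close>
  alone, and \<open>C\<close> just collects the factors \<open>lin a\<close>. Started at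
  \<open>B = 0\<close>, \<open>C = 1\<close> it yields the form \<open>S\<close>.\<close>

fun second_shift :: "(p1_coord \<times> (p1_coord \<Rightarrow> complex)) list \<Rightarrow> (p1_coord \<Rightarrow> complex) \<Rightarrow>
    (p1_coord \<Rightarrow> complex) \<Rightarrow> p1_coord \<Rightarrow> complex" where
  "second_shift [] B C = B"
| "second_shift ((a, q) # bs) B C = second_shift bs (\<lambda>x. B x + C x * q x) (\<lambda>x. C x * lin a x)"

lemma lin_eq_0_iff:
  assumes "a \<noteq> 0" "x \<noteq> 0"
  shows "lin a x = 0 \<longleftrightarrow> (\<exists>c. c \<noteq> 0 \<and> x = dil c a)"
proof
  assume "lin a x = 0"
  then have "fst a * snd x = snd a * fst x" by (simp add: lin_def)
  from proportional_pair[OF this] assms show "\<exists>c. c \<noteq> 0 \<and> x = dil c a"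
    by (metis prod.collapse)
qed (auto simp: lin_def)

text \<open>Besides the equation, the induction carries an invariant: where \<open>C x = 0\<close>,
  the equation does not involve \<open>z\<close>, so being nonzero at \<open>(1, 0)\<close> means
  that the curve meets this fibre only on the exceptional section. A step on a new fibre establishes
  it, because its centre is off the curve.\<close>

lemma second_curve_transform_eq:
  assumes F: "ternary_form d F" "d \<ge> 1" "F (vertex fr) \<noteq> 0"
    and "binary_form (j + n - 1) A" "binary_form (j + n) B" "binary_form j C" "length bs < n"
    and "\<forall>b\<in>set bs. fst b \<noteq> 0"
    and "second_centres_ok n bs (h_curve n (transform_eq F fr A B C))"
    and "\<forall>x. x \<noteq> 0 \<longrightarrow> C x = 0 \<longrightarrow> transform_eq F fr A B C x 1 0 \<noteq> 0"
    and "\<And>S R. S = second_shift bs B C \<Longrightarrow> R = (\<lambda>x. C x * lin_prod (map fst bs) x) \<Longrightarrow>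
      binary_form (j + n) S \<Longrightarrow> \<forall>x. x \<noteq> 0 \<longrightarrow> R x = 0 \<longrightarrow> transform_eq F fr A S R x 1 0 \<noteq> 0 \<Longrightarrow>
      second_curve n bs (h_curve n (transform_eq F fr A B C)) =
        h_curve (n - length bs) (transform_eq F fr A S R) \<Longrightarrow> thesis"
  shows thesis
  using assms(4-)
proof (induction bs arbitrary: n j B C thesis)
  case Nil
  show ?case by (rule Nil.prems(8)) (use Nil.prems in auto)
next
  case (Cons b bs)
  obtain a q where b: "b = (a, q)" by (cases b)
  let ?T = "transform_eq F fr A B C"
  let ?B = "\<lambda>x. B x + C x * q x" and ?C = "\<lambda>x. C x * lin a x"
  have n: "n \<ge> 1" using Cons.prems(4) by simp
  have a: "a \<noteq> 0" using Cons.prems(5) b by simp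
  have \<Phi>: "h_equation n ?T" by (rule h_equation_transform_eq[OF F Cons.prems(1-3) n])
  have q: "binary_form n q" "centre2 n a q \<notin> h_curve n ?T"
    "second_centres_ok (n - 1) bs (snd ` proper_transform (elem2 n a q) (centre2 n a q) (h_curve n ?T))"
    using Cons.prems(6) unfolding b by auto
  have nz: "(1 :: complex, q a) \<noteq> 0" by (simp add: zero_prod_def)
  have Ta: "?T a 1 (q a) \<noteq> 0"
    using q(2) hpt_in_h_curve_iff[OF \<Phi> a nz] by (simp add: centre2_def)
  have "snd ` proper_transform (elem2 n a q) (centre2 n a q) (h_curve n ?T) = elem2 n a q `` h_curve n ?T"
    by (rule image_proper_transform_h_curve[OF \<Phi> q(2) elem2_in])
  also have "\<dots> = h_curve (n - 1) (transform_eq F fr A ?B ?C)"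
    unfolding elem2_image_h_curve[OF \<Phi> n q(1)]
    by (rule arg_cong[where f = "h_curve (n - 1)"]) (simp add: fun_eq_iff transform_eq_def algebra_simps)
  finally have eq: "snd ` proper_transform (elem2 n a q) (centre2 n a q) (h_curve n ?T) =
      h_curve (n - 1) (transform_eq F fr A ?B ?C)" .
  have jn: "(j + 1) + (n - 1) = j + n" using n by simp
  show ?case
  proof (rule Cons.IH)
    show "binary_form (j + 1 + (n - 1) - 1) A" unfolding jn by (rule Cons.prems)
    show "binary_form (j + 1 + (n - 1)) ?B"
      unfolding jn by (intro binary_form_add binary_form_mult Cons.prems q)
    show "binary_form (j + 1) ?C" by (intro binary_form_mult binary_form_lin Cons.prems)
    show "length bs < n - 1" "\<forall>b\<in>set bs. fst b \<noteq> 0" using Cons.prems by auto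
    show "second_centres_ok (n - 1) bs (h_curve (n - 1) (transform_eq F fr A ?B ?C))"
      using q(3) unfolding eq .
    show "\<forall>x. x \<noteq> 0 \<longrightarrow> C x * lin a x = 0 \<longrightarrow> transform_eq F fr A ?B ?C x 1 0 \<noteq> 0"
    proof (intro allI impI)
      fix x :: p1_coord assume x: "x \<noteq> 0" "C x * lin a x = 0"
      have T: "transform_eq F fr A ?B ?C x 1 0 = ?T x 1 (q x)" by (simp add: transform_eq_def)
      show "transform_eq F fr A ?B ?C x 1 0 \<noteq> 0"
      proof (cases "C x = 0")
        \<comment> \<open>A line treated before: the shift of \<open>B\<close> by
          \<open>C * q\<close> is not visible on it.\<close>
        case True
        then have "?T x 1 (q x) = ?T x 1 0" by (simp add: transform_eq_def)
        then show ?thesis using T Cons.prems(7) x True by metis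
      next
        \<comment> \<open>A line treated for the first time: \<open>x\<close> is a multiple of
          \<open>a\<close>, and the value is, up to a nonzero factor, the one at the centre.\<close>
        case False
        then obtain c where c: "c \<noteq> 0" "x = dil c a"
          using x lin_eq_0_iff[OF a x(1)] by auto
        have "?T (dil c a) (c ^ n * 1 / c ^ n) (c ^ n * q a) \<noteq> 0"
          using transform_eq_scale[OF F(1) Cons.prems(1-3) n c(1), where fr = fr and x = a and y = 1
            and m = "c ^ n" and z = "q a"] Ta c(1) by simp
        then have "?T x 1 (q x) \<noteq> 0"
          unfolding c(2) binary_form_scale[OF q(1)] using c(1) by simp
        then show ?thesis unfolding T .
      qed
    qed
  next
    fix S R assume SR: "S = second_shift bs ?B ?C" "R = (\<lambda>x. C x * lin a x * lin_prod (map fst bs) x)"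
      "binary_form (j + 1 + (n - 1)) S"
      "\<forall>x. x \<noteq> 0 \<longrightarrow> R x = 0 \<longrightarrow> transform_eq F fr A S R x 1 0 \<noteq> 0"
      "second_curve (n - 1) bs (h_curve (n - 1) (transform_eq F fr A ?B ?C)) =
        h_curve (n - 1 - length bs) (transform_eq F fr A S R)"
    show thesis
      by (rule Cons.prems(8)[of S R]) (use SR jn eq in \<open>auto simp: b mult_ac\<close>)
  qed
qed

section \<open>The transformation on points outside the lines\<close>

lemma first_rel_generic:
  assumes "x \<noteq> 0" "y \<noteq> 0"
  shows "(hpt n x y z, hpt (n + length as) x y (lin_prod as x * z)) \<in> first_rel n as"
proof (induction as arbitrary: n z)
  case (Cons a as)
  have "(hpt n x y z, hpt (n + 1) x y (lin a x * z)) \<in> elem1 n a"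
    using elem1_off_centre[of x y z a n] assms by (auto simp: zero_prod_def)
  with Cons[of "n + 1" "lin a x * z"] show ?case by (auto simp: mult_ac)
qed simp

text \<open>Equations are pulled back but points are pushed forward, so the substitution by
  \<open>B\<close> and \<open>C\<close> appears inverted: \<open>(y, z)\<close> has moved to
  \<open>(C * y, z - B * y)\<close> after the steps already made.\<close>

lemma second_rel_generic:
  assumes "x \<noteq> 0" "y \<noteq> 0" "length bs < n" "C x * lin_prod (map fst bs) x \<noteq> 0"
    and "second_centres_ok n bs D"
  shows "(hpt n x (C x * y) (z - B x * y),
    hpt (n - length bs) x (C x * lin_prod (map fst bs) x * y) (z - second_shift bs B C x * y)) \<in> second_rel n bs"
  using assms(3-)
proof (induction bs arbitrary: n B C D)
  case (Cons b bs)
  obtain a q where b: "b = (a, q)" by (cases b)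
  have nz: "C x \<noteq> 0" "lin a x \<noteq> 0" using Cons.prems b by auto
  have q: "binary_form n q" using Cons.prems b by simp
  have "(hpt n x (C x * y) (z - B x * y), hpt (n - 1) x (lin a x * (C x * y)) (z - B x * y - q x * (C x * y))) \<in> elem2 n a q"
    using assms nz Cons.prems q by (subst elem2_off_centre) (auto simp: zero_prod_def)
  also have "hpt (n - 1) x (lin a x * (C x * y)) (z - B x * y - q x * (C x * y)) =
      hpt (n - 1) x (C x * lin a x * y) (z - (B x + C x * q x) * y)"
    by (simp add: algebra_simps)
  finally have "(hpt n x (C x * y) (z - B x * y), hpt (n - 1) x (C x * lin a x * y) (z - (B x + C x * q x) * y)) \<in> elem2 n a q" .
  with Cons.IH[of "n - 1" "\<lambda>x. C x * lin a x" _ "\<lambda>x. B x + C x * q x"] Cons.prems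
  show ?case by (auto simp: b mult_ac)
qed simp

lemma ppt_scale: "c \<noteq> 0 \<Longrightarrow> ppt (c *s v) = ppt v"
proof -
  have sub: "ppt (c *s v) \<subseteq> ppt v" if "c \<noteq> 0" for c v
    unfolding ppt_def using that by (auto simp: vector_smult_assoc intro: exI[of _ "_ * c"])
  assume c: "c \<noteq> 0"
  have "v = (1 / c) *s (c *s v)" using c by (simp add: vector_smult_assoc)
  then have "ppt v \<subseteq> ppt (c *s v)" using sub[of "1 / c" "c *s v"] c by simp
  with sub[OF c] show ?thesis by blast
qed

lemma ppt_eqD: "ppt v = ppt w \<Longrightarrow> \<exists>c. c \<noteq> 0 \<and> w = c *s v"
  using ppt_self[of w] unfolding ppt_def by blast

lemma ppt_memD: "w \<in> ppt v \<Longrightarrow> \<exists>c. c \<noteq> 0 \<and> w = c *s v"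
  unfolding ppt_def by blast

lemma xcoord_scale: "xcoord fr (c *s v) = dil c (xcoord fr v)"
  and zcoord_scale: "zcoord fr (c *s v) = c * zcoord fr v"
  using ternary_form_scale[OF ternary_form_coords(1), of fr c v]
    ternary_form_scale[OF ternary_form_coords(2), of fr c v]
    ternary_form_scale[OF ternary_form_coords(3), of fr c v] by (simp_all add: prod_eq_iff)

section \<open>Singular points and polynomial maps\<close>

text \<open>Stated for vectors, including 0, on purpose: \<tau> takes the value 0 at the vertex and
  at the new points, and \<open>sing_at F 0\<close> then makes the composite singular.\<close>

definition sing_at :: "(complex ^ 3 \<Rightarrow> complex) \<Rightarrow> complex ^ 3 \<Rightarrow> bool" where
  "sing_at F v \<longleftrightarrow> F v = 0 \<and> (F has_derivative (\<lambda>_. 0)) (at v)"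

lemma sing_points_eq: "sing_points F = {ppt v | v. v \<noteq> 0 \<and> sing_at F v}"
  unfolding sing_points_def sing_at_def by blast

definition form_map :: "nat \<Rightarrow> (complex ^ 3 \<Rightarrow> complex ^ 3) \<Rightarrow> bool" where
  "form_map e T \<longleftrightarrow> (\<forall>i. ternary_form e (\<lambda>v. T v $ i))"

lemma form_map_scale: "form_map e T \<Longrightarrow> T (c *s v) = c ^ e *s T v"
  unfolding form_map_def vec_eq_iff using ternary_form_scale[of e "\<lambda>v. T v $ i" for i] by simp

text \<open>\<open>has_derivative\<close> yields real linearity only; complex homogeneity of
  \<open>D\<close>, required for determinants over the complex numbers, is read off from the partial
  derivatives.\<close>

lemma form_map_has_derivative:
  assumes "form_map e T"
  shows "\<exists>D. (T has_derivative D) (at v) \<and> (\<forall>h k. D (h + k) = D h + D k) \<and> (\<forall>c h. D (c *s h) = c *s D h)"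
proof -
  have "\<exists>p :: complex ^ 3. ((\<lambda>v. T v $ i) has_derivative (\<lambda>h. p $ 1 * h $ 1 + p $ 2 * h $ 2 + p $ 3 * h $ 3)) (at v)" for i
  proof -
    have Ti: "ternary_form e (\<lambda>v. T v $ i)" using assms unfolding form_map_def by blast
    obtain D :: "complex ^ 3 \<Rightarrow> complex ^ 3" where
      "\<And>v. ((\<lambda>v. T v $ i) has_derivative (\<lambda>h. D v $ 1 * h $ 1 + D v $ 2 * h $ 2 + D v $ 3 * h $ 3)) (at v)"
      using ternary_form_has_derivative[OF Ti] by blast
    then show ?thesis by (rule exI[of _ "D v"])
  qed
  then have "\<exists>p :: 3 \<Rightarrow> complex ^ 3. \<forall>i. ((\<lambda>v. T v $ i) has_derivative
      (\<lambda>h. p i $ 1 * h $ 1 + p i $ 2 * h $ 2 + p i $ 3 * h $ 3)) (at v)"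
    by (intro choice allI)
  then obtain p :: "3 \<Rightarrow> complex ^ 3" where
    p: "\<And>i. ((\<lambda>v. T v $ i) has_derivative (\<lambda>h. p i $ 1 * h $ 1 + p i $ 2 * h $ 2 + p i $ 3 * h $ 3)) (at v)"
    by blast
  have "(T has_derivative (\<lambda>h. \<chi> i. p i $ 1 * h $ 1 + p i $ 2 * h $ 2 + p i $ 3 * h $ 3)) (at v)"
    by (rule has_derivative_vec) (unfold vec_lambda_beta, rule p)
  then show ?thesis
    by (intro exI[of _ "\<lambda>h. \<chi> i. p i $ 1 * h $ 1 + p i $ 2 * h $ 2 + p i $ 3 * h $ 3"])
       (auto simp: vec_eq_iff algebra_simps)
qed

lemma ternary_form_has_derivative_at:
  "ternary_form d F \<Longrightarrow> \<exists>D. (F has_derivative D) (at v)"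
  using ternary_form_has_derivative by blast

lemma sing_at_compose:
  assumes "form_map e T" "sing_at F (T v)"
  shows "sing_at (\<lambda>v. F (T v)) v"
proof -
  obtain D where "(T has_derivative D) (at v)" using form_map_has_derivative[OF assms(1)] by blast
  from has_derivative_compose[OF this, of F "\<lambda>_. 0"] assms(2) show ?thesis
    unfolding sing_at_def by simp
qed

text \<open>Along each ray \<open>F (t *s v) = t ^ d * F v\<close>, whose derivative at
  \<open>t = 0\<close> is zero for \<open>d \<ge> 2\<close>.\<close>

lemma sing_at_0:
  assumes "ternary_form d F" "d \<ge> 2"
  shows "sing_at F 0"
proof -
  obtain D :: "complex ^ 3 \<Rightarrow> complex ^ 3" where
    D: "(F has_derivative (\<lambda>h. D 0 $ 1 * h $ 1 + D 0 $ 2 * h $ 2 + D 0 $ 3 * h $ 3)) (at 0)"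
    using ternary_form_has_derivative[OF assms(1)] by blast
  define E where "E = (\<lambda>h :: complex ^ 3. D 0 $ 1 * h $ 1 + D 0 $ 2 * h $ 2 + D 0 $ 3 * h $ 3)"
  have "E v = 0" for v
  proof -
    have "((\<lambda>t. t *s v) has_derivative (\<lambda>h. h *s v)) (at (0 :: complex))"
      by (rule has_derivative_vec) (auto intro!: derivative_eq_intros)
    from has_derivative_compose[OF this, of F E] D
    have "((\<lambda>t. F (t *s v)) has_derivative (\<lambda>h. E (h *s v))) (at 0)" by (simp add: E_def)
    moreover have "((\<lambda>t. F (t *s v)) has_derivative (\<lambda>h. 0)) (at 0)"
    proof -
      have "((\<lambda>t. t ^ d * F v) has_derivative (\<lambda>h. of_nat d * 0 ^ (d - 1) * F v * h)) (at 0)"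
        by (rule has_field_derivative_imp_has_derivative) (auto intro!: derivative_eq_intros)
      then show ?thesis using assms(2) ternary_form_scale[OF assms(1)] by (simp add: power_0_left)
    qed
    ultimately have "(\<lambda>h. E (h *s v)) = (\<lambda>h. 0)" by (rule has_derivative_unique)
    from fun_cong[OF this, of 1] show ?thesis by simp
  qed
  then show ?thesis
    using D ternary_form_zero_at_0[OF assms(1)] assms(2) unfolding sing_at_def E_def by simp
qed

lemma sing_at_mult_cancel:
  assumes F: "ternary_form d F" and k: "ternary_form e k" "k v \<noteq> 0" and "sing_at (\<lambda>v. k v * F v) v"
  shows "sing_at F v"
proof -
  have Fv: "F v = 0" using assms unfolding sing_at_def by simp
  obtain D E where DE: "(F has_derivative D) (at v)" "(k has_derivative E) (at v)"
    using ternary_form_has_derivative_at F k by blast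
  have "(\<lambda>h. k v * D h + E h * F v) = (\<lambda>_. 0)"
    using has_derivative_mult[OF DE(2,1)] assms(4) unfolding sing_at_def
    by (intro has_derivative_unique) auto
  then have "k v * D h = 0" for h using Fv by (metis add.right_neutral mult_zero_right)
  then have "D = (\<lambda>_. 0)" using k(2) by auto
  with DE Fv show ?thesis unfolding sing_at_def by simp
qed

lemma form_map_scaling: "form_map 1 (\<lambda>v. c *s v)"
  unfolding form_map_def vector_smult_component by (intro allI ternary_form_scaleC ternary_form_coord)

lemma sing_at_scale:
  assumes "ternary_form d F" "c \<noteq> 0" "sing_at F v"
  shows "sing_at F (c *s v)"
proof -
  have "sing_at (\<lambda>w. F ((1 / c) *s w)) (c *s v)"
    using assms by (intro sing_at_compose[OF form_map_scaling]) (simp add: vector_smult_assoc)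
  then have *: "sing_at (\<lambda>w. (1 / c) ^ d * F w) (c *s v)"
    by (simp add: ternary_form_scale[OF assms(1)])
  show ?thesis
    by (rule sing_at_mult_cancel[OF assms(1) ternary_form_const _ *]) (use assms in simp)
qed

section \<open>Transport of local coordinates\<close>

text \<open>Differentiating \<open>T' (T v) = k v *s v\<close> shows that the derivative
  \<open>E\<close> of \<open>T\<close> can only kill multiples of the base point
  \<open>\<psi> 0\<close>, and Euler's relation shows that it does not kill that either. So
  \<open>E\<close> is injective and preserves the independence required of a lift.\<close>

lemma local_coords_form_map:
  assumes T: "form_map e T" "e \<ge> 1" and T': "form_map e' T'" "e' \<ge> 1" and k: "ternary_form m k"
    and inv: "\<And>v. T' (T v) = k v *s v" and k0: "k (\<psi> 0) \<noteq> 0" and \<psi>: "local_coords \<psi> p"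
  shows "local_coords (\<lambda>x. T (\<psi> x)) (ppt (T (\<psi> 0)))"
proof -
  let ?w = "\<psi> 0"
  obtain D where D: "(\<psi> has_derivative D) (at 0)" "det (vector [?w, D (1, 0), D (0, 1)] :: complex ^ 3 ^ 3) \<noteq> 0"
    and holo: "\<And>i. holo2 (\<lambda>x. \<psi> x $ i)" and w: "?w \<noteq> 0"
    using \<psi> unfolding local_coords_def by blast
  obtain E where E: "(T has_derivative E) (at ?w)" "\<And>h k. E (h + k) = E h + E k" "\<And>c h. E (c *s h) = c *s E h"
    using form_map_has_derivative[OF T(1)] by blast
  obtain E' where E': "(T' has_derivative E') (at (T ?w))" using form_map_has_derivative[OF T'(1)] by blast
  obtain K where K: "(k has_derivative K) (at ?w)" using ternary_form_has_derivative_at[OF k] by blast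
  have "((\<lambda>v. k v *s v) has_derivative (\<lambda>h. K h *s ?w + k ?w *s h)) (at ?w)"
  proof (rule has_derivative_vec)
    fix i
    from has_derivative_mult[OF K bounded_linear_imp_has_derivative[OF bounded_linear_vec_nth[of i]]]
    show "((\<lambda>v. (k v *s v) $ i) has_derivative (\<lambda>h. (K h *s ?w + k ?w *s h) $ i)) (at ?w)"
      by (simp add: add.commute)
  qed
  moreover have "((\<lambda>v. k v *s v) has_derivative (\<lambda>h. E' (E h))) (at ?w)"
    using has_derivative_compose[OF E(1) E'] by (simp add: inv)
  ultimately have "(\<lambda>h. K h *s ?w + k ?w *s h) = (\<lambda>h. E' (E h))" by (rule has_derivative_unique)
  then have EE: "E' (E h) = K h *s ?w + k ?w *s h" for h by metis
  have E'0: "E' 0 = 0" using E' has_derivative_bounded_linear linear_0 bounded_linear.linear by blast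
  \<comment> \<open>Euler's relation, from \<open>T (t *s w) = t ^ e *s T w\<close> at
    \<open>t = 1\<close>.\<close>
  have euler: "E ?w = of_nat e *s T ?w"
  proof -
    have "((\<lambda>t. t *s ?w) has_derivative (\<lambda>h. h *s ?w)) (at (1 :: complex))"
      by (rule has_derivative_vec) (auto intro!: derivative_eq_intros)
    from has_derivative_compose[OF this, of T E] E(1)
    have "((\<lambda>t. T (t *s ?w)) has_derivative (\<lambda>h. E (h *s ?w))) (at 1)" by simp
    moreover have "((\<lambda>t. T (t *s ?w)) has_derivative (\<lambda>h. (h * of_nat e) *s T ?w)) (at 1)"
      unfolding form_map_scale[OF T(1)]
      by (rule has_derivative_vec) (auto intro!: derivative_eq_intros)
    ultimately have "(\<lambda>h. E (h *s ?w)) = (\<lambda>h. (h * of_nat e) *s T ?w)" by (rule has_derivative_unique)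
    from fun_cong[OF this, of 1] show ?thesis by simp
  qed
  have Tw: "T ?w \<noteq> 0"
  proof
    assume "T ?w = 0"
    have "T' 0 = 0"
      using form_map_scale[OF T'(1), of 0 0] T'(2) by (simp add: power_0_left)
    then show False using inv[of ?w] \<open>T ?w = 0\<close> w k0 by (simp add: vector_mul_eq_0)
  qed
  \<comment> \<open>\<open>E h = 0\<close> makes \<open>h\<close> a multiple of the base point, to
    which Euler's relation applies.\<close>
  have inj: "h = 0" if "E h = 0" for h
  proof -
    have "k ?w *s h = - (K h *s ?w)" using EE[of h] that E'0 by (simp add: add_eq_0_iff)
    then have "h = (- K h / k ?w) *s ?w" using k0
      by (simp add: vec_eq_iff field_simps)
    then obtain c where c: "h = c *s ?w" by blast
    then have "c *s (of_nat e *s T ?w) = 0" using that E(3) euler by simp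
    then show ?thesis using c Tw T(2) by (simp add: vector_mul_eq_0 vector_smult_assoc)
  qed
  have "det (vector [T ?w, E (D (1, 0)), E (D (0, 1))] :: complex ^ 3 ^ 3) \<noteq> 0"
    unfolding det_vector_3_iff
  proof (intro allI impI)
    fix a b c assume "a *s T ?w + b *s E (D (1, 0)) + c *s E (D (0, 1)) = 0"
    moreover have "a *s T ?w = E ((a / of_nat e) *s ?w)"
      unfolding E(3) euler using T(2) by (simp add: vector_smult_assoc)
    ultimately have "E ((a / of_nat e) *s ?w + b *s D (1, 0) + c *s D (0, 1)) = 0"
      by (simp add: E(2,3))
    from inj[OF this] D(2) have "a / of_nat e = 0 \<and> b = 0 \<and> c = 0" unfolding det_vector_3_iff by blast
    then show "a = 0 \<and> b = 0 \<and> c = 0" using T(2) by simp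
  qed
  moreover have "((\<lambda>x. T (\<psi> x)) has_derivative (\<lambda>h. E (D h))) (at 0)"
    by (rule has_derivative_compose[OF D(1) E(1)])
  moreover have "holo2 (\<lambda>x. T (\<psi> x) $ i)" for i
    by (rule holo2_ternary_form[of e "\<lambda>v. T v $ i"]) (use T holo in \<open>auto simp: form_map_def\<close>)
  ultimately show ?thesis using Tw unfolding local_coords_def by blast
qed

text \<open>The partial derivatives of the new lift are \<open>l 0\<close> times the old ones plus
  multiples of \<open>\<psi> 0\<close>, so linear independence persists.\<close>

lemma local_coords_scale:
  assumes \<psi>: "local_coords \<psi> p" and l: "holo2 l" "l 0 \<noteq> 0"
  shows "local_coords (\<lambda>x. l x *s \<psi> x) p"
proof -
  obtain D where D: "(\<psi> has_derivative D) (at 0)" "det (vector [\<psi> 0, D (1, 0), D (0, 1)] :: complex ^ 3 ^ 3) \<noteq> 0"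
    and holo: "\<And>i. holo2 (\<lambda>x. \<psi> x $ i)" and w: "\<psi> 0 \<noteq> 0" "p = ppt (\<psi> 0)"
    using \<psi> unfolding local_coords_def by blast
  obtain L where L: "(l has_derivative L) (at 0)" using holo2_at_0[OF l(1)] unfolding cdiff2_def by blast
  have "((\<lambda>x. l x *s \<psi> x) has_derivative (\<lambda>h. l 0 *s D h + L h *s \<psi> 0)) (at 0)"
  proof (rule has_derivative_vec)
    fix i
    from has_derivative_mult[OF L bounded_linear.has_derivative[OF bounded_linear_vec_nth[of i] D(1)]]
    show "((\<lambda>x. (l x *s \<psi> x) $ i) has_derivative (\<lambda>h. (l 0 *s D h + L h *s \<psi> 0) $ i)) (at 0)"
      by simp
  qed
  moreover have "det (vector [l 0 *s \<psi> 0, l 0 *s D (1, 0) + L (1, 0) *s \<psi> 0, l 0 *s D (0, 1) + L (0, 1) *s \<psi> 0] :: complex ^ 3 ^ 3) \<noteq> 0"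
    unfolding det_vector_3_iff
  proof (intro allI impI)
    fix a b c
    assume "a *s (l 0 *s \<psi> 0) + b *s (l 0 *s D (1, 0) + L (1, 0) *s \<psi> 0) + c *s (l 0 *s D (0, 1) + L (0, 1) *s \<psi> 0) = 0"
    then have "(a * l 0 + b * L (1, 0) + c * L (0, 1)) *s \<psi> 0 + (b * l 0) *s D (1, 0) + (c * l 0) *s D (0, 1) = 0"
      by (simp add: vec_eq_iff algebra_simps)
    then have *: "a * l 0 + b * L (1, 0) + c * L (0, 1) = 0 \<and> b * l 0 = 0 \<and> c * l 0 = 0"
      using D(2) unfolding det_vector_3_iff by blast
    then have "b = 0" "c = 0" using l(2) by auto
    with * l(2) show "a = 0 \<and> b = 0 \<and> c = 0" by simp
  qed
  moreover have "holo2 (\<lambda>x. (l x *s \<psi> x) $ i)" for i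
    using holo2_mult[OF l(1) holo] by simp
  ultimately show ?thesis
    using w l(2) ppt_scale[OF l(2)] unfolding local_coords_def by (auto simp: vector_mul_eq_0)
qed

lemma local_coords_emb:
  assumes fr: "is_frame fr" and f: "holo2 f" "((\<lambda>x. f x) has_derivative (\<lambda>(h, k). \<alpha> * h + \<beta> * k)) (at 0)" "\<beta> \<noteq> 0"
    and a: "lin a a' \<noteq> 0"
  shows "local_coords (\<lambda>x. emb fr (line_at a a' (fst x)) (f x)) (ppt (emb fr a (f 0)))"
proof -
  let ?\<psi> = "\<lambda>x. emb fr (line_at a a' (fst x)) (f x)"
  have "(?\<psi> has_derivative (\<lambda>h. emb fr (dil (fst h) a') (\<alpha> * fst h + \<beta> * snd h))) (at 0)"
  proof (rule has_derivative_vec)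
    fix i
    show "((\<lambda>x. ?\<psi> x $ i) has_derivative (\<lambda>h. emb fr (dil (fst h) a') (\<alpha> * fst h + \<beta> * snd h) $ i)) (at 0)"
      unfolding emb_component
      by (rule derivative_eq_intros f(2) refl)+ (simp add: algebra_simps case_prod_unfold fun_eq_iff)
  qed
  moreover have "det (vector [emb fr a (f 0), emb fr a' \<alpha>, emb fr (0, 0) \<beta>] :: complex ^ 3 ^ 3) \<noteq> 0"
    unfolding det_vector_3_iff
  proof (intro allI impI)
    fix x y z assume "x *s emb fr a (f 0) + y *s emb fr a' \<alpha> + z *s emb fr (0, 0) \<beta> = 0"
    then have "emb fr (x * fst a + y * fst a', x * snd a + y * snd a') (x * f 0 + y * \<alpha> + z * \<beta>) = 0"
      by (simp add: vec_eq_iff emb_component algebra_simps)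
    then have *: "x * fst a + y * fst a' = 0" "x * snd a + y * snd a' = 0" "x * f 0 + y * \<alpha> + z * \<beta> = 0"
      using emb_eq_0_iff[OF fr] by (auto simp: zero_prod_def)
    have "x * lin a a' = 0" "y * lin a a' = 0" using *(1,2) unfolding lin_def by algebra+
    then have "x = 0" "y = 0" using a by auto
    with * f(3) show "x = 0 \<and> y = 0 \<and> z = 0" by simp
  qed
  moreover have "holo2 (\<lambda>x. ?\<psi> x $ i)" for i
    unfolding emb_component fst_conv snd_conv
    by (intro holo2_add holo2_mult holo2_const holo2_fst f)
  moreover have "emb fr a (f 0) \<noteq> 0"
    using a emb_eq_0_iff[OF fr, of a "f 0"] by (auto simp: lin_def)
  ultimately show ?thesis unfolding local_coords_def
    by (intro conjI allI exI[of _ "\<lambda>h. emb fr (dil (fst h) a') (\<alpha> * fst h + \<beta> * snd h)"]) auto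
qed

lemma exists_lin_neq_0: "a \<noteq> 0 \<Longrightarrow> \<exists>a'. lin a a' \<noteq> 0"
proof -
  assume "a \<noteq> 0"
  then have "lin a (0, 1) \<noteq> 0 \<or> lin a (1, 0) \<noteq> 0" by (cases a) (auto simp: lin_def zero_prod_def)
  then show ?thesis by blast
qed

lemma holo2_root:
  assumes "holo2 f" "f 0 \<noteq> 0" "n \<ge> 1"
  shows "\<exists>l. holo2 l \<and> l 0 \<noteq> 0 \<and> (\<forall>\<^sub>F x in nhds 0. l x ^ n = f x)"
proof -
  \<comment> \<open>Dividing by \<open>f 0\<close> keeps the argument of \<open>Ln\<close> near 1,
    away from the branch cut; the first factor restores the constant.\<close>
  define l where "l = (\<lambda>x. exp (Ln (f 0) / of_nat n) * exp (Ln (f x / f 0) / of_nat n))"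
  have "holo2 (\<lambda>x. exp (Ln (f x / f 0) / of_nat n))"
    by (rule holo2_analytic[of "\<lambda>x. f x / f 0" "\<lambda>z. exp (Ln z / of_nat n)"])
       (use assms in \<open>auto intro!: holo2_divide analytic_intros\<close>)
  then have "holo2 l" unfolding l_def by (intro holo2_mult holo2_const)
  moreover have "l 0 \<noteq> 0" by (simp add: l_def)
  moreover have "\<forall>\<^sub>F x in nhds 0. f x \<in> - {0}"
    by (rule eventually_nhds_compose[OF eventually_nhds_in_open holo2_isCont[OF assms(1)]])
       (use assms in auto)
  then have "\<forall>\<^sub>F x in nhds 0. l x ^ n = f x"
  proof eventually_elim
    case (elim x)
    then show ?case using assms(2,3)
      by (simp add: l_def power_mult_distrib exp_of_nat_mult[symmetric])
  qed
  ultimately show ?thesis by blast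
qed

section \<open>Explicit form of the Cremona transformations\<close>

lemma ppt_in_curve_points_iff:
  assumes "ternary_form d F" "w \<noteq> 0"
  shows "ppt w \<in> curve_points F \<longleftrightarrow> F w = 0"
proof
  assume "ppt w \<in> curve_points F"
  then obtain v where v: "ppt v = ppt w" "F v = 0" unfolding curve_points_def by auto
  from ppt_eqD[OF v(1)] obtain c where "w = c *s v" by blast
  then show "F w = 0" using v(2) ternary_form_scale[OF assms(1)] by simp
qed (use assms in \<open>unfold curve_points_def, blast\<close>)

lemma blow_up_P2_eq:
  "blow_up_P2 fr = {(ppt (emb fr (dil y x) z), hpt 1 x y z) | x y z. x \<noteq> 0 \<and> (y, z) \<noteq> 0}"
  unfolding blow_up_P2_def emb_def direction_scale ..

lemma blow_up_P2I:
  "x \<noteq> 0 \<Longrightarrow> y \<noteq> 0 \<Longrightarrow> (ppt (emb fr (dil y x) z), hpt 1 x y z) \<in> blow_up_P2 fr"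
proof -
  assume "x \<noteq> 0" "y \<noteq> 0"
  moreover from this have "(y, z) \<noteq> 0" by (simp add: zero_prod_def)
  ultimately show ?thesis unfolding blow_up_P2_eq by blast
qed

lemma emb_cone_nonzero:
  assumes "is_frame fr" "x \<noteq> 0" "(y, z) \<noteq> 0"
  shows "emb fr (dil y x) z \<noteq> 0"
  using assms emb_eq_0_iff[OF assms(1)] by (cases x) (auto simp: zero_prod_def)

lemma curve_on_blow_up_P2:
  assumes F: "ternary_form d F" "F (vertex fr) \<noteq> 0" and fr: "is_frame fr"
  shows "snd ` proper_transform (blow_up_P2 fr) (ppt (vertex fr)) (curve_points F) =
     h_curve 1 (transform_eq F fr (\<lambda>_. 1) (\<lambda>_. 0) (\<lambda>_. 1))"
proof -
  have V0: "vertex fr \<noteq> 0"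
    using emb_eq_0_iff[OF fr, of 0 1] by (simp add: emb_def zero_prod_def)
  have "snd ` proper_transform (blow_up_P2 fr) (ppt (vertex fr)) (curve_points F) =
      blow_up_P2 fr `` curve_points F"
  proof (rule image_proper_transform[where K = "{v. F v = 0}"])
    show "ppt (vertex fr) \<notin> curve_points F"
      using ppt_in_curve_points_iff[OF F(1) V0] F(2) by simp
    show "closed {v. F v = 0}"
      by (intro closed_Collect_eq ternary_form_continuous[OF F(1)] continuous_on_const)
    show "P \<subseteq> {v. F v = 0}" if P: "P \<in> curve_points F" for P
    proof -
      obtain v where v: "P = ppt v" "F v = 0" using P unfolding curve_points_def by blast
      show ?thesis unfolding v(1) using v(2) ternary_form_scale[OF F(1)] by (auto dest!: ppt_memD)
    qed
    show "P \<noteq> {} \<and> P' \<noteq> {}" if P: "(P, P') \<in> blow_up_P2 fr" for P P'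
      using that ppt_self hpt_self unfolding blow_up_P2_eq by blast
    show "P \<in> curve_points F" if P: "(P, P') \<in> blow_up_P2 fr" and v: "v \<in> P" "v \<in> {v. F v = 0}" for P P' v
    proof -
      obtain w where w: "P = ppt w" "w \<noteq> 0"
        using P emb_cone_nonzero[OF fr] unfolding blow_up_P2_eq by blast
      obtain c where c: "c \<noteq> 0" "v = c *s w" using v(1) w(1) ppt_memD by blast
      then have "F w = 0" using v(2) ternary_form_scale[OF F(1)] by simp
      then show ?thesis using ppt_in_curve_points_iff[OF F(1) w(2)] w(1) by simp
    qed
  qed
  also have "\<dots> = h_curve 1 (transform_eq F fr (\<lambda>_. 1) (\<lambda>_. 0) (\<lambda>_. 1))"
  proof -
    have T: "transform_eq F fr (\<lambda>_. 1) (\<lambda>_. 0) (\<lambda>_. 1) x y z = F (emb fr (dil y x) z)" for x y z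
      by (simp add: transform_eq_def)
    show ?thesis
      using ppt_in_curve_points_iff[OF F(1) emb_cone_nonzero[OF fr]]
      unfolding blow_up_P2_eq h_curve_def T by blast
  qed
  finally show ?thesis .
qed

text \<open>Both directions are instances: \<tau> is built from \<open>Q\<close>, \<open>R\<close>,
  \<open>S\<close>, and \<sigma> from \<open>R\<close>, \<open>Q\<close>, \<open>- S\<close> with
  the frames exchanged.\<close>

definition cremona_map :: "frame \<Rightarrow> frame \<Rightarrow> (p1_coord \<Rightarrow> complex) \<Rightarrow> (p1_coord \<Rightarrow> complex) \<Rightarrow>
    (p1_coord \<Rightarrow> complex) \<Rightarrow> complex ^ 3 \<Rightarrow> complex ^ 3" where
  "cremona_map fr fr' Q R S v =
     (let x = xcoord fr v in emb fr' (dil (Q x) x) (R x * zcoord fr v + S x))"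

lemma cremona_map_emb:
  "is_frame fr \<Longrightarrow> cremona_map fr fr' Q R S (emb fr x z) = emb fr' (dil (Q x) x) (R x * z + S x)"
  by (simp add: cremona_map_def)

lemma form_map_cremona_map:
  assumes "binary_form N Q" "binary_form N R" "binary_form (N + 1) S"
  shows "form_map (N + 1) (cremona_map fr fr' Q R S)"
  unfolding form_map_def cremona_map_def Let_def
proof (intro allI ternary_form_emb, unfold fst_conv snd_conv)
  have *: "ternary_form n (\<lambda>v. q (xcoord fr v))" if "binary_form n q" for n q
    using binary_form_compose_ternary[OF that ternary_form_coords(1)[of fr] ternary_form_coords(2)[of fr]] by simp
  show "ternary_form (N + 1) (\<lambda>v. Q (xcoord fr v) * fst (xcoord fr v))"
    "ternary_form (N + 1) (\<lambda>v. Q (xcoord fr v) * snd (xcoord fr v))"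
    "ternary_form (N + 1) (\<lambda>v. R (xcoord fr v) * zcoord fr v + S (xcoord fr v))"
    by (intro ternary_form_add ternary_form_mult * assms ternary_form_coords)+
qed

text \<open>The inner map scales \<open>x\<close> by \<open>R x\<close>, so \<open>S\<close>
  acquires the factor \<open>R x ^ (N + 1)\<close> and \<open>R\<close> the factor
  \<open>R x ^ N\<close>; as the degree of \<open>S\<close> is one larger, the two contributions of
  \<open>S\<close> cancel.\<close>

lemma cremona_map_inverse:
  assumes "is_frame fr" "is_frame fr'" "binary_form N Q" "binary_form N R" "binary_form (N + 1) S"
  shows "cremona_map fr' fr Q R S (cremona_map fr fr' R Q (\<lambda>x. - S x) v) =
     (R (xcoord fr v) ^ (N + 1) * Q (xcoord fr v)) *s v"
proof -
  define x z where "x = xcoord fr v" and "z = zcoord fr v"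
  have v: "v = emb fr x z" using assms(1) by (simp add: x_def z_def)
  show ?thesis
    unfolding v cremona_map_emb[OF assms(1)] cremona_map_emb[OF assms(2)] fst_conv snd_conv
      binary_form_scale[OF assms(3)] binary_form_scale[OF assms(4)] binary_form_scale[OF assms(5)]
    using assms(1) by (simp add: emb_scale mult_ac) (simp add: algebra_simps)
qed

lemma cremona_data:
  assumes F: "ternary_form d F" "d \<ge> 1" "F (vertex fr) \<noteq> 0" and fr: "is_frame fr" "is_frame fr'"
    and as: "as \<noteq> []" "\<forall>a\<in>set as. a \<noteq> 0" and bs: "\<forall>b\<in>set bs. fst b \<noteq> 0" "length bs = length as"
    and ok: "second_centres_ok (length as + 1) bs (curve_on_top fr as F)"
    and Q: "Q = lin_prod as" and R: "R = lin_prod (map fst bs)"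
  obtains S where "binary_form (length as + 1) S"
    "\<And>x. x \<noteq> 0 \<Longrightarrow> R x = 0 \<Longrightarrow> F (emb fr (dil (Q x) x) (S x)) \<noteq> 0"
    "curve_points (\<lambda>v. F (cremona_map fr' fr Q R S v)) = cremona_image fr fr' as bs F"
    "\<And>v. xcoord fr v \<noteq> 0 \<Longrightarrow> Q (xcoord fr v) \<noteq> 0 \<Longrightarrow> R (xcoord fr v) \<noteq> 0 \<Longrightarrow>
       (ppt v, ppt (cremona_map fr fr' R Q (\<lambda>x. - S x) v)) \<in> cremona_rel fr fr' as bs"
proof -
  let ?N = "length as"
  have formQ: "binary_form ?N Q" unfolding Q by (rule binary_form_lin_prod)
  have formR: "binary_form ?N R" unfolding R using binary_form_lin_prod[of "map fst bs"] bs(2) by simp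
  have "curve_on_top fr as F = h_curve (1 + ?N) (transform_eq F fr (\<lambda>x. 1 * lin_prod as x) (\<lambda>_. 0) (\<lambda>_. 1))"
    unfolding curve_on_top_def curve_on_blow_up_P2[OF F(1,3) fr(1)]
    by (rule first_curve_transform_eq[OF F]) (use as in simp_all)
  then have top: "curve_on_top fr as F = h_curve (?N + 1) (transform_eq F fr Q (\<lambda>_. 0) (\<lambda>_. 1))"
    by (simp add: Q)
  define S where "S = second_shift bs (\<lambda>_. 0) (\<lambda>_. 1)"
  have Rd: "R = (\<lambda>x. 1 * lin_prod (map fst bs) x)" by (simp add: R)
  have *: "binary_form (?N + 1) S \<and> (\<forall>x. x \<noteq> 0 \<longrightarrow> R x = 0 \<longrightarrow> transform_eq F fr Q S R x 1 0 \<noteq> 0) \<and>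
      second_curve (?N + 1) bs (curve_on_top fr as F) = h_curve 1 (transform_eq F fr Q S R)"
  proof (rule second_curve_transform_eq[OF F, where j = 0 and n = "?N + 1" and A = Q and B = "\<lambda>_. 0" and C = "\<lambda>_. 1" and bs = bs])
    show "second_centres_ok (?N + 1) bs (h_curve (?N + 1) (transform_eq F fr Q (\<lambda>_. 0) (\<lambda>_. 1)))"
      using ok unfolding top .
    fix S' R' assume SR: "S' = second_shift bs (\<lambda>_. 0) (\<lambda>_. 1)" "R' = (\<lambda>x. 1 * lin_prod (map fst bs) x)"
      and h: "binary_form (0 + (?N + 1)) S'" "\<forall>x. x \<noteq> 0 \<longrightarrow> R' x = 0 \<longrightarrow> transform_eq F fr Q S' R' x 1 0 \<noteq> 0"
      "second_curve (?N + 1) bs (h_curve (?N + 1) (transform_eq F fr Q (\<lambda>_. 0) (\<lambda>_. 1))) =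
        h_curve (?N + 1 - length bs) (transform_eq F fr Q S' R')"
    have "S' = S" "R' = R" using SR by (simp_all add: S_def R)
    with h show ?thesis unfolding top using bs(2) by simp
  qed (use bs formQ in \<open>auto intro: binary_form_zero\<close>)
  then have formS: "binary_form (?N + 1) S" by blast
  have nz: "F (emb fr (dil (Q x) x) (S x)) \<noteq> 0" if "x \<noteq> 0" "R x = 0" for x
    using *[THEN conjunct2, THEN conjunct1, rule_format, OF that] by (simp add: transform_eq_def)
  let ?G = "\<lambda>v. F (cremona_map fr' fr Q R S v)"
  have N1: "?N \<ge> 1" using as(1) by (cases as) auto
  \<comment> \<open>For \<open>y \<noteq> 0\<close> only: there a factor \<open>y ^ N\<close> can be
    taken out of \<tau>. The points with \<open>y = 0\<close> are all contracted to the vertex and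
    are treated separately.\<close>
  have G_emb: "?G (emb fr' (dil y x) z) = 0 \<longleftrightarrow> transform_eq F fr Q S R x y z = 0"
    if "y \<noteq> 0" for x y z
  proof -
    have "?G (emb fr' (dil y x) z) =
        F (y ^ ?N *s emb fr (dil (Q x * y) x) (S x * y + R x * z))"
      unfolding cremona_map_emb[OF fr(2)] fst_conv snd_conv emb_scale
        binary_form_scale[OF formQ] binary_form_scale[OF formR] binary_form_scale[OF formS]
      by (simp add: algebra_simps)
    also have "\<dots> = (y ^ ?N) ^ d * transform_eq F fr Q S R x y z"
      unfolding ternary_form_scale[OF F(1)] transform_eq_def ..
    finally show ?thesis using that by simp
  qed
  have F0: "F (emb fr (0, 0) 0) = 0" using ternary_form_zero_at_0[OF F(1,2)] by simp
  have R0: "R (0, 0) = 0" and S0: "S (0, 0) = 0" and Q0: "Q (0, 0) = 0"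
    using binary_form_zero_at_0[OF formR N1] binary_form_zero_at_0[OF formS]
      binary_form_zero_at_0[OF formQ N1] by (simp_all add: zero_prod_def)
  have G_vertex: "?G (emb fr' (0, 0) z) = 0" for z
    unfolding cremona_map_emb[OF fr(2)] using F0 by (simp add: R0 S0)
  have img: "cremona_image fr fr' as bs F =
      {ppt (emb fr' (dil y x) z) | x y z. x \<noteq> 0 \<and> (y, z) \<noteq> 0 \<and> transform_eq F fr Q S R x y z = 0}"
  proof -
    have \<Phi>: "h_equation 1 (transform_eq F fr Q S R)"
      by (rule h_equation_transform_eq[OF F, where j = ?N]) (use formQ formS formR in simp_all)
    show ?thesis
      unfolding cremona_image_def *[THEN conjunct2, THEN conjunct2]
      using hpt_in_h_curve_iff[OF \<Phi>] unfolding blow_up_P2_eq by blast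
  qed
  have "curve_points ?G = cremona_image fr fr' as bs F"
  proof (intro equalityI subsetI)
    fix P assume "P \<in> curve_points ?G"
    then obtain w where w: "P = ppt w" "w \<noteq> 0" "?G w = 0" unfolding curve_points_def by blast
    define x z where "x = xcoord fr' w" and "z = zcoord fr' w"
    have wxz: "w = emb fr' x z" using fr(2) by (simp add: x_def z_def)
    show "P \<in> cremona_image fr fr' as bs F"
    proof (cases "x = 0")
      case False
      have "transform_eq F fr Q S R x 1 z = 0" using G_emb[of 1 x z] w(3) wxz by simp
      moreover have "(1 :: complex, z) \<noteq> 0" by (simp add: zero_prod_def)
      moreover have "P = ppt (emb fr' (dil 1 x) z)" using w wxz by simp
      ultimately show ?thesis unfolding img using False by blast
    next
      case True
      then have "z \<noteq> 0" using w(2) wxz emb_eq_0_iff[OF fr(2)] by blast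
      \<comment> \<open>Any fibre over a zero of \<open>R\<close> shows that the vertex is on the
        image: with \<open>R = 0\<close> and \<open>y = 0\<close> both arguments of \<open>F\<close>
        vanish.\<close>
      obtain b where b: "b \<in> set bs" using bs(2) as(1) by (cases bs) auto
      have Rb: "R (fst b) = 0" unfolding R using b by (induction bs) auto
      have "transform_eq F fr Q S R (fst b) 0 z = 0"
        using F0 Rb by (simp add: transform_eq_def)
      moreover have "(0 :: complex, z) \<noteq> 0" using \<open>z \<noteq> 0\<close> by (simp add: zero_prod_def)
      moreover have "P = ppt (emb fr' (dil 0 (fst b)) z)" using w wxz True by (simp add: zero_prod_def)
      moreover have "fst b \<noteq> 0" using b bs(1) by blast
      ultimately show ?thesis unfolding img by blast
    qed
  next
    fix P assume "P \<in> cremona_image fr fr' as bs F"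
    then obtain x y z where P: "P = ppt (emb fr' (dil y x) z)" "x \<noteq> 0" "(y, z) \<noteq> 0"
      "transform_eq F fr Q S R x y z = 0" unfolding img by blast
    have "?G (emb fr' (dil y x) z) = 0"
      using G_emb[of y x z] P(4) G_vertex[of z] by (cases "y = 0") auto
    then show "P \<in> curve_points ?G"
      unfolding P(1) curve_points_def using emb_cone_nonzero[OF fr(2) P(2,3)] by blast
  qed
  moreover have "(ppt v, ppt (cremona_map fr fr' R Q (\<lambda>x. - S x) v)) \<in> cremona_rel fr fr' as bs"
    if v: "xcoord fr v \<noteq> 0" "Q (xcoord fr v) \<noteq> 0" "R (xcoord fr v) \<noteq> 0" for v
  proof -
    define x z where "x = xcoord fr v" and "z = zcoord fr v"
    have vxz: "v = emb fr (dil 1 x) z" using fr(1) by (simp add: x_def z_def)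
    have "(ppt v, hpt 1 x 1 z) \<in> blow_up_P2 fr"
      unfolding vxz by (rule blow_up_P2I) (use v(1) in \<open>simp_all add: x_def\<close>)
    moreover have "(hpt 1 x 1 z, hpt (1 + ?N) x 1 (Q x * z)) \<in> first_rel 1 as"
      unfolding Q by (rule first_rel_generic) (use v in \<open>auto simp: x_def\<close>)
    \<comment> \<open>The case \<open>y = 1\<close>, \<open>B = 0\<close>, \<open>C = 1\<close> of
      \<open>second_rel_generic\<close>, with the units written out to match its pattern.\<close>
    moreover have "(hpt (?N + 1) x (1 * 1) (Q x * z - 0 * 1), hpt (?N + 1 - length bs) x (1 * lin_prod (map fst bs) x * 1)
        (Q x * z - S x * 1)) \<in> second_rel (?N + 1) bs"
      unfolding S_def
      by (rule second_rel_generic[where B = "\<lambda>_. 0" and C = "\<lambda>_. 1" and D = "curve_on_top fr as F"])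
         (use v ok bs(2) in \<open>auto simp: x_def R\<close>)
    then have "(hpt (1 + ?N) x 1 (Q x * z), hpt 1 x (R x) (Q x * z - S x)) \<in> second_rel (?N + 1) bs"
      using bs(2) by (simp add: R)
    moreover have "(ppt (cremona_map fr fr' R Q (\<lambda>x. - S x) v), hpt 1 x (R x) (Q x * z - S x)) \<in> blow_up_P2 fr'"
      using blow_up_P2I[of x "R x" fr' "Q x * z - S x"] v fr(1) unfolding vxz
      by (simp add: cremona_map_emb x_def[symmetric])
    ultimately show ?thesis unfolding cremona_rel_def by blast
  qed
  ultimately show thesis using that formS nz by blast
qed

section \<open>Products of equations of lines, branches near one of them\<close>

lemma binary_form_power: "binary_form n f \<Longrightarrow> binary_form (k * n) (\<lambda>x. f x ^ k)"
  by (induction k) (simp_all add: binary_form_mult)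

lemma binary_form_prod:
  "finite A \<Longrightarrow> (\<And>i. i \<in> A \<Longrightarrow> binary_form (k i) (f i)) \<Longrightarrow> binary_form (sum k A) (\<lambda>x. \<Prod>i\<in>A. f i x)"
  by (induction A rule: finite_induct) (simp_all add: binary_form_mult)

text \<open>The product \<open>lin_prod\<close> over a list with repetitions, regrouped by
  exponents, so that the full power belonging to one line can be split off.\<close>

definition line_prod :: "p1_coord list \<Rightarrow> nat list \<Rightarrow> p1_coord \<Rightarrow> complex" where
  "line_prod as ks x = (\<Prod>i<length as. lin (as ! i) x ^ (ks ! i))"

lemma binary_form_lin_powers:
  "finite A \<Longrightarrow> binary_form (\<Sum>i\<in>A. ks ! i) (\<lambda>x. \<Prod>i\<in>A. lin (as ! i) x ^ (ks ! i))"
  using binary_form_power[OF binary_form_lin] by (intro binary_form_prod) auto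

lemma binary_form_line_prod:
  assumes "length as = length ks"
  shows "binary_form (sum_list ks) (line_prod as ks)"
  using binary_form_lin_powers[of "{..<length as}" ks as] assms
  by (simp add: line_prod_def[abs_def] sum_list_sum_nth atLeast0LessThan)

lemma line_prod_eq_0_iff:
  assumes "length as = length ks" "\<forall>k\<in>set ks. k \<ge> 1"
  shows "line_prod as ks x = 0 \<longleftrightarrow> (\<exists>i<length as. lin (as ! i) x = 0)"
proof -
  have "ks ! i \<noteq> 0" if "i < length as" for i
    using assms nth_mem[of i ks] that by fastforce
  then show ?thesis by (auto simp: line_prod_def)
qed

lemma line_prod_factor:
  assumes "i < length as" "\<forall>j<length as. j \<noteq> i \<longrightarrow> lin (as ! j) (as ! i) \<noteq> 0"
  obtains q m where "binary_form m q" "\<And>x. line_prod as ks x = lin (as ! i) x ^ (ks ! i) * q x" "q (as ! i) \<noteq> 0"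
proof
  show "binary_form (\<Sum>j\<in>{..<length as} - {i}. ks ! j) (\<lambda>x. \<Prod>j\<in>{..<length as} - {i}. lin (as ! j) x ^ (ks ! j))"
    by (rule binary_form_lin_powers) simp
  show "line_prod as ks x = lin (as ! i) x ^ (ks ! i) * (\<Prod>j\<in>{..<length as} - {i}. lin (as ! j) x ^ (ks ! j))" for x
    unfolding line_prod_def using assms(1) by (subst prod.remove[of _ i]) auto
  show "(\<Prod>j\<in>{..<length as} - {i}. lin (as ! j) (as ! i) ^ (ks ! j)) \<noteq> 0"
    using assms(2) by auto
qed

lemma binary_form_analytic:
  assumes "binary_form n q"
  shows "(\<lambda>u. q (line_at a a' u)) analytic_on S"
  by (rule binary_form_closure[where P = "\<lambda>_ f. f analytic_on S", OF assms]) (auto intro!: analytic_intros)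

lemma lin_line: "lin p (line_at a a' u) = lin p a + u * lin p a'"
  by (simp add: lin_def algebra_simps)

text \<open>Homogeneity for \<open>q \<noteq> 0\<close>. The case \<open>q = 0\<close>, where both
  sides are \<open>w ^ d * F (vertex fr)\<close>, is needed too, because \<open>Q\<close> vanishes
  on the line itself.\<close>

lemma form_at_dilated_branches:
  assumes F: "ternary_form d F" and eq: "\<And>z. F (emb fr x z) = F (vertex fr) * (\<Prod>i<d. z - \<rho> i)"
  shows "F (emb fr (dil q x) w) = F (vertex fr) * (\<Prod>i<d. w - q * \<rho> i)"
proof (cases "q = 0")
  case True
  have "emb fr (0, 0) w = w *s vertex fr" by (simp add: emb_def)
  then show ?thesis using True ternary_form_scale[OF F, of w "vertex fr"] by simp
next
  case False
  have "emb fr (dil q x) w = q *s emb fr x (w / q)" using False by (simp add: emb_scale)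
  then have "F (emb fr (dil q x) w) = q ^ d * (F (vertex fr) * (\<Prod>i<d. w / q - \<rho> i))"
    using ternary_form_scale[OF F] eq by simp
  also have "\<dots> = F (vertex fr) * (\<Prod>i<d. q * (w / q - \<rho> i))"
    by (simp add: prod.distrib)
  also have "(\<Prod>i<d. q * (w / q - \<rho> i)) = (\<Prod>i<d. w - q * \<rho> i)"
    using False by (intro prod.cong refl) (simp add: field_simps)
  finally show ?thesis .
qed

lemma meets_transversally_scale:
  assumes "c \<noteq> 0" "meets_transversally F u v"
  shows "meets_transversally F u (c *s v)"
proof -
  have "{b *s u + k *s (c *s v) | b k. True} = {b *s u + k *s v | b k. True}"
  proof (intro equalityI subsetI)
    fix w assume "w \<in> {b *s u + k *s v | b k. True}"
    then obtain b k where "w = b *s u + k *s v" by blast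
    then have "w = b *s u + (k / c) *s (c *s v)" using assms(1) by (simp add: vector_smult_assoc)
    then show "w \<in> {b *s u + k *s (c *s v) | b k. True}" by blast
  qed (auto simp: vector_smult_assoc)
  then show ?thesis using assms(2) unfolding meets_transversally_def by simp
qed

lemma transversal_not_sing_at:
  assumes "meets_transversally F u v" "sing_at F (b *s u + c *s v)" "b *s u + c *s v \<noteq> 0"
  shows False
proof -
  obtain D h where "(F has_derivative D) (at (b *s u + c *s v))" "D h \<noteq> 0"
    using assms unfolding meets_transversally_def sing_at_def by blast
  moreover have "D = (\<lambda>_. 0)"
    using calculation(1) assms(2) has_derivative_unique unfolding sing_at_def by blast
  ultimately show False by simp
qed

lemma eventually_nhds_fst:
  "eventually P (nhds (0 :: complex)) \<Longrightarrow> \<forall>\<^sub>F x in nhds 0. P (fst (x :: complex \<times> complex))"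
  by (rule eventually_nhds_compose) auto

lemma eventually_nhds_snd:
  "eventually P (nhds (0 :: complex)) \<Longrightarrow> \<forall>\<^sub>F x in nhds 0. P (snd (x :: complex \<times> complex))"
  by (rule eventually_nhds_compose) auto

text \<open>Of the chain of surfaces only the form \<open>S\<close> survives, with its degree and
  \<open>S_nonzero\<close>: the final curve on the last Hirzebruch surface meets the fibres over the
  lines \<open>ps\<close> on the exceptional section only.\<close>

locale cremona_curve =
  fixes F :: "complex ^ 3 \<Rightarrow> complex" and d N :: nat and fr fr' :: frame
    and qs ps :: "p1_coord list" and ns ms :: "nat list" and S Q R :: "p1_coord \<Rightarrow> complex"
  assumes F: "ternary_form d F" "d \<ge> 2" and lines: "admissible_lines F fr qs ps" and fr': "is_frame fr'"
    and lengths: "length qs = length ns" "length ps = length ms"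
    and pos: "\<forall>n\<in>set ns. n \<ge> 1" "\<forall>m\<in>set ms. m \<ge> 1" and nonempty: "ns \<noteq> []"
    and N: "N = sum_list ns" "sum_list ns = sum_list ms"
    and Q_def: "Q = line_prod qs ns" and R_def: "R = line_prod ps ms"
    and S: "binary_form (N + 1) S"
    and S_nonzero: "\<And>x. x \<noteq> 0 \<Longrightarrow> R x = 0 \<Longrightarrow> F (emb fr (dil (Q x) x) (S x)) \<noteq> 0"
begin

definition \<tau> :: "complex ^ 3 \<Rightarrow> complex ^ 3" where "\<tau> = cremona_map fr' fr Q R S"
definition \<sigma> :: "complex ^ 3 \<Rightarrow> complex ^ 3" where "\<sigma> = cremona_map fr fr' R Q (\<lambda>x. - S x)"
definition G :: "complex ^ 3 \<Rightarrow> complex" where "G = (\<lambda>v. F (\<tau> v))"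

lemma fr: "is_frame fr" and vertex_nonzero: "F (vertex fr) \<noteq> 0"
  using lines unfolding admissible_lines_def by auto

lemma line_q: "i < length qs \<Longrightarrow> qs ! i \<noteq> 0 \<and> meets_transversally F (vertex fr) (direction fr (qs ! i))"
  and line_p: "j < length ps \<Longrightarrow> ps ! j \<noteq> 0 \<and> meets_transversally F (vertex fr) (direction fr (ps ! j))"
  using lines nth_mem unfolding admissible_lines_def by auto

lemma lin_nonzero:
  "i < length (qs @ ps) \<Longrightarrow> j < length (qs @ ps) \<Longrightarrow> i \<noteq> j \<Longrightarrow> lin ((qs @ ps) ! i) ((qs @ ps) ! j) \<noteq> 0"
  using lines unfolding admissible_lines_def by blast

lemma lin_qq: "i < length qs \<Longrightarrow> j < length qs \<Longrightarrow> i \<noteq> j \<Longrightarrow> lin (qs ! i) (qs ! j) \<noteq> 0"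
  using lin_nonzero[of i j] by (simp add: nth_append)

lemma lin_pp: "i < length ps \<Longrightarrow> j < length ps \<Longrightarrow> i \<noteq> j \<Longrightarrow> lin (ps ! i) (ps ! j) \<noteq> 0"
  using lin_nonzero[of "length qs + i" "length qs + j"] by (simp add: nth_append)

lemma lin_qp: "i < length qs \<Longrightarrow> j < length ps \<Longrightarrow> lin (qs ! i) (ps ! j) \<noteq> 0"
  using lin_nonzero[of i "length qs + j"] by (simp add: nth_append)

lemma Q: "binary_form N Q" and R: "binary_form N R"
  using binary_form_line_prod[of qs ns] binary_form_line_prod[of ps ms] lengths N
  by (simp_all add: Q_def R_def)

lemma Q_eq_0_iff: "Q x = 0 \<longleftrightarrow> (\<exists>i<length qs. lin (qs ! i) x = 0)"
  and R_eq_0_iff: "R x = 0 \<longleftrightarrow> (\<exists>j<length ps. lin (ps ! j) x = 0)"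
  using line_prod_eq_0_iff[OF lengths(1) pos(1)] line_prod_eq_0_iff[OF lengths(2) pos(2)]
  by (simp_all add: Q_def R_def)

lemma QR_coprime: "x \<noteq> 0 \<Longrightarrow> Q x = 0 \<Longrightarrow> R x \<noteq> 0"
proof
  assume x: "x \<noteq> 0" "Q x = 0" "R x = 0"
  then obtain i j where ij: "i < length qs" "j < length ps" "lin (qs ! i) x = 0" "lin (ps ! j) x = 0"
    unfolding Q_eq_0_iff R_eq_0_iff by blast
  obtain c where c: "c \<noteq> 0" "x = dil c (ps ! j)"
    using ij line_p lin_eq_0_iff[OF _ x(1)] by blast
  then have "lin (qs ! i) x = c * lin (qs ! i) (ps ! j)" by (simp add: lin_def algebra_simps)
  then show False using lin_qp[OF ij(1,2)] ij(3) c(1) by simp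
qed

lemma N_pos: "N \<ge> 1"
  using nonempty pos(1) N(1) by (cases ns) auto

lemma Q_0: "Q (0, 0) = 0" and R_0: "R (0, 0) = 0" and S_0: "S (0, 0) = 0"
  using binary_form_zero_at_0[OF Q N_pos] binary_form_zero_at_0[OF R N_pos] binary_form_zero_at_0[OF S]
  by (simp_all add: zero_prod_def)

lemma form_map_\<tau>: "form_map (N + 1) \<tau>" and form_map_\<sigma>: "form_map (N + 1) \<sigma>"
proof -
  have S': "binary_form (N + 1) (\<lambda>x. - S x)"
    using binary_form_scaleC[OF S, of "- 1"] by simp
  show "form_map (N + 1) \<tau>" "form_map (N + 1) \<sigma>"
    unfolding \<tau>_def \<sigma>_def by (intro form_map_cremona_map Q R S S')+
qed

lemma \<tau>_emb: "\<tau> (emb fr' x z) = emb fr (dil (Q x) x) (R x * z + S x)"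
  unfolding \<tau>_def by (rule cremona_map_emb[OF fr'])

lemma \<sigma>_emb: "\<sigma> (emb fr x z) = emb fr' (dil (R x) x) (Q x * z - S x)"
  unfolding \<sigma>_def by (subst cremona_map_emb[OF fr]) simp

text \<open>The scalar by which \<open>\<tau> \<circ> \<sigma>\<close> multiplies \<open>v\<close>;
  \<open>\<kappa>'\<close> belongs to \<open>\<sigma> \<circ> \<tau>\<close>. Each is nonzero
  exactly off the lines, in the plane concerned.\<close>

definition \<kappa> :: "complex ^ 3 \<Rightarrow> complex" where
  "\<kappa> v = R (xcoord fr v) ^ (N + 1) * Q (xcoord fr v)"

definition \<kappa>' :: "complex ^ 3 \<Rightarrow> complex" where
  "\<kappa>' v = Q (xcoord fr' v) ^ (N + 1) * R (xcoord fr' v)"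

lemma \<tau>_\<sigma>: "\<tau> (\<sigma> v) = \<kappa> v *s v"
  unfolding \<tau>_def \<sigma>_def \<kappa>_def by (rule cremona_map_inverse[OF fr fr' Q R S])

lemma \<sigma>_\<tau>: "\<sigma> (\<tau> v) = \<kappa>' v *s v"
proof -
  have "binary_form (N + 1) (\<lambda>x. - S x)" using binary_form_scaleC[OF S, of "- 1"] by simp
  from cremona_map_inverse[OF fr' fr R Q this] show ?thesis
    unfolding \<tau>_def \<sigma>_def \<kappa>'_def by simp
qed

lemma ternary_form_\<kappa>: "ternary_form ((N + 1) * N + N) \<kappa>" and ternary_form_\<kappa>': "ternary_form ((N + 1) * N + N) \<kappa>'"
proof -
  have *: "ternary_form N (\<lambda>v. q (xcoord f v))" if "binary_form N q" for q f
    using binary_form_compose_ternary[OF that ternary_form_coords(1)[of f] ternary_form_coords(2)[of f]] by simp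
  show "ternary_form ((N + 1) * N + N) \<kappa>" "ternary_form ((N + 1) * N + N) \<kappa>'"
    unfolding \<kappa>_def[abs_def] \<kappa>'_def[abs_def] by (intro ternary_form_mult ternary_form_power * Q R)+
qed

lemma G: "ternary_form (d * (N + 1)) G"
  unfolding G_def by (rule ternary_form_compose[OF F(1)]) (use form_map_\<tau> in \<open>auto simp: form_map_def\<close>)

lemma G_\<sigma>: "G (\<sigma> v) = \<kappa> v ^ d * F v"
  unfolding G_def \<tau>_\<sigma> by (rule ternary_form_scale[OF F(1)])

text \<open>The free factor \<open>q\<close> will be \<open>Q\<close> near a zero of
  \<open>Q\<close>, and \<open>s * Q\<close> in a chart of the blow-up of the vertex. As
  \<open>q\<close> and \<open>w\<close> are quantified under \<open>eventually\<close>, only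
  \<open>u\<close> has to be small.\<close>

definition branch_family :: "p1_coord \<Rightarrow> p1_coord \<Rightarrow> (nat \<Rightarrow> complex \<Rightarrow> complex) \<Rightarrow> bool" where
  "branch_family a a' \<rho> \<longleftrightarrow> (\<forall>i<d. \<rho> i analytic_on {0}) \<and> (\<forall>i<d. \<forall>j<d. \<rho> i 0 = \<rho> j 0 \<longrightarrow> i = j) \<and>
     (\<forall>\<^sub>F u in nhds 0. (\<forall>i<d. \<forall>j<d. \<rho> i u = \<rho> j u \<longrightarrow> i = j) \<and>
       (\<forall>q w. F (emb fr (q * (fst a + u * fst a'), q * (snd a + u * snd a')) w) =
          F (vertex fr) * (\<Prod>i<d. w - q * \<rho> i u)))"

lemma branch_familyD:
  assumes "branch_family a a' \<rho>"
  shows "\<And>i. i < d \<Longrightarrow> \<rho> i analytic_on {0}" "\<And>i j. i < d \<Longrightarrow> j < d \<Longrightarrow> \<rho> i 0 = \<rho> j 0 \<Longrightarrow> i = j"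
    "\<forall>\<^sub>F u in nhds 0. (\<forall>i<d. \<forall>j<d. \<rho> i u = \<rho> j u \<longrightarrow> i = j) \<and>
       (\<forall>q w. F (emb fr (q * (fst a + u * fst a'), q * (snd a + u * snd a')) w) =
          F (vertex fr) * (\<Prod>i<d. w - q * \<rho> i u))"
  using assms unfolding branch_family_def by blast+

lemma branch_family_exists:
  assumes "a \<noteq> 0" "meets_transversally F (vertex fr) (direction fr a)"
  obtains \<rho> where "branch_family a a' \<rho>"
proof -
  obtain \<rho> where \<rho>: "\<forall>i<d. \<rho> i analytic_on {0}" "\<forall>i<d. \<forall>j<d. \<rho> i 0 = \<rho> j 0 \<longrightarrow> i = j"
    "\<forall>\<^sub>F u in nhds 0. (\<forall>i<d. \<forall>j<d. \<rho> i u = \<rho> j u \<longrightarrow> i = j) \<and>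
      (\<forall>z. F (emb fr (line_at a a' u) z) = F (vertex fr) * (\<Prod>i<d. z - \<rho> i u))"
    using transversal_line_branches[OF F(1) fr vertex_nonzero assms, of a'] by blast
  have "branch_family a a' \<rho>"
    unfolding branch_family_def
  proof (intro conjI \<rho>(1,2), use \<rho>(3) in eventually_elim)
    case (elim u)
    then show ?case
      using form_at_dilated_branches[OF F(1), of fr "line_at a a' u" "\<lambda>i. \<rho> i u"] by simp
  qed
  then show thesis by (rule that)
qed

lemma point_q_tacnode:
  assumes k: "k < length qs"
  shows "tacnode_at d (ns ! k - 1) G (ppt (emb fr' (qs ! k) (- S (qs ! k) / R (qs ! k)))) \<and>
    has_type G (ppt (emb fr' (qs ! k) (- S (qs ! k) / R (qs ! k)))) (rep_type d (ns ! k))"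
proof -
  define a where "a = qs ! k"
  have a: "a \<noteq> 0" "meets_transversally F (vertex fr) (direction fr a)" using line_q[OF k] by (auto simp: a_def)
  obtain a' where a': "lin a a' \<noteq> 0" using exists_lin_neq_0[OF a(1)] by blast
  define X where "X = (\<lambda>u. line_at a a' u)"
  have X0: "X 0 = a" by (simp add: X_def)
  obtain n where n: "ns ! k = Suc n"
    using pos(1) nth_mem[of k ns] k lengths by (cases "ns ! k") auto
  obtain e m where e: "binary_form m e" "\<And>x. Q x = lin a x ^ Suc n * e x" "e a \<noteq> 0"
    using line_prod_factor[of k qs ns] k lin_qq n unfolding Q_def a_def by metis
  have "Q a = 0" unfolding e(2) by simp
  then have Ra: "R a \<noteq> 0" using QR_coprime[OF a(1)] by blast
  obtain \<rho> where "branch_family a a' \<rho>" using branch_family_exists[OF a] by blast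
  note \<rho> = branch_familyD[OF this]
  have an: "(\<lambda>u. q (X u)) analytic_on {0}" if "binary_form m q" for q m
    unfolding X_def by (rule binary_form_analytic[OF that])
  \<comment> \<open>The branch \<open>Q * \<rho> i\<close> divided by \<open>u ^ Suc n\<close>. The
    order of vanishing of \<open>Q\<close> is exactly \<open>Suc n\<close>, since
    \<open>e a \<noteq> 0\<close>; so the values at 0 remain distinct.\<close>
  define \<epsilon> where "\<epsilon> = (\<lambda>i u. lin a a' ^ Suc n * e (X u) * \<rho> i u)"
  have \<epsilon>: "\<epsilon> i analytic_on {0}" if "i < d" for i
    unfolding \<epsilon>_def by (intro analytic_intros an[OF e(1)] \<rho> that)
  have inj: "i = j" if "i < d" "j < d" "\<epsilon> i 0 = \<epsilon> j 0" for i j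
    using that \<rho>(2)[OF that(1,2)] a' e(3) by (simp add: \<epsilon>_def X0)
  have QX: "Q (X u) = u ^ Suc n * (lin a a' ^ Suc n * e (X u))" for u
    unfolding e(2) by (simp add: X_def lin_line power_mult_distrib)
  \<comment> \<open>Solves \<open>R * z + S = w\<close> for \<open>z\<close>: the second local
    coordinate is \<open>w\<close>, and \<open>w = 0\<close> is the new point of the line.\<close>
  define f where "f = (\<lambda>x :: complex \<times> complex. (snd x - S (X (fst x))) / R (X (fst x)))"
  define \<psi> where "\<psi> = (\<lambda>x. emb fr' (line_at a a' (fst x)) (f x))"
  have holo: "holo2 (\<lambda>x. q (X (fst x)))" if "binary_form m q" for q m
    by (rule holo2_analytic[OF holo2_fst]) (simp add: an[OF that])
  have hf: "holo2 f" unfolding f_def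
    by (intro holo2_divide holo2_diff holo2_snd holo[OF S] holo[OF R]) (simp add: X0 Ra)
  then obtain \<alpha> \<beta> where fder: "(f has_derivative (\<lambda>(h, k). \<alpha> * h + \<beta> * k)) (at 0)"
    using holo2_at_0 unfolding cdiff2_def by blast
  have "\<beta> \<noteq> 0"
  proof -
    have "((\<lambda>u. (0, u)) has_derivative (\<lambda>u. (0 :: complex, u))) (at (0 :: complex))"
      by (intro has_derivative_Pair has_derivative_const has_derivative_ident)
    from has_derivative_compose[OF this, of f "\<lambda>(h, k). \<alpha> * h + \<beta> * k"] fder
    have "((\<lambda>u. f (0, u)) has_derivative (\<lambda>u. \<beta> * u)) (at 0)" by (simp add: zero_prod_def)
    moreover have "((\<lambda>u. f (0, u)) has_derivative (\<lambda>u. 1 / R a * u)) (at 0)"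
      unfolding f_def using X0 Ra
      by (intro has_field_derivative_imp_has_derivative) (auto intro!: derivative_eq_intros)
    ultimately have "(\<lambda>u. \<beta> * u) = (\<lambda>u. 1 / R a * u)" by (rule has_derivative_unique)
    from fun_cong[OF this, of 1] show ?thesis using Ra by simp
  qed
  have f0: "f 0 = - S a / R a" by (simp add: f_def X0)
  have lc: "local_coords \<psi> (ppt (emb fr' a (- S a / R a)))"
    using local_coords_emb[OF fr' hf fder \<open>\<beta> \<noteq> 0\<close> a'] unfolding \<psi>_def f0 .
  have "\<forall>\<^sub>F u in nhds 0. R (X u) \<in> - {0}"
    by (rule eventually_nhds_compose[OF eventually_nhds_in_open])
       (use Ra an[OF R] in \<open>auto simp: X0 intro: analytic_at_imp_isCont\<close>)
  from eventually_nhds_fst[OF this] eventually_nhds_fst[OF \<rho>(3)]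
  have ev: "\<forall>\<^sub>F x in nhds 0. (G \<circ> \<psi>) x = F (vertex fr) * (\<Prod>i<d. snd x - fst x ^ Suc n * \<epsilon> i (fst x))"
  proof eventually_elim
    case (elim x)
    have "\<psi> x = emb fr' (X (fst x)) (f x)" by (simp add: \<psi>_def X_def)
    then have "\<tau> (\<psi> x) = emb fr (dil (Q (X (fst x))) (X (fst x))) (snd x)"
      using elim(1) by (simp add: \<tau>_emb f_def)
    then have "G (\<psi> x) = F (vertex fr) * (\<Prod>i<d. snd x - Q (X (fst x)) * \<rho> i (fst x))"
      using elim(2) by (simp add: G_def X_def)
    then show ?case by (simp add: QX \<epsilon>_def mult_ac)
  qed
  have "germ_tacnode d n (G \<circ> \<psi>)"
    by (rule germ_tacnodeI[OF coord_change_id, where U = "\<lambda>_. F (vertex fr)" and \<epsilon> = \<epsilon>])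
       (use vertex_nonzero \<epsilon> inj ev in auto)
  moreover have "germ_type (\<lambda>x. F (vertex fr) * (\<Prod>i<d. snd x - fst x ^ Suc n * \<epsilon> i (fst x))) (rep_type d (Suc n))"
    by (rule germ_type_tangent_branches[OF F(2)]) (use vertex_nonzero \<epsilon> inj in auto)
  then have "germ_type (G \<circ> \<psi>) (rep_type d (Suc n))"
    by (rule germ_type_cong) (use ev in \<open>auto elim: eventually_mono\<close>)
  ultimately show ?thesis
    using lc unfolding tacnode_at_def has_type_def n a_def[symmetric] by auto
qed

end

section \<open>The singular point at the centre\<close>

fun dir_point :: "complex option \<Rightarrow> p1_coord" where
  "dir_point None = (0, 1)"
| "dir_point (Some b) = (1, b)"

fun dir_tangent :: "complex option \<Rightarrow> p1_coord" where
  "dir_tangent None = (1, 0)"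
| "dir_tangent (Some b) = (0, 1)"

definition dir_of :: "p1_coord \<Rightarrow> complex option" where
  "dir_of p = (if fst p = 0 then None else Some (snd p / fst p))"

text \<open>The chart at \<theta> is \<open>s\<close> times this vector, so a form of degree
  \<open>n\<close> pulls back to \<open>s ^ n\<close> times its value on
  \<open>dir_line \<theta> u\<close>.\<close>

definition dir_line :: "complex option \<Rightarrow> complex \<Rightarrow> p1_coord" where
  "dir_line \<theta> u = line_at (dir_point \<theta>) (dir_tangent \<theta>) u"

lemma blow_chart_dir_line:
  "blow_chart \<theta> x = dil (fst x) (dir_line \<theta> (snd x))"
  by (cases \<theta>; cases x) (auto simp: dir_line_def)

lemma dir_point_nonzero: "dir_point \<theta> \<noteq> 0"
  by (cases \<theta>) (auto simp: zero_prod_def)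

lemma dir_line_0 [simp]: "dir_line \<theta> 0 = dir_point \<theta>"
  by (simp add: dir_line_def)

lemma dir_of_proportional:
  assumes "p \<noteq> 0"
  obtains c where "c \<noteq> 0" "p = dil c (dir_point (dir_of p))"
proof (cases "fst p = 0")
  case True
  then have "snd p \<noteq> 0" using assms by (cases p) (auto simp: zero_prod_def)
  then show ?thesis using True that[of "snd p"] by (cases p) (auto simp: dir_of_def)
next
  case False
  then show ?thesis using that[of "fst p"] by (cases p) (auto simp: dir_of_def)
qed

lemma dir_of_eqI:
  assumes "p \<noteq> 0" "lin p (dir_point \<theta>) = 0"
  shows "dir_of p = \<theta>"
proof (cases \<theta>)
  case None
  then show ?thesis using assms by (simp add: lin_def dir_of_def)
next
  case (Some b)
  then have *: "fst p * b = snd p" using assms by (simp add: lin_def)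
  then have "fst p \<noteq> 0" using assms(1) by (cases p) (auto simp: zero_prod_def)
  then show ?thesis using * Some by (simp add: dir_of_def field_simps)
qed

lemma lin_dir_of_self: "p \<noteq> 0 \<Longrightarrow> lin p (dir_point (dir_of p)) = 0"
  by (cases p) (auto simp: dir_of_def lin_def zero_prod_def)

lemma lin_dir_tangent: "p \<noteq> 0 \<Longrightarrow> lin p (dir_tangent (dir_of p)) \<noteq> 0"
  by (cases p) (auto simp: dir_of_def lin_def zero_prod_def)

lemma lin_eq_0_of_dir_of_eq:
  assumes "p \<noteq> 0" "p' \<noteq> 0" "dir_of p = dir_of p'"
  shows "lin p p' = 0"
proof -
  obtain c where "p' = dil c (dir_point (dir_of p))"
    using dir_of_proportional[OF assms(2)] assms(3) by metis
  then have "lin p p' = c * lin p (dir_point (dir_of p))" by (simp add: lin_def algebra_simps)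
  then show ?thesis using lin_dir_of_self[OF assms(1)] by simp
qed

lemma binary_form_zero_iff_proportional:
  assumes "binary_form n q" "c \<noteq> 0" "p = dil c x"
  shows "q p = 0 \<longleftrightarrow> q x = 0"
  using binary_form_scale[OF assms(1), of c x] assms(2,3) by simp

context cremona_curve
begin

definition centre_germ :: "complex option \<Rightarrow> complex \<times> complex \<Rightarrow> complex" where
  "centre_germ \<theta> x = (let X = dir_line \<theta> (snd x) in
     F (emb fr (dil (fst x * Q X) X) (R X + fst x * S X)))"

text \<open>At \<open>(s X, 1)\<close> the terms of \<tau> with \<open>Q\<close>, \<open>R\<close>
  and \<open>S\<close> have degree \<open>N + 1\<close>, \<open>N\<close> and \<open>N + 1\<close>
  in \<open>s\<close>. Taking out \<open>s ^ N\<close> leaves the arguments in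
  \<open>centre_germ\<close>, and the degree \<open>d\<close> of \<open>F\<close> gives the exponent
  \<open>d * N\<close>.\<close>

lemma G_centre_chart:
  "G (emb fr' (blow_chart \<theta> x) 1) = fst x ^ (d * N) * centre_germ \<theta> x"
proof -
  define X s where "X = dir_line \<theta> (snd x)" and "s = fst x"
  have "\<tau> (emb fr' (dil s X) 1) =
      s ^ N *s emb fr (dil (s * Q X) X) (R X + s * S X)"
    unfolding \<tau>_emb fst_conv snd_conv emb_scale binary_form_scale[OF Q] binary_form_scale[OF R]
      binary_form_scale[OF S] by (simp add: algebra_simps)
  then have "G (emb fr' (dil s X) 1) =
      (s ^ N) ^ d * F (emb fr (dil (s * Q X) X) (R X + s * S X))"
    unfolding G_def using ternary_form_scale[OF F(1)] by simp
  then show ?thesis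
    unfolding blow_chart_dir_line centre_germ_def Let_def X_def[symmetric] s_def[symmetric]
    by (simp add: power_mult[symmetric] mult.commute)
qed

lemma analytic_dir_line:
  assumes "binary_form m q"
  shows "(\<lambda>u. q (dir_line \<theta> u)) analytic_on {0}"
  unfolding dir_line_def by (rule binary_form_analytic[OF assms])

lemma holo2_centre_germ: "holo2 (centre_germ \<theta>)"
proof -
  have h: "holo2 (\<lambda>x. q (dir_line \<theta> (snd x)))" if "binary_form m q" for m q
    by (rule holo2_analytic[OF holo2_snd]) (simp add: analytic_dir_line[OF that])
  have "holo2 (\<lambda>x. F (emb fr (fst x * Q (dir_line \<theta> (snd x)) * fst (dir_line \<theta> (snd x)),
      fst x * Q (dir_line \<theta> (snd x)) * snd (dir_line \<theta> (snd x)))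
      (R (dir_line \<theta> (snd x)) + fst x * S (dir_line \<theta> (snd x)))))"
    by (rule holo2_ternary_form[OF F(1)], unfold emb_component fst_conv snd_conv)
       (intro holo2_add holo2_mult holo2_const holo2_fst h[OF Q] h[OF R] h[OF S]
          h[OF binary_form_fst] h[OF binary_form_snd])
  then show ?thesis by (simp add: centre_germ_def[abs_def] Let_def)
qed

text \<open>For \<open>s = 0\<close> only a multiple of the vertex is left, so the strict transform
  meets the exceptional curve just in the directions of the lines \<open>ps\<close>.\<close>

lemma centre_germ_0: "centre_germ \<theta> 0 = R (dir_point \<theta>) ^ d * F (vertex fr)"
  using ternary_form_scale[OF F(1), of "R (dir_point \<theta>)" "vertex fr"]
  by (simp add: centre_germ_def emb_def)

lemma local_coords_centre: "local_coords (\<lambda>x. emb fr' x 1) (ppt (vertex fr'))"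
proof -
  have "((\<lambda>x. emb fr' x 1) has_derivative (\<lambda>h. emb fr' h 0)) (at 0)"
    by (rule has_derivative_vec, unfold emb_component) (rule derivative_eq_intros refl | simp)+
  moreover have "det (vector [emb fr' 0 1, emb fr' (1, 0) 0, emb fr' (0, 1) 0] :: complex ^ 3 ^ 3) \<noteq> 0"
    unfolding det_vector_3_iff
  proof (intro allI impI)
    fix a b c assume "a *s emb fr' 0 1 + b *s emb fr' (1, 0) 0 + c *s emb fr' (0, 1) 0 = 0"
    then have "emb fr' (b, c) a = 0" by (simp add: vec_eq_iff emb_component algebra_simps)
    then show "a = 0 \<and> b = 0 \<and> c = 0" using emb_eq_0_iff[OF fr'] by (auto simp: zero_prod_def)
  qed
  moreover have "emb fr' 0 1 \<noteq> 0" using emb_eq_0_iff[OF fr', of 0 1] by simp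
  moreover have "emb fr' 0 1 = vertex fr'" by (simp add: emb_def zero_prod_def)
  moreover have "holo2 (\<lambda>x. emb fr' x 1 $ i)" for i
    unfolding emb_component by (intro holo2_add holo2_mult holo2_const holo2_fst holo2_snd)
  ultimately show ?thesis unfolding local_coords_def by auto
qed

lemma strict_transform_centre:
  "strict_transform (d * N) (G \<circ> (\<lambda>x. emb fr' x 1)) \<theta> (centre_germ \<theta>)"
  unfolding strict_transform_def using holo2_centre_germ G_centre_chart by simp

lemma has_mult_centre: "has_mult (G \<circ> (\<lambda>x. emb fr' x 1)) (d * N)"
proof -
  have v: "vanishes_to_order (n * 1) q" if "binary_form n q" for n q
    using vanishes_to_order_binary_form[OF that vanishes_to_order_1[OF holo2_fst] vanishes_to_order_1[OF holo2_snd]]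
    by simp
  have c: "isCont (\<lambda>x :: complex \<times> complex. fst x * k) 0" "isCont (\<lambda>x :: complex \<times> complex. snd x * k) 0" for k
    by (intro continuous_intros)+
  have vQ: "vanishes_to_order N (\<lambda>x. Q x * (fst x * k))" "vanishes_to_order N (\<lambda>x. Q x * (snd x * k))" for k
    using vanishes_to_order_mult[OF v[OF Q] vanishes_to_order_0[OF c(1)]]
      vanishes_to_order_mult[OF v[OF Q] vanishes_to_order_0[OF c(2)]] by simp_all
  have vRS: "vanishes_to_order N (\<lambda>x. R x + S x)"
    using v[OF R] v[OF S] by (intro vanishes_to_order_add) (auto intro: vanishes_to_order_mono)
  have "vanishes_to_order N (\<lambda>x. \<tau> (emb fr' x 1) $ i)" for i
  proof -
    have "vanishes_to_order N (\<lambda>x. (R x + S x) * vertex fr $ i)"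
      using vanishes_to_order_mult[OF vRS vanishes_to_order_const] by simp
    then have "vanishes_to_order N (\<lambda>x. Q x * (fst x * direction fr (1, 0) $ i) +
        Q x * (snd x * direction fr (0, 1) $ i) + (R x + S x) * vertex fr $ i)"
      by (intro vanishes_to_order_add vQ)
    then show ?thesis unfolding \<tau>_emb emb_component by (simp add: mult.assoc)
  qed
  then have "vanishes_to_order (d * N) (G \<circ> (\<lambda>x. emb fr' x 1))"
    unfolding G_def comp_def by (rule vanishes_to_order_ternary_form[OF F(1)])
  moreover have "\<not> vanishes_to_order (Suc (d * N)) (G \<circ> (\<lambda>x. emb fr' x 1))"
  proof -
    \<comment> \<open>A direction that is not tangent to the curve at the vertex is needed; that of
      the first line of \<open>qs\<close> will do, since \<open>R\<close> does not vanish
      there.\<close>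
    have len: "0 < length qs" using nonempty lengths by simp
    define \<theta> where "\<theta> = dir_of (qs ! 0)"
    obtain k where k: "k \<noteq> 0" "qs ! 0 = dil k (dir_point \<theta>)"
      unfolding \<theta>_def using dir_of_proportional line_q[OF len] by blast
    have "Q (qs ! 0) = 0" unfolding Q_eq_0_iff using len by (intro exI[of _ 0]) simp
    then have "R (qs ! 0) \<noteq> 0" using QR_coprime line_q[OF len] by blast
    then have "R (dir_point \<theta>) \<noteq> 0" using binary_form_zero_iff_proportional[OF R k] by blast
    then have nz: "centre_germ \<theta> 0 \<noteq> 0" using vertex_nonzero by (simp add: centre_germ_0)
    show ?thesis
      by (rule not_vanishes_to_Suc_order[where \<theta> = \<theta> and g = "centre_germ \<theta>"])
         (use G_centre_chart nz holo2_isCont[OF holo2_centre_germ] in auto)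
  qed
  ultimately show ?thesis unfolding has_mult_def by simp
qed

lemma centre_germ_on_line:
  assumes j: "j < length ps"
  defines "\<theta> \<equiv> dir_of (ps ! j)"
  shows "germ_tacnode d (ms ! j - 1) (centre_germ \<theta>) \<and> germ_type (centre_germ \<theta>) (rep_type d (ms ! j))"
proof -
  define p a a' X where "p = ps ! j" and "a = dir_point \<theta>" and "a' = dir_tangent \<theta>" and "X = dir_line \<theta>"
  have p: "p \<noteq> 0" "meets_transversally F (vertex fr) (direction fr p)" using line_p[OF j] by (auto simp: p_def)
  \<comment> \<open>The chart normalises the direction to \<open>a\<close>, while the line is given
    by \<open>p\<close>; transversality does not depend on the representative.\<close>
  obtain c where c: "c \<noteq> 0" "p = dil c a"
    using dir_of_proportional[OF p(1)] unfolding a_def \<theta>_def p_def by metis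
  have a0: "a \<noteq> 0" by (simp add: a_def dir_point_nonzero)
  have "direction fr a = (1 / c) *s direction fr p"
    using c direction_scale[of fr c a] by (simp add: vector_smult_assoc)
  then have a: "meets_transversally F (vertex fr) (direction fr a)"
    using meets_transversally_scale[OF _ p(2), of "1 / c"] c(1) by simp
  have X_eq: "X u = line_at a a' u" for u
    by (simp add: X_def dir_line_def a_def a'_def)
  have X0: "X 0 = a" by (simp add: X_eq)
  obtain m where m: "ms ! j = Suc m"
    using pos(2) nth_mem[of j ms] j lengths by (cases "ms ! j") auto
  obtain e k where e: "binary_form k e" "\<And>x. R x = lin p x ^ Suc m * e x" "e p \<noteq> 0"
    using line_prod_factor[of j ps ms] j lin_pp m unfolding R_def p_def by metis
  have ea: "e a \<noteq> 0" using binary_form_zero_iff_proportional[OF e(1) c] e(3) by blast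
  have linpa: "lin p a = 0" "lin p a' \<noteq> 0"
    using lin_dir_of_self[OF p(1)] lin_dir_tangent[OF p(1)] by (simp_all add: a_def a'_def \<theta>_def p_def)
  have Ra: "R a = 0" using e(2) linpa by simp
  have Qa: "Q a \<noteq> 0" using QR_coprime[OF a0] Ra by blast
  obtain \<rho> where "branch_family a a' \<rho>" using branch_family_exists[OF a0 a] by blast
  note \<rho> = branch_familyD[OF this]
  \<comment> \<open>\<open>R\<close> along the chart divided by \<open>u ^ Suc m\<close>, nonzero at
    0 because the other lines of \<open>ps\<close> have other directions.\<close>
  define r where "r = (\<lambda>u. lin p a' ^ Suc m * e (X u))"
  \<comment> \<open>The equation \<open>R + s * S = s * Q * \<rho> i\<close> of a branch reads
    \<open>R = s * \<delta> i\<close>.\<close>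
  define \<delta> where "\<delta> = (\<lambda>i u. Q (X u) * \<rho> i u - S (X u))"
  define \<epsilon> where "\<epsilon> = (\<lambda>i u. r u / \<delta> i u)"
  define U where "U = (\<lambda>u. F (vertex fr) * (\<Prod>i<d. - \<delta> i u))"
  have an: "(\<lambda>u. q (X u)) analytic_on {0}" if "binary_form m q" for q m
    unfolding X_def by (rule analytic_dir_line[OF that])
  have r: "r analytic_on {0}" unfolding r_def by (intro analytic_intros an[OF e(1)])
  have \<delta>: "\<delta> i analytic_on {0}" if "i < d" for i
    unfolding \<delta>_def by (intro analytic_intros an[OF Q] an[OF S] \<rho> that)
  have Sa: "F (emb fr (dil (Q a) a) (S a)) = F (vertex fr) * (\<Prod>i<d. S a - Q a * \<rho> i 0)"
    using eventually_nhds_x_imp_x[OF \<rho>(3)] by simp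
  \<comment> \<open>This is where the centres of the second type enter: \<open>S_nonzero\<close> at
    \<open>a\<close> says that no factor \<open>S a - Q a * \<rho> i 0\<close> vanishes.\<close>
  have \<delta>0: "\<delta> i 0 \<noteq> 0" if "i < d" for i
  proof -
    have "(\<Prod>i<d. S a - Q a * \<rho> i 0) \<noteq> 0" using S_nonzero[OF a0 Ra] Sa by simp
    then have "S a - Q a * \<rho> i 0 \<noteq> 0" using that by (auto simp del: right_minus_eq)
    then show ?thesis by (simp add: \<delta>_def X0)
  qed
  have \<epsilon>: "\<epsilon> i analytic_on {0}" if "i < d" for i
    unfolding \<epsilon>_def using \<delta>0[OF that] by (intro analytic_on_divide r \<delta> that) auto
  have r0: "r 0 \<noteq> 0" using linpa ea by (simp add: r_def X0)
  have inj: "i = j" if "i < d" "j < d" "\<epsilon> i 0 = \<epsilon> j 0" for i j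
  proof -
    have "\<delta> i 0 = \<delta> j 0" using that(3) r0 \<delta>0 that(1,2) by (simp add: \<epsilon>_def field_simps)
    then have "\<rho> i 0 = \<rho> j 0" using Qa by (simp add: \<delta>_def X0)
    then show ?thesis using \<rho>(2) that by blast
  qed
  have RX: "R (X u) = u ^ Suc m * r u" for u
    unfolding e(2) X_eq lin_line linpa r_def by (simp add: power_mult_distrib X_eq)
  have "\<forall>\<^sub>F u in nhds 0. \<delta> i u \<in> - {0}" if "i < d" for i
    by (rule eventually_nhds_compose[OF eventually_nhds_in_open])
       (use \<delta>0[OF that] \<delta>[OF that] in \<open>auto intro: analytic_at_imp_isCont\<close>)
  then have "\<forall>\<^sub>F u in nhds 0. \<forall>i\<in>{..<d}. \<delta> i u \<in> - {0}" by (intro eventually_ball_finite ballI) auto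
  with \<rho>(3) have ev: "\<forall>\<^sub>F u in nhds 0. \<forall>s. centre_germ \<theta> (s, u) = U u * (\<Prod>i<d. s - u ^ Suc m * \<epsilon> i u)"
  proof eventually_elim
    case (elim u)
    show ?case
    proof
      fix s
      have "centre_germ \<theta> (s, u) = F (emb fr (dil (s * Q (X u)) (X u)) (R (X u) + s * S (X u)))"
        by (simp add: centre_germ_def Let_def X_def)
      also have "\<dots> = F (vertex fr) * (\<Prod>i<d. R (X u) + s * S (X u) - s * Q (X u) * \<rho> i u)"
        using elim(1)[THEN conjunct2, rule_format, of "s * Q (X u)" "R (X u) + s * S (X u)"] by (simp add: X_eq)
      also have "(\<Prod>i<d. R (X u) + s * S (X u) - s * Q (X u) * \<rho> i u) =
          (\<Prod>i<d. - \<delta> i u * (s - u ^ Suc m * \<epsilon> i u))"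
      proof (intro prod.cong refl)
        fix i assume "i \<in> {..<d}"
        then have nz: "\<delta> i u \<noteq> 0" using elim(2) by auto
        have "R (X u) + s * S (X u) - s * Q (X u) * \<rho> i u = R (X u) - s * \<delta> i u"
          by (simp add: \<delta>_def algebra_simps)
        also have "\<dots> = - \<delta> i u * (s - u ^ Suc m * \<epsilon> i u)"
          unfolding RX \<epsilon>_def using nz by (simp add: field_simps)
        finally show "R (X u) + s * S (X u) - s * Q (X u) * \<rho> i u = - \<delta> i u * (s - u ^ Suc m * \<epsilon> i u)" .
      qed
      also have "(\<Prod>i<d. - \<delta> i u * (s - u ^ Suc m * \<epsilon> i u)) = (\<Prod>i<d. - \<delta> i u) * (\<Prod>i<d. s - u ^ Suc m * \<epsilon> i u)"
        by (rule prod.distrib)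
      finally show "centre_germ \<theta> (s, u) = U u * (\<Prod>i<d. s - u ^ Suc m * \<epsilon> i u)"
        by (simp only: U_def mult.assoc)
    qed
  qed
  have Uan: "U analytic_on {0}"
    unfolding U_def by (intro analytic_intros \<delta>) auto
  have U0: "U 0 \<noteq> 0" using vertex_nonzero \<delta>0 by (simp add: U_def)
  have hU: "holo2 (\<lambda>x. U (fst x))" "holo2 (\<lambda>x. U (snd x))"
    by (rule holo2_analytic[OF holo2_fst], simp add: Uan, rule holo2_analytic[OF holo2_snd], simp add: Uan)
  \<comment> \<open>The branches are graphs over \<open>u\<close>, the second coordinate, whereas
    \<open>germ_tacnode\<close> describes graphs over the first; hence the swap.\<close>
  have "germ_tacnode d m (centre_germ \<theta>)"
  proof (rule germ_tacnodeI[OF coord_change_swap hU(1)])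
    show "\<forall>\<^sub>F x in nhds 0. centre_germ \<theta> (prod.swap x) = U (fst x) * (\<Prod>i<d. snd x - fst x ^ Suc m * \<epsilon> i (fst x))"
      using eventually_nhds_fst[OF ev] by eventually_elim (simp add: prod.swap_def)
  qed (use U0 \<epsilon> inj in auto)
  moreover have "germ_type (\<lambda>x. U (snd x) * (\<Prod>i<d. fst x - snd x ^ Suc m * \<epsilon> i (snd x))) (rep_type d (Suc m))"
    by (rule germ_type_tangent_branches_swap[OF F(2) hU(2)]) (use U0 \<epsilon> inj in auto)
  then have "germ_type (centre_germ \<theta>) (rep_type d (Suc m))"
  proof (rule germ_type_cong)
    show "\<forall>\<^sub>F x in nhds 0. U (snd x) * (\<Prod>i<d. fst x - snd x ^ Suc m * \<epsilon> i (snd x)) = centre_germ \<theta> x"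
      using eventually_nhds_snd[OF ev]
    proof eventually_elim
      case (elim x)
      from spec[OF elim, of "fst x"] show ?case by simp
    qed
  qed
  ultimately show ?thesis by (simp add: m)
qed

lemma centre_singularity:
  "blow_down_of_tacnodes d (map (\<lambda>m. m - 1) ms) G (ppt (vertex fr'))"
  "has_type G (ppt (vertex fr')) (Sing (d * N) (map (rep_type d) ms))"
proof -
  define dirs where "dirs = map dir_of ps"
  have dist: "distinct dirs"
    unfolding dirs_def distinct_conv_nth
  proof (intro allI impI)
    fix i j assume "i < length (map dir_of ps)" "j < length (map dir_of ps)" "i \<noteq> j"
    then show "map dir_of ps ! i \<noteq> map dir_of ps ! j"
      using lin_eq_0_of_dir_of_eq[of "ps ! i" "ps ! j"] line_p[of i] line_p[of j] lin_pp[of i j] by auto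
  qed
  have off: "centre_germ \<theta> 0 \<noteq> 0" if "\<theta> \<notin> set dirs" for \<theta>
  proof
    assume "centre_germ \<theta> 0 = 0"
    then have "R (dir_point \<theta>) = 0" using vertex_nonzero by (simp add: centre_germ_0)
    then obtain j where j: "j < length ps" "lin (ps ! j) (dir_point \<theta>) = 0" unfolding R_eq_0_iff by blast
    then have "dir_of (ps ! j) = \<theta>" using dir_of_eqI line_p by blast
    then show False using that j(1) by (auto simp: dirs_def)
  qed
  show "blow_down_of_tacnodes d (map (\<lambda>m. m - 1) ms) G (ppt (vertex fr'))"
    unfolding blow_down_of_tacnodes_def
  proof (rule exI[of _ "\<lambda>x. emb fr' x 1"], rule exI[of _ "d * N"], rule exI[of _ centre_germ],
      rule exI[of _ dirs], intro conjI allI impI)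
    show "list_all2 (\<lambda>\<theta> k. germ_tacnode d k (centre_germ \<theta>)) dirs (map (\<lambda>m. m - 1) ms)"
      using centre_germ_on_line lengths by (auto simp: list_all2_conv_all_nth dirs_def)
  qed (use local_coords_centre has_mult_centre strict_transform_centre dist off in auto)
  have "germ_type (G \<circ> (\<lambda>x. emb fr' x 1)) (Sing (d * N) (map (rep_type d) ms))"
  proof (rule germ_type.intros[where g = centre_germ and dirs = dirs])
    show "d * N > 1" using mult_le_mono[OF F(2) N_pos] by simp
    show "list_all2 (\<lambda>\<theta>. germ_type (centre_germ \<theta>)) dirs (map (rep_type d) ms)"
      using centre_germ_on_line lengths by (auto simp: list_all2_conv_all_nth dirs_def)
  qed (use has_mult_centre strict_transform_centre dist off in \<open>auto simp: germ_singular_def\<close>)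
  then show "has_type G (ppt (vertex fr')) (Sing (d * N) (map (rep_type d) ms))"
    unfolding has_type_def using local_coords_centre by blast
qed


section \<open>The remaining singular points\<close>

lemma sing_at_off_lines:
  assumes "sing_at F v" "v \<noteq> 0"
  shows "xcoord fr v \<noteq> 0 \<and> Q (xcoord fr v) \<noteq> 0 \<and> R (xcoord fr v) \<noteq> 0"
proof -
  define x z where "x = xcoord fr v" and "z = zcoord fr v"
  have v: "v = emb fr x z" using fr by (simp add: x_def z_def)
  have x0: "x \<noteq> 0"
  proof
    assume "x = 0"
    then have v': "v = z *s vertex fr" using v by (simp add: emb_def zero_prod_def)
    then have "z \<noteq> 0" using assms(2) by auto
    then have "F v \<noteq> 0" unfolding v' ternary_form_scale[OF F(1)] using vertex_nonzero by simp
    then show False using assms(1) by (simp add: sing_at_def)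
  qed
  have off: "lin a x \<noteq> 0" if a: "a \<noteq> 0 \<and> meets_transversally F (vertex fr) (direction fr a)" for a
  proof
    assume "lin a x = 0"
    then obtain c where "x = dil c a" using lin_eq_0_iff[OF _ x0] a by blast
    then have "v = z *s vertex fr + c *s direction fr a"
      unfolding v emb_def by (simp add: direction_scale add.commute)
    then show False using transversal_not_sing_at a assms by metis
  qed
  have "Q x \<noteq> 0" "R x \<noteq> 0" unfolding Q_eq_0_iff R_eq_0_iff using off line_q line_p by blast+
  then show ?thesis using x0 by (simp add: x_def)
qed

section \<open>Correspondence of singular points off the lines\<close>

lemma \<kappa>_nonzero_iff: "\<kappa> v \<noteq> 0 \<longleftrightarrow> Q (xcoord fr v) \<noteq> 0 \<and> R (xcoord fr v) \<noteq> 0"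
  and \<kappa>'_nonzero_iff: "\<kappa>' v \<noteq> 0 \<longleftrightarrow> Q (xcoord fr' v) \<noteq> 0 \<and> R (xcoord fr' v) \<noteq> 0"
  by (auto simp: \<kappa>_def \<kappa>'_def)

lemma xcoord_\<sigma>: "xcoord fr' (\<sigma> v) = dil (R (xcoord fr v)) (xcoord fr v)"
  unfolding \<sigma>_def cremona_map_def Let_def using fr' by simp

lemma xcoord_\<tau>: "xcoord fr (\<tau> v) = dil (Q (xcoord fr' v)) (xcoord fr' v)"
  unfolding \<tau>_def cremona_map_def Let_def using fr by simp

lemma sing_at_G_\<sigma>_iff:
  assumes "\<kappa> v \<noteq> 0"
  shows "sing_at G (\<sigma> v) \<longleftrightarrow> sing_at F v"
proof
  assume "sing_at G (\<sigma> v)"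
  from sing_at_compose[OF form_map_\<sigma> this] have "sing_at (\<lambda>v. \<kappa> v ^ d * F v) v" by (simp add: G_\<sigma>)
  then show "sing_at F v"
    using assms by (intro sing_at_mult_cancel[OF F(1) ternary_form_power[OF ternary_form_\<kappa>]]) auto
next
  assume "sing_at F v"
  then have "sing_at F (\<tau> (\<sigma> v))" unfolding \<tau>_\<sigma> by (rule sing_at_scale[OF F(1) assms])
  then show "sing_at G (\<sigma> v)" unfolding G_def by (rule sing_at_compose[OF form_map_\<tau>])
qed

lemma sing_at_F_\<tau>:
  assumes "sing_at G w" "\<kappa>' w \<noteq> 0"
  shows "sing_at F (\<tau> w)"
proof -
  have "\<kappa> (\<tau> w) \<noteq> 0"
    unfolding \<kappa>_nonzero_iff xcoord_\<tau>
    using assms(2) binary_form_scale[OF Q] binary_form_scale[OF R] by (simp add: \<kappa>'_nonzero_iff)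
  moreover have "sing_at G (\<sigma> (\<tau> w))" unfolding \<sigma>_\<tau> by (rule sing_at_scale[OF G assms(2,1)])
  ultimately show ?thesis using sing_at_G_\<sigma>_iff by blast
qed

definition new_point :: "nat \<Rightarrow> complex ^ 3" where
  "new_point i = emb fr' (qs ! i) (- S (qs ! i) / R (qs ! i))"

lemma Q_at_line: "i < length qs \<Longrightarrow> Q (qs ! i) = 0"
  unfolding Q_eq_0_iff by (intro exI[of _ i]) simp

lemma R_at_line: "i < length qs \<Longrightarrow> R (qs ! i) \<noteq> 0"
  using QR_coprime Q_at_line line_q by blast

lemma \<tau>_new_point: "i < length qs \<Longrightarrow> \<tau> (new_point i) = 0"
  unfolding new_point_def \<tau>_emb using Q_at_line R_at_line by simp

lemma new_point_nonzero: "i < length qs \<Longrightarrow> new_point i \<noteq> 0"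
  unfolding new_point_def using emb_eq_0_iff[OF fr'] line_q by blast

lemma vertex_eq_emb: "vertex f = emb f (0, 0) 1"
  by (simp add: emb_def)

lemma vertex'_nonzero: "vertex fr' \<noteq> 0"
  unfolding vertex_eq_emb using emb_eq_0_iff[OF fr'] by simp

lemma sing_at_new:
  "i < length qs \<Longrightarrow> sing_at G (new_point i)" "sing_at G (vertex fr')"
proof -
  show "sing_at G (vertex fr')"
    unfolding G_def by (rule sing_at_compose[OF form_map_\<tau>])
      (simp add: vertex_eq_emb[of fr'] \<tau>_emb Q_0 R_0 S_0 sing_at_0[OF F])
  show "i < length qs \<Longrightarrow> sing_at G (new_point i)"
    unfolding G_def by (rule sing_at_compose[OF form_map_\<tau>]) (simp add: \<tau>_new_point sing_at_0[OF F])
qed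

definition new_points :: "p2_point set" where
  "new_points = set (ppt (vertex fr') # map (\<lambda>i. ppt (new_point i)) [0..<length qs])"

lemma new_points_D:
  assumes "ppt w \<in> new_points"
  shows "xcoord fr' w = 0 \<or> Q (xcoord fr' w) = 0"
proof -
  consider "ppt (vertex fr') = ppt w" | i where "i < length qs" "ppt (new_point i) = ppt w"
    using assms unfolding new_points_def by force
  then show ?thesis
  proof cases
    case 1
    from ppt_eqD[OF this] obtain c where "w = c *s vertex fr'" by blast
    then show ?thesis using fr' by (simp add: xcoord_scale vertex_eq_emb zero_prod_def)
  next
    case 2
    from ppt_eqD[OF 2(2)] obtain c where "w = c *s new_point i" by blast
    then show ?thesis
      using fr' binary_form_scale[OF Q] Q_at_line[OF 2(1)] by (simp add: xcoord_scale new_point_def)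
  qed
qed

text \<open>Where \<open>R x = 0\<close> the value does not depend on \<open>z\<close> and
  \<open>S_nonzero\<close> applies. Elsewhere \<open>R x * z + S x\<close> takes all values, and
  \<open>F\<close> restricted to the corresponding line has leading coefficient
  \<open>F (vertex fr)\<close>. The purpose is to exclude lines through the vertex as components of
  \<open>G = 0\<close>.\<close>

lemma ex_G_nonzero_on_line:
  assumes "x \<noteq> 0"
  shows "\<exists>z. G (emb fr' x z) \<noteq> 0"
proof (cases "R x = 0")
  case True
  then show ?thesis using S_nonzero[OF assms] by (auto simp: G_def \<tau>_emb)
next
  case False
  obtain p where p: "degree p \<le> d" "coeff p d = F (vertex fr)"
      "\<And>t. poly p t = F (emb fr (dil (Q x) x) 0 + t *s vertex fr)"
    using ternary_form_line[OF F(1), where w = "vertex fr"] by metis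
  have "p \<noteq> 0" using p(2) vertex_nonzero by auto
  then obtain t where "poly p t \<noteq> 0" using poly_all_0_iff_0 by blast
  then have "F (emb fr (dil (Q x) x) t) \<noteq> 0" using p(3) by (simp add: emb_def)
  then have "G (emb fr' x ((t - S x) / R x)) \<noteq> 0" using False by (simp add: G_def \<tau>_emb)
  then show ?thesis by blast
qed

text \<open>Over a zero of \<open>Q\<close> the equation degenerates to
  \<open>(R x * z + S x) ^ d * F (vertex fr)\<close>, whose only zero is the new point; over a zero
  of \<open>R\<close> there is none outside the vertex, by \<open>S_nonzero\<close>.\<close>

lemma sing_at_G_classify:
  assumes w: "sing_at G w" "w \<noteq> 0" "ppt w \<notin> new_points"
  shows "xcoord fr' w \<noteq> 0 \<and> \<kappa>' w \<noteq> 0"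
proof -
  define x z where "x = xcoord fr' w" and "z = zcoord fr' w"
  have wxz: "w = emb fr' x z" using fr' by (simp add: x_def z_def)
  have Gw: "F (emb fr (dil (Q x) x) (R x * z + S x)) = 0"
    using w(1) by (simp add: sing_at_def G_def wxz \<tau>_emb)
  have x0: "x \<noteq> 0"
  proof
    assume "x = 0"
    then have w': "w = z *s vertex fr'" using wxz by (simp add: emb_def zero_prod_def)
    then have "z \<noteq> 0" using w(2) by auto
    then have "ppt w = ppt (vertex fr')" unfolding w' by (rule ppt_scale)
    then show False using w(3) by (simp add: new_points_def)
  qed
  have "R x \<noteq> 0"
  proof
    assume "R x = 0"
    then show False using S_nonzero[OF x0] Gw by simp
  qed
  moreover have "Q x \<noteq> 0"
  proof
    assume Qx: "Q x = 0"
    then have "F ((R x * z + S x) *s vertex fr) = 0" using Gw by (simp add: emb_def)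
    then have "R x * z + S x = 0" unfolding ternary_form_scale[OF F(1)] using vertex_nonzero by simp
    then have z: "z = - S x / R x" using \<open>R x \<noteq> 0\<close> by (simp add: field_simps add_eq_0_iff)
    obtain i where i: "i < length qs" "lin (qs ! i) x = 0" using Qx unfolding Q_eq_0_iff by blast
    then obtain c where c: "c \<noteq> 0" "x = dil c (qs ! i)"
      using lin_eq_0_iff[OF _ x0] line_q by blast
    have "z = c * (- S (qs ! i) / R (qs ! i))"
      unfolding z c(2) binary_form_scale[OF S] binary_form_scale[OF R] using c(1) by simp
    then have "w = c *s new_point i" unfolding wxz new_point_def emb_scale using c(2) by simp
    then have "ppt w = ppt (new_point i)" using ppt_scale[OF c(1)] by simp
    then show False using w(3) i(1) by (simp add: new_points_def)
  qed
  ultimately show ?thesis using x0 by (simp add: \<kappa>'_nonzero_iff x_def)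
qed

text \<open>The representative chosen by \<open>SOME\<close> is irrelevant, as \<sigma> is
  homogeneous.\<close>

definition point_image :: "p2_point \<Rightarrow> p2_point" where
  "point_image p = ppt (\<sigma> (SOME v. v \<in> p))"

definition point_preimage :: "p2_point \<Rightarrow> p2_point" where
  "point_preimage p = ppt (\<tau> (SOME v. v \<in> p))"

lemma ppt_form_map_SOME:
  assumes "form_map e T"
  shows "ppt (T (SOME w. w \<in> ppt v)) = ppt (T v)"
proof -
  obtain c where "c \<noteq> 0" "(SOME w. w \<in> ppt v) = c *s v"
    using ppt_memD[of "SOME w. w \<in> ppt v" v] ppt_self[of v] someI_ex[of "\<lambda>w. w \<in> ppt v"] by blast
  then show ?thesis using ppt_scale[of "c ^ e"] by (simp add: form_map_scale[OF assms])
qed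

lemma point_image_ppt: "point_image (ppt v) = ppt (\<sigma> v)"
  unfolding point_image_def by (rule ppt_form_map_SOME[OF form_map_\<sigma>])

lemma point_preimage_ppt: "point_preimage (ppt v) = ppt (\<tau> v)"
  unfolding point_preimage_def by (rule ppt_form_map_SOME[OF form_map_\<tau>])

lemma bij_betw_point_image:
  "bij_betw point_image (sing_points F) (sing_points G - new_points)"
proof (rule bij_betw_byWitness[where f' = point_preimage])
  have 1: "point_preimage (point_image (ppt v)) = ppt v" if "v \<noteq> 0" "sing_at F v" for v
    using ppt_scale[of "\<kappa> v" v] sing_at_off_lines[OF that(2,1)]
    by (simp add: point_image_ppt point_preimage_ppt \<tau>_\<sigma> \<kappa>_nonzero_iff)
  then show "\<forall>p\<in>sing_points F. point_preimage (point_image p) = p" unfolding sing_points_eq by blast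
  have 2: "point_image (point_preimage (ppt w)) = ppt w" if "w \<noteq> 0" "sing_at G w" "ppt w \<notin> new_points" for w
    using ppt_scale[of "\<kappa>' w" w] sing_at_G_classify[OF that(2,1,3)]
    by (simp add: point_image_ppt point_preimage_ppt \<sigma>_\<tau>)
  then show "\<forall>p\<in>sing_points G - new_points. point_image (point_preimage p) = p" unfolding sing_points_eq by blast
  show "point_image ` sing_points F \<subseteq> sing_points G - new_points"
  proof
    fix q assume "q \<in> point_image ` sing_points F"
    then obtain v where v: "v \<noteq> 0" "sing_at F v" "q = ppt (\<sigma> v)"
      unfolding sing_points_eq by (auto simp: point_image_ppt)
    note off = sing_at_off_lines[OF v(2,1)]
    then have \<kappa>: "\<kappa> v \<noteq> 0" by (simp add: \<kappa>_nonzero_iff)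
    have x: "xcoord fr' (\<sigma> v) \<noteq> 0" "Q (xcoord fr' (\<sigma> v)) \<noteq> 0"
      unfolding xcoord_\<sigma> binary_form_scale[OF Q] using off by (auto simp: prod_eq_iff)
    then have "\<sigma> v \<noteq> 0" using xcoord_scale[of fr' 0 "\<sigma> v"] by (auto simp: zero_prod_def)
    moreover have "sing_at G (\<sigma> v)" using sing_at_G_\<sigma>_iff[OF \<kappa>] v(2) by blast
    moreover have "ppt (\<sigma> v) \<notin> new_points" using new_points_D x by blast
    ultimately show "q \<in> sing_points G - new_points" unfolding v(3) sing_points_eq by blast
  qed
  show "point_preimage ` (sing_points G - new_points) \<subseteq> sing_points F"
  proof
    fix p assume "p \<in> point_preimage ` (sing_points G - new_points)"
    then obtain w where w: "w \<noteq> 0" "sing_at G w" "ppt w \<notin> new_points" "p = ppt (\<tau> w)"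
      unfolding sing_points_eq by (auto simp: point_preimage_ppt)
    note cl = sing_at_G_classify[OF w(2,1,3)]
    then have x: "xcoord fr (\<tau> w) \<noteq> 0" unfolding xcoord_\<tau> \<kappa>'_nonzero_iff by (auto simp: prod_eq_iff)
    then have "\<tau> w \<noteq> 0" using xcoord_scale[of fr 0 "\<tau> w"] by (auto simp: zero_prod_def)
    moreover have "sing_at F (\<tau> w)" using sing_at_F_\<tau> w(2) cl by blast
    ultimately show "p \<in> sing_points F" unfolding w(4) sing_points_eq by blast
  qed
qed

text \<open>Multiplying the lift \<open>\<sigma> \<circ> \<psi>\<close> by a root of \<open>\<kappa>\<close> turns the identity up to a unit into an
  equality of germs.\<close>

lemma transport_local_coords:
  assumes \<psi>: "local_coords \<psi> (ppt v)" and \<kappa>: "\<kappa> v \<noteq> 0"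
  shows "\<exists>\<psi>'. local_coords \<psi>' (ppt (\<sigma> v)) \<and> (\<forall>\<^sub>F x in nhds 0. F (\<psi> x) = G (\<psi>' x))"
proof -
  have "ppt v = ppt (\<psi> 0)" using \<psi> unfolding local_coords_def by blast
  from ppt_eqD[OF this] obtain c where c: "c \<noteq> 0" "\<psi> 0 = c *s v" by blast
  have \<kappa>0: "\<kappa> (\<psi> 0) \<noteq> 0"
    unfolding c(2) ternary_form_scale[OF ternary_form_\<kappa>] using c(1) \<kappa> by simp
  have "ppt (\<sigma> (\<psi> 0)) = ppt (\<sigma> v)"
    unfolding c(2) form_map_scale[OF form_map_\<sigma>] using c(1) by (intro ppt_scale) simp
  then have lc: "local_coords (\<lambda>x. \<sigma> (\<psi> x)) (ppt (\<sigma> v))"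
    using local_coords_form_map[OF form_map_\<sigma> _ form_map_\<tau> _ ternary_form_\<kappa> \<tau>_\<sigma> \<kappa>0 \<psi>] by simp
  have "holo2 (\<lambda>x. \<kappa> (\<psi> x))"
    using \<psi> unfolding local_coords_def by (intro holo2_ternary_form[OF ternary_form_\<kappa>]) blast
  then have "holo2 (\<lambda>x. inverse (\<kappa> (\<psi> x)))" using \<kappa>0 by (rule holo2_inverse)
  from holo2_root[OF this, of "N + 1"] \<kappa>0 obtain l where
    l: "holo2 l" "l 0 \<noteq> 0" "\<forall>\<^sub>F x in nhds 0. l x ^ (N + 1) = inverse (\<kappa> (\<psi> x))" by auto
  have "\<forall>\<^sub>F x in nhds 0. \<kappa> (\<psi> x) \<in> - {0}"
    by (rule eventually_nhds_compose[OF eventually_nhds_in_open holo2_isCont[OF \<open>holo2 (\<lambda>x. \<kappa> (\<psi> x))\<close>]])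
       (use \<kappa>0 in auto)
  with l(3) have "\<forall>\<^sub>F x in nhds 0. F (\<psi> x) = G (l x *s \<sigma> (\<psi> x))"
  proof eventually_elim
    case (elim x)
    have "G (l x *s \<sigma> (\<psi> x)) = (l x ^ (N + 1)) ^ d * (\<kappa> (\<psi> x) ^ d * F (\<psi> x))"
      unfolding ternary_form_scale[OF G] G_\<sigma> by (simp only: power_mult[symmetric] mult.commute)
    also have "\<dots> = F (\<psi> x)" unfolding elim(1) using elim(2) by (simp add: power_inverse)
    finally show ?case ..
  qed
  then show ?thesis using local_coords_scale[OF lc l(1,2)] by blast
qed

text \<open>In this direction no rescaling is necessary: \<open>G\<close> is
  \<open>F \<circ> \<tau>\<close> by definition, so the germs of \<open>G\<close> along \<psi> and
  of \<open>F\<close> along \<open>\<tau> \<circ> \<psi>\<close> are equal.\<close>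

lemma transport_local_coords_back:
  assumes \<psi>: "local_coords \<psi> (ppt (\<sigma> v))" and \<kappa>: "\<kappa> v \<noteq> 0"
  shows "local_coords (\<lambda>x. \<tau> (\<psi> x)) (ppt v)"
proof -
  have "ppt (\<sigma> v) = ppt (\<psi> 0)" using \<psi> unfolding local_coords_def by blast
  from ppt_eqD[OF this] obtain c where c: "c \<noteq> 0" "\<psi> 0 = c *s \<sigma> v" by blast
  have "\<kappa>' (\<sigma> v) \<noteq> 0"
    unfolding \<kappa>'_nonzero_iff xcoord_\<sigma> binary_form_scale[OF Q] binary_form_scale[OF R]
    using \<kappa> by (simp add: \<kappa>_nonzero_iff)
  then have \<kappa>0: "\<kappa>' (\<psi> 0) \<noteq> 0"
    unfolding c(2) ternary_form_scale[OF ternary_form_\<kappa>'] using c(1) by simp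
  have "ppt (\<tau> (\<psi> 0)) = ppt (c ^ (N + 1) * \<kappa> v *s v)"
    unfolding c(2) form_map_scale[OF form_map_\<tau>] \<tau>_\<sigma> by (simp add: vector_smult_assoc)
  also have "\<dots> = ppt v" using c(1) \<kappa> by (intro ppt_scale) simp
  finally show ?thesis
    using local_coords_form_map[OF form_map_\<tau> _ form_map_\<sigma> _ ternary_form_\<kappa>' \<sigma>_\<tau> \<kappa>0 \<psi>] by simp
qed

lemma exists_local_coords:
  assumes "xcoord fr v \<noteq> 0"
  shows "\<exists>\<psi>. local_coords \<psi> (ppt v)"
proof -
  obtain a' where "lin (xcoord fr v) a' \<noteq> 0" using exists_lin_neq_0[OF assms] by blast
  moreover have "holo2 (\<lambda>x. zcoord fr v + snd x)" by (intro holo2_add) auto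
  moreover have "((\<lambda>x. zcoord fr v + snd x) has_derivative (\<lambda>(h, k). 0 * h + 1 * k)) (at (0 :: complex \<times> complex))"
    by (auto simp: case_prod_unfold intro!: derivative_eq_intros)
  ultimately show ?thesis
    using local_coords_emb[OF fr, of "\<lambda>x. zcoord fr v + snd x" 0 1 "xcoord fr v" a'] fr by auto
qed

lemma point_image_isomorphic:
  assumes "p \<in> sing_points F"
  shows "locally_isomorphic F p G (point_image p) \<and> (\<forall>t. has_type F p t \<longleftrightarrow> has_type G (point_image p) t)"
proof -
  obtain v where v: "v \<noteq> 0" "sing_at F v" "p = ppt v" using assms unfolding sing_points_eq by blast
  note off = sing_at_off_lines[OF v(2,1)]
  then have \<kappa>: "\<kappa> v \<noteq> 0" by (simp add: \<kappa>_nonzero_iff)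
  have "locally_isomorphic F p G (point_image p)"
    using exists_local_coords transport_local_coords \<kappa> off
    unfolding locally_isomorphic_def v(3) point_image_ppt by blast
  moreover have "has_type F p t \<longleftrightarrow> has_type G (point_image p) t" for t
  proof
    assume "has_type F p t"
    then obtain \<psi> where \<psi>: "local_coords \<psi> (ppt v)" "germ_type (F \<circ> \<psi>) t" unfolding has_type_def v(3) by blast
    obtain \<psi>' where \<psi>': "local_coords \<psi>' (ppt (\<sigma> v))" "\<forall>\<^sub>F x in nhds 0. F (\<psi> x) = G (\<psi>' x)"
      using transport_local_coords[OF \<psi>(1) \<kappa>] by blast
    have "germ_type (G \<circ> \<psi>') t" by (rule germ_type_cong[OF \<psi>(2)]) (use \<psi>'(2) in simp)
    then show "has_type G (point_image p) t" unfolding has_type_def v(3) point_image_ppt using \<psi>'(1) by blast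
  next
    assume "has_type G (point_image p) t"
    then obtain \<psi> where \<psi>: "local_coords \<psi> (ppt (\<sigma> v))" "germ_type (G \<circ> \<psi>) t"
      unfolding has_type_def v(3) point_image_ppt by blast
    have "G \<circ> \<psi> = F \<circ> (\<lambda>x. \<tau> (\<psi> x))" by (simp add: G_def fun_eq_iff)
    then show "has_type F p t"
      unfolding has_type_def v(3) using \<psi>(2) transport_local_coords_back[OF \<psi>(1) \<kappa>] by metis
  qed
  ultimately show ?thesis by blast
qed

lemma distinct_new_points: "distinct (ppt (vertex fr') # map (\<lambda>i. ppt (new_point i)) [0..<length qs])"
proof -
  have v: "ppt (vertex fr') \<noteq> ppt (new_point i)" if "i < length qs" for i
  proof
    assume "ppt (vertex fr') = ppt (new_point i)"
    from ppt_eqD[OF this] obtain c where "new_point i = c *s emb fr' (0, 0) 1" unfolding vertex_eq_emb by blast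
    then have "emb fr' (qs ! i) (- S (qs ! i) / R (qs ! i)) = emb fr' (0, 0) c"
      unfolding new_point_def emb_scale by simp
    then show False using emb_inject[OF fr'] line_q[OF that] by (auto simp: zero_prod_def)
  qed
  have "i = j" if "i < length qs" "j < length qs" "ppt (new_point i) = ppt (new_point j)" for i j
  proof (rule ccontr)
    assume "i \<noteq> j"
    from ppt_eqD[OF that(3)] obtain c where "new_point j = c *s new_point i" by blast
    then have "qs ! j = dil c (qs ! i)"
      unfolding new_point_def emb_scale emb_inject[OF fr'] by blast
    then have "lin (qs ! i) (qs ! j) = 0" by (simp add: lin_def)
    then show False using lin_qq that \<open>i \<noteq> j\<close> by blast
  qed
  then have "inj_on (\<lambda>i. ppt (new_point i)) {0..<length qs}" by (intro inj_onI) simp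
  moreover have "ppt (vertex fr') \<notin> (\<lambda>i. ppt (new_point i)) ` {0..<length qs}"
  proof
    assume "ppt (vertex fr') \<in> (\<lambda>i. ppt (new_point i)) ` {0..<length qs}"
    then obtain i where "i < length qs" "ppt (vertex fr') = ppt (new_point i)" by auto
    with v show False by blast
  qed
  ultimately show ?thesis by (simp add: distinct_map)
qed

end

section \<open>Reducedness\<close>

lemma infinite_punctured_nhds:
  assumes "\<forall>\<^sub>F u in nhds (0 :: complex). u \<noteq> 0 \<longrightarrow> P u"
  shows "infinite {u. P u}"
proof -
  obtain e where e: "e > 0" "\<And>u. dist u 0 < e \<Longrightarrow> u \<noteq> 0 \<Longrightarrow> P u"
    using assms unfolding eventually_nhds_metric by blast
  have "infinite (ball (0 :: complex) e - {0})"
    using uncountable_ball[OF e(1), of "0 :: complex"] countable_finite by (simp add: infinite_remove) blast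
  moreover have "ball 0 e - {0} \<subseteq> {u. P u}" using e(2) by (auto simp: dist_commute)
  ultimately show ?thesis using finite_subset by blast
qed

lemma poly_eq_of_infinite:
  fixes p q :: "complex poly"
  assumes "infinite {u. poly p u = poly q u}"
  shows "p = q"
proof (rule ccontr)
  assume "p \<noteq> q"
  then have "finite {u. poly (p - q) u = 0}" by (intro poly_roots_finite) simp
  then show False using assms by simp
qed

lemma poly_no_roots_constant:
  fixes p :: "complex poly"
  assumes "\<And>u. poly p u \<noteq> 0"
  shows "poly p u = poly p 0"
proof -
  have "constant (poly p)" using assms fundamental_theorem_of_algebra by blast
  then show ?thesis unfolding constant_def by blast
qed

lemma sing_at_square_mult:
  assumes "ternary_form r g" "ternary_form m h" "g w = 0"
  shows "sing_at (\<lambda>v. (g v)\<^sup>2 * h v) w"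
proof -
  obtain D where D: "(g has_derivative D) (at w)" using ternary_form_has_derivative_at[OF assms(1)] by blast
  obtain E where E: "(h has_derivative E) (at w)" using ternary_form_has_derivative_at[OF assms(2)] by blast
  from has_derivative_mult[OF has_derivative_mult[OF D D] E] assms(3)
  show ?thesis unfolding sing_at_def by (simp add: power2_eq_square)
qed

context cremona_curve
begin

text \<open>For small \<open>u\<close> the roots \<open>\<rho> i u\<close> are distinct, so
  \<open>F\<close> has simple zeros on the line over \<open>u\<close> and its derivative in the
  direction of the vertex is nonzero at each of them. The statement covers all \<open>z\<close> at
  once.\<close>

lemma eventually_not_sing_at:
  assumes a: "a \<noteq> 0" "meets_transversally F (vertex fr) (direction fr a)"
  shows "\<forall>\<^sub>F u in nhds 0. \<forall>z. \<not> sing_at F (emb fr (line_at a a' u) z)"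
proof -
  obtain \<rho> where "branch_family a a' \<rho>" using branch_family_exists[OF a] by blast
  note \<rho> = branch_familyD[OF this]
  from \<rho>(3) show ?thesis
  proof eventually_elim
    case (elim u)
    define x where "x = line_at a a' u"
    have Fx: "F (emb fr x w) = F (vertex fr) * (\<Prod>i<d. w - \<rho> i u)" for w
      using elim[THEN conjunct2, rule_format, of 1 w] by (simp add: x_def)
    show ?case
    proof (intro allI notI)
      fix z assume "sing_at F (emb fr (line_at a a' u) z)"
      then have sing: "sing_at F (emb fr x z)" by (simp add: x_def)
      have "\<not> germ_singular (\<lambda>p. F (vertex fr) * (\<Prod>i<d. z + snd p - \<rho> i u))"
      proof (rule not_germ_singular_prod)
        fix i j assume "i < d" "j < d" "z + snd 0 - \<rho> i u = 0" "z + snd 0 - \<rho> j u = 0"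
        moreover from this have "\<rho> i u = \<rho> j u" by simp
        ultimately show "i = j" using elim by blast
      next
        fix i
        show "holo2 (\<lambda>p. z + snd p - \<rho> i u)" by (intro holo2_diff holo2_add holo2_const holo2_snd)
        show "\<exists>c. c \<noteq> 0 \<and> ((\<lambda>t. z + snd (0, t) - \<rho> i u) has_field_derivative c) (at 0)"
          by (rule exI[of _ 1]) (auto intro!: derivative_eq_intros)
      qed (use vertex_nonzero in auto)
      moreover have "germ_singular (\<lambda>p. F (emb fr x (z + snd p)))"
      proof -
        have "((\<lambda>p. emb fr x (z + snd p)) has_derivative (\<lambda>h. snd h *s vertex fr)) (at (0 :: complex \<times> complex))"
          by (rule has_derivative_vec, unfold emb_component) (rule derivative_eq_intros refl | simp)+
        from has_derivative_compose[OF this, of F "\<lambda>_. 0"] sing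
        show ?thesis unfolding germ_singular_def sing_at_def by simp
      qed
      ultimately show False unfolding Fx by blast
    qed
  qed
qed

lemma reduced_G: "reduced_curve (d * (N + 1)) G"
  unfolding reduced_curve_def plane_curve_def
proof (intro conjI allI impI notI G)
  have "((1 :: complex), (0 :: complex)) \<noteq> 0" by (simp add: zero_prod_def)
  then show "\<exists>v. G v \<noteq> 0" using ex_G_nonzero_on_line by blast
next
  fix r g h
  assume *: "1 \<le> r \<and> 2 * r \<le> d * (N + 1) \<and> ternary_form r g \<and> ternary_form (d * (N + 1) - 2 * r) h"
    and Gg: "G = (\<lambda>v. (g v)\<^sup>2 * h v)"
  then have r: "r \<ge> 1" and g: "ternary_form r g" and h: "ternary_form (d * (N + 1) - 2 * r) h" by auto
  have len: "0 < length qs" using nonempty lengths by simp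
  define a where "a = qs ! 0"
  have a: "a \<noteq> 0" "meets_transversally F (vertex fr) (direction fr a)" using line_q[OF len] by (auto simp: a_def)
  obtain a' where a': "lin a a' \<noteq> 0" using exists_lin_neq_0[OF a(1)] by blast
  define X where "X = (\<lambda>u. line_at a a' u)"
  have X0: "X 0 = a" by (simp add: X_def)
  obtain e m where e: "binary_form m e" "\<And>x. Q x = lin a x ^ (ns ! 0) * e x" "e a \<noteq> 0"
    using line_prod_factor[of 0 qs ns] len lin_qq unfolding Q_def a_def by metis
  have ev: "\<forall>\<^sub>F u in nhds 0. q (X u) \<in> - {0}" if "binary_form m q" "q a \<noteq> 0" for q m
    by (rule eventually_nhds_compose[OF eventually_nhds_in_open])
       (use that binary_form_analytic[OF that(1)] in \<open>auto simp: X_def intro: analytic_at_imp_isCont\<close>)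
  have "R a \<noteq> 0" using R_at_line[OF len] by (simp add: a_def)
  have line_poly: "\<exists>p. degree p \<le> r \<and> coeff p r = g (emb fr' y 0) \<and> (\<forall>t. poly p t = g (emb fr' (line_at x y t) z))"
    for x y z
  proof -
    have "emb fr' (line_at x y t) z = emb fr' x z + t *s emb fr' y 0" for t
      by (simp add: vec_eq_iff emb_component algebra_simps)
    then show ?thesis using ternary_form_line[OF g, of "emb fr' y 0" "emb fr' x z"] by simp
  qed
  \<comment> \<open>A zero of \<open>g\<close> on such a line would be a singular point of
    \<open>G\<close> off the lines, hence give one of \<open>F\<close>. So \<open>g\<close> has no
    zeros there, and a polynomial without zeros is constant. The value \<open>u = 0\<close> is
    excluded because \<open>Q\<close> vanishes on the line itself.\<close>
  have const_near: "\<forall>\<^sub>F u in nhds 0. u \<noteq> 0 \<longrightarrow> (\<forall>z. g (emb fr' (X u) z) = g (emb fr' (X u) 0))"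
    using eventually_not_sing_at[OF a, of a'] ev[OF e(1,3)] ev[OF R \<open>R a \<noteq> 0\<close>]
  proof eventually_elim
    case (elim u)
    show ?case
    proof (intro impI allI)
      fix z assume u: "u \<noteq> 0"
      define x where "x = X u"
      have "lin a x = u * lin a a'" by (simp add: x_def X_def lin_line)
      then have QR: "Q x \<noteq> 0" "R x \<noteq> 0" unfolding e(2) using u a' elim by (simp_all add: x_def)
      have nz: "g (emb fr' x z) \<noteq> 0" for z
      proof
        assume "g (emb fr' x z) = 0"
        from sing_at_square_mult[OF g h this] have "sing_at G (emb fr' x z)" unfolding Gg .
        moreover have "\<kappa>' (emb fr' x z) \<noteq> 0" unfolding \<kappa>'_nonzero_iff using QR fr' by simp
        ultimately have "sing_at F (\<tau> (emb fr' x z))" by (rule sing_at_F_\<tau>)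
        \<comment> \<open>Dividing by \<open>Q x\<close> brings the point back to the representative
          \<open>x\<close> used by \<open>eventually_not_sing_at\<close>.\<close>
        from sing_at_scale[OF F(1) _ this, of "1 / Q x"] QR
        have "sing_at F (emb fr x ((R x * z + S x) / Q x))" by (simp add: \<tau>_emb emb_scale)
        then show False using elim(1) by (simp add: x_def X_def)
      qed
      obtain p where p: "\<And>t. poly p t = g (emb fr' x 0 + t *s vertex fr')"
        using ternary_form_line[OF g, where w = "vertex fr'"] by metis
      have "poly p t = g (emb fr' x t)" for t using p by (simp add: emb_def)
      then show "g (emb fr' (X u) z) = g (emb fr' (X u) 0)"
        using poly_no_roots_constant[of p z] nz by (simp add: x_def)
    qed
  qed
  \<comment> \<open>Both sides are polynomials in \<open>u\<close> that agree for infinitely many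
    \<open>u\<close>, so independence of \<open>z\<close> holds in the whole pencil.\<close>
  have const: "g (emb fr' (X u) z) = g (emb fr' (X u) 0)" for u z
  proof -
    obtain p where p: "\<And>t. poly p t = g (emb fr' (X t) z)" using line_poly[of a' a z] unfolding X_def by blast
    obtain q where q: "\<And>t. poly q t = g (emb fr' (X t) 0)" using line_poly[of a' a 0] unfolding X_def by blast
    have "infinite {u. poly p u = poly q u}"
      by (rule infinite_punctured_nhds) (use const_near in \<open>simp add: p q; auto elim: eventually_mono\<close>)
    then have "p = q" by (rule poly_eq_of_infinite)
    then show ?thesis using p q by metis
  qed
  \<comment> \<open>Up to scalars the directions are the \<open>X u\<close> and \<open>a'\<close>.
    If \<open>g\<close> vanishes at no \<open>X u\<close>, it is constant along them, and its
    homogeneity makes it vanish at \<open>a'\<close>.\<close>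
  have "\<exists>x. x \<noteq> 0 \<and> (\<forall>z. g (emb fr' x z) = 0)"
  proof (cases "\<exists>u. g (emb fr' (X u) 0) = 0")
    case True
    then obtain u where u: "g (emb fr' (X u) 0) = 0" by blast
    have "X u \<noteq> 0"
    proof
      assume "X u = 0"
      then have "fst a + u * fst a' = 0" "snd a + u * snd a' = 0" by (simp_all add: X_def zero_prod_def)
      then have "lin a a' = 0" unfolding lin_def by algebra
      then show False using a' by blast
    qed
    moreover have "g (emb fr' (X u) z) = 0" for z using const u by metis
    ultimately show ?thesis by blast
  next
    case False
    obtain q where q: "\<And>t. poly q t = g (emb fr' (X t) 0)" using line_poly[of a' a 0] unfolding X_def by blast
    define k where "k = poly q 0"
    have k: "g (emb fr' (X u) z) = k" for u z
      using const[of u z] poly_no_roots_constant[of q u] q False by (simp add: k_def)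
    have "g (emb fr' a' z) = 0" for z
    proof -
      obtain p where p: "\<And>t. poly p t = g (emb fr' (line_at a' a t) z)"
        using line_poly[of a a' z] by blast
      \<comment> \<open>Rescaling by \<open>t\<close> turns the constant \<open>k\<close> into
        \<open>k * t ^ r\<close> for \<open>t \<noteq> 0\<close>, hence identically; at
        \<open>t = 0\<close>, the direction \<open>a'\<close>, this is 0 because
        \<open>r \<ge> 1\<close>.\<close>
      have "poly p t = poly (monom k r) t" if "t \<noteq> 0" for t
      proof -
        have "emb fr' (line_at a' a t) z = t *s emb fr' (X (1 / t)) (z / t)"
          using that by (simp add: X_def emb_scale algebra_simps)
        then show ?thesis unfolding p by (simp add: ternary_form_scale[OF g] k poly_monom)
      qed
      then have "infinite {t. poly p t = poly (monom k r) t}" by (intro infinite_punctured_nhds) auto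
      then have "p = monom k r" by (rule poly_eq_of_infinite)
      then show ?thesis using p[of 0] r by (simp add: poly_monom power_0_left)
    qed
    moreover have "a' \<noteq> 0" using a' by (auto simp: lin_def)
    ultimately show ?thesis by blast
  qed
  then obtain x where x: "x \<noteq> 0" "\<And>z. g (emb fr' x z) = 0" by blast
  obtain z where "G (emb fr' x z) \<noteq> 0" using ex_G_nonzero_on_line[OF x(1)] by blast
  then show False unfolding Gg using x(2) by simp
qed

end

section \<open>From the lists of steps to the locale, and the conclusion\<close>

lemma length_repeat_each: "length ns = length xs \<Longrightarrow> length (repeat_each ns xs) = sum_list ns"
  unfolding repeat_each_def by (induction ns xs rule: list_induct2) auto

lemma set_repeat_each: "set (repeat_each ns xs) \<subseteq> set xs"
  unfolding repeat_each_def by (auto dest: set_zip_rightD)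

lemma lin_prod_repeat_each:
  "length ns = length xs \<Longrightarrow> lin_prod (repeat_each ns xs) x = line_prod xs ns x"
  unfolding repeat_each_def line_prod_def
  by (induction ns xs rule: list_induct2) (simp_all del: prod.lessThan_Suc add: prod.lessThan_Suc_shift prod_list_replicate)

theorem proposition5p5:
  fixes F :: "complex ^ 3 \<Rightarrow> complex" and d :: nat
    and ns ms :: "nat list"
    and fr fr' :: frame
    and qs ps :: "p1_coord list"
    and cs :: "(p1_coord \<Rightarrow> complex) list"
  assumes "plane_curve d F" and "d \<ge> 2"
    and "ns \<noteq> []" and "\<forall>n \<in> set ns. n \<ge> 1" and "\<forall>m \<in> set ms. m \<ge> 1"
    and "sum_list ns = sum_list ms"
    and "length qs = length ns" and "length ps = length ms" and "length cs = sum_list ms"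
    and "admissible_lines F fr qs ps"
    and "second_centres_ok (sum_list ns + 1) (second_steps ms ps cs)
           (curve_on_top fr (first_steps ns qs) F)"
    and "is_frame fr'"
  shows "\<exists>e G. reduced_curve e G \<and>
    curve_points G = cremona_image fr fr' (first_steps ns qs) (second_steps ms ps cs) F \<and>
    (\<exists>pts h. let centre = ppt (vertex fr'); new = set (centre # pts) in
       length pts = length ns \<and> distinct (centre # pts) \<and> new \<subseteq> sing_points G \<and>
       bij_betw h (sing_points F) (sing_points G - new) \<and>
       (\<forall>p \<in> sing_points F.
          (p, h p) \<in> cremona_rel fr fr' (first_steps ns qs) (second_steps ms ps cs) \<and>
          locally_isomorphic F p G (h p) \<and> (\<forall>\<tau>. has_type F p \<tau> \<longleftrightarrow> has_type G (h p) \<tau>)) \<and>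
       (\<forall>i < length ns. tacnode_at d (ns ! i - 1) G (pts ! i) \<and>
          has_type G (pts ! i) (rep_type d (ns ! i))) \<and>
       blow_down_of_tacnodes d (map (\<lambda>m. m - 1) ms) G centre \<and>
       has_type G centre (Sing (d * sum_list ns) (map (rep_type d) ms)))"
proof -
  define as bs N where "as = first_steps ns qs" and "bs = second_steps ms ps cs" and "N = sum_list ns"
  define Q R where "Q = line_prod qs ns" and "R = line_prod ps ms"
  have F: "ternary_form d F" using assms(1) unfolding plane_curve_def by blast
  have vertex: "F (vertex fr) \<noteq> 0" and fr: "is_frame fr"
    and nz: "\<forall>a\<in>set qs. a \<noteq> 0" "\<forall>a\<in>set ps. a \<noteq> 0"
    using assms(10) unfolding admissible_lines_def by auto
  have len_as: "length as = N"
    unfolding as_def first_steps_def N_def using assms(7) by (simp add: length_repeat_each)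
  have len_ps: "length (repeat_each ms ps) = length cs" using assms(8,9) by (simp add: length_repeat_each)
  have len_bs: "length bs = length as"
    unfolding len_as bs_def second_steps_def N_def using len_ps assms(6,9) by simp
  have fst_bs: "map fst bs = repeat_each ms ps"
    unfolding bs_def second_steps_def using len_ps by simp
  have "N \<ge> 1" using assms(3,4) unfolding N_def by (cases ns) auto
  have QR: "Q = lin_prod as" "R = lin_prod (map fst bs)"
    unfolding Q_def R_def fst_bs as_def first_steps_def
    using lin_prod_repeat_each[of ns qs] lin_prod_repeat_each[of ms ps] assms(7,8) by auto
  have as: "as \<noteq> []" using len_as \<open>N \<ge> 1\<close> by auto
  have as0: "\<forall>a\<in>set as. a \<noteq> 0"
    using nz(1) set_repeat_each[of ns qs] unfolding as_def first_steps_def by blast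
  have bs0: "\<forall>b\<in>set bs. fst b \<noteq> 0"
  proof
    fix b assume "b \<in> set bs"
    then have "fst b \<in> set (map fst bs)" by simp
    then have "fst b \<in> set ps" unfolding fst_bs by (rule subsetD[OF set_repeat_each])
    then show "fst b \<noteq> 0" using nz(2) by blast
  qed
  have ok: "second_centres_ok (length as + 1) bs (curve_on_top fr as F)"
    using assms(11) len_as unfolding as_def bs_def N_def by simp
  have d1: "d \<ge> 1" using assms(2) by simp
  obtain S where data: "binary_form (length as + 1) S"
    "\<And>x. x \<noteq> 0 \<Longrightarrow> R x = 0 \<Longrightarrow> F (emb fr (dil (Q x) x) (S x)) \<noteq> 0"
    "curve_points (\<lambda>v. F (cremona_map fr' fr Q R S v)) = cremona_image fr fr' as bs F"
    "\<And>v. xcoord fr v \<noteq> 0 \<Longrightarrow> Q (xcoord fr v) \<noteq> 0 \<Longrightarrow> R (xcoord fr v) \<noteq> 0 \<Longrightarrow>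
       (ppt v, ppt (cremona_map fr fr' R Q (\<lambda>x. - S x) v)) \<in> cremona_rel fr fr' as bs"
    by (rule cremona_data[OF F d1 vertex fr assms(12) as as0 bs0 len_bs ok QR]) (rule that)
  interpret cremona_curve F d N fr fr' qs ps ns ms S Q R
    using F assms data(1,2) len_as by unfold_locales (simp_all add: N_def Q_def R_def)
  define pts where "pts = map (\<lambda>i. ppt (new_point i)) [0..<length qs]"
  have new: "insert (ppt (vertex fr')) (set pts) = new_points" by (simp add: pts_def new_points_def)
  have "new_points \<subseteq> sing_points G"
    using sing_at_new new_point_nonzero vertex'_nonzero
    unfolding new_points_def sing_points_eq by auto
  moreover have "(p, point_image p) \<in> cremona_rel fr fr' as bs" if "p \<in> sing_points F" for p
  proof -
    obtain v where v: "v \<noteq> 0" "sing_at F v" "p = ppt v" using \<open>p \<in> sing_points F\<close> unfolding sing_points_eq by blast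
    show ?thesis
      using data(4)[of v] sing_at_off_lines[OF v(2,1)] unfolding v(3) point_image_ppt \<sigma>_def by blast
  qed
  moreover have "tacnode_at d (ns ! i - 1) G (pts ! i) \<and> has_type G (pts ! i) (rep_type d (ns ! i))"
    if "i < length ns" for i
    using point_q_tacnode[of i] that assms(7) by (simp add: pts_def new_point_def)
  moreover have "length pts = length ns" using assms(7) by (simp add: pts_def)
  moreover have "curve_points G = cremona_image fr fr' as bs F"
    using data(3) by (simp add: G_def \<tau>_def)
  \<comment> \<open>The degree of \<open>G\<close> is that of \<open>F\<close> times the degree
    \<open>N + 1\<close> of \<tau>.\<close>
  ultimately show ?thesis
    using reduced_G distinct_new_points bij_betw_point_image point_image_isomorphic centre_singularity
    unfolding as_def[symmetric] bs_def[symmetric] N_def[symmetric] Let_def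
    by (intro exI[of _ "d * (N + 1)"] exI[of _ G] exI[of _ pts] exI[of _ point_image] conjI)
       (simp_all add: new pts_def[symmetric] del: insert_subset)
qed

end
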